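(* Let $n\ge 3$ and let $\Sigma\subset\mathbb{R}^{n+1}$ be an $(n-1)$-dimensional $C^2$ manifold satisfying the non-degenerate condition (defined in the context). Let $Z\subset\mathbb{R}^{n+1}$ be an analytic set and let $0<s<\min\{\dim_H Z,1\}$. Then $$\dim_H\{z\in\Sigma:\ \dim_H(Z\cdot z)<s\}\le (n-2)+s.$$ In particular, for $\mathcal{H}^{n-1}$-almost every $z\in\Sigma$, $\dim_H(Z\cdot z)=\min\{\dim_H Z,1\}$.
   Context: $\dim_H$ denotes Hausdorff dimension, $\mathcal{H}^{n-1}$ the $(n-1)$-dimensional Hausdorff measure, and $Z\cdot z:=\{w\cdot z:w\in Z\}$ with $\cdot$ the Euclidean inner product. An $(n-1)$-dimensional $C^2$ manifold $\Sigma\subset\mathbb{R}^{n+1}$ ($n\ge3$) satisfies the non-degenerate condition if: (i) there is a $C^2$ vector field $\nu:\Sigma\to\mathbb{R}^{n+1}$ with $\nu(x)\perp x$, $\nu(x)\perp T_x\Sigma$ and $\mathrm{span}\{x,T_x\Sigma,\nu(x)\}=\mathbb{R}^{n+1}$ for all $x\in\Sigma$; and (ii) for every $x\in\Sigma$ and every pair of $C^2$ curves $\gamma_1,\gamma_2:[-1,1]\to\Sigma$ with $\gamma_i(0)=x$ and $\dot\gamma_i(t)\neq0$ for all $t\in[-1,1]$, $i=1,2$, one has $\langle\ddot\gamma_1(0),\nu(x)\rangle\,\langle\ddot\gamma_2(0),\nu(x)\rangle>0$. *)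

theory Defs
  imports "HOL-Analysis.Analysis"
begin

definition diam_pow :: "real \<Rightarrow> 'a::metric_space set \<Rightarrow> real" where
  "diam_pow s C = (if C = {} then 0 else if s = 0 then 1 else diameter C powr s)"

definition hausdorff_pre :: "real \<Rightarrow> real \<Rightarrow> 'a::metric_space set \<Rightarrow> ennreal" where
  "hausdorff_pre s \<delta> A =
     (INF C \<in> {C :: nat \<Rightarrow> 'a set. A \<subseteq> (\<Union>i. C i) \<and> (\<forall>i. bounded (C i) \<and> diameter (C i) \<le> \<delta>)}.
        (\<Sum>i. ennreal (diam_pow s (C i))))"

definition hausdorff_measure :: "real \<Rightarrow> 'a::metric_space set \<Rightarrow> ennreal" where
  "hausdorff_measure s A = (SUP \<delta> \<in> {0<..}. hausdorff_pre s \<delta> A)"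

text \<open>Hausdorff dimension: inf of s >= 0 with H^s(A) = 0 (for subsets of Euclidean
  spaces this set is nonempty and bounded below).\<close>
definition hausdorff_dim :: "'a::metric_space set \<Rightarrow> real" where
  "hausdorff_dim A = Inf {s. 0 \<le> s \<and> hausdorff_measure s A = 0}"

definition analytic_set :: "'a::topological_space set \<Rightarrow> bool" where
  "analytic_set Z \<longleftrightarrow> Z = {} \<or>
     (\<exists>f :: (nat \<Rightarrow> nat) \<Rightarrow> 'a. continuous_on UNIV f \<and> Z = range f)"

definition C2_on :: "('a::euclidean_space \<Rightarrow> 'b::euclidean_space) \<Rightarrow> 'a set \<Rightarrow> bool" where
  "C2_on f U \<longleftrightarrow>
     (\<exists>(f' :: 'a \<Rightarrow> 'a \<Rightarrow>\<^sub>L 'b) (f'' :: 'a \<Rightarrow> 'a \<Rightarrow>\<^sub>L ('a \<Rightarrow>\<^sub>L 'b)).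
        (\<forall>x\<in>U. (f has_derivative blinfun_apply (f' x)) (at x)) \<and>
        (\<forall>x\<in>U. (f' has_derivative blinfun_apply (f'' x)) (at x)) \<and>
        continuous_on U f'')"

definition C2_fun_on :: "'a::euclidean_space set \<Rightarrow> ('a \<Rightarrow> 'b::euclidean_space) \<Rightarrow> bool" where
  "C2_fun_on S g \<longleftrightarrow>
     (\<forall>x\<in>S. \<exists>U h. open U \<and> x \<in> U \<and> C2_on h U \<and> (\<forall>y\<in>S \<inter> U. h y = g y))"

definition C2_submanifold :: "nat \<Rightarrow> 'a::euclidean_space set \<Rightarrow> bool" where
  "C2_submanifold k M \<longleftrightarrow>
     (\<forall>x\<in>M. \<exists>U V L (\<phi> :: 'a \<Rightarrow> 'a) (\<psi> :: 'a \<Rightarrow> 'a) (\<phi>' :: 'a \<Rightarrow> 'a \<Rightarrow> 'a).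
        open U \<and> x \<in> U \<and> open V \<and> subspace L \<and> dim L = k \<and>
        C2_on \<phi> V \<and>
        homeomorphism (V \<inter> L) (M \<inter> U) \<phi> \<psi> \<and>
        (\<forall>v\<in>V. (\<phi> has_derivative \<phi>' v) (at v)) \<and>
        (\<forall>v\<in>V \<inter> L. inj_on (\<phi>' v) L))"

definition tangent_space :: "'a::euclidean_space set \<Rightarrow> 'a \<Rightarrow> 'a set" where
  "tangent_space M x =
     {v. \<exists>\<gamma> :: real \<Rightarrow> 'a. \<gamma> ` {-1..1} \<subseteq> M \<and> \<gamma> 0 = x \<and>
          (\<gamma> has_vector_derivative v) (at 0 within {-1..1})}"

definition C2_curve :: "(real \<Rightarrow> 'a::euclidean_space) \<Rightarrow> (real \<Rightarrow> 'a) \<Rightarrow> (real \<Rightarrow> 'a) \<Rightarrow> bool" where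
  "C2_curve \<gamma> d1 d2 \<longleftrightarrow>
     (\<forall>t\<in>{-1..1}. (\<gamma> has_vector_derivative d1 t) (at t within {-1..1}) \<and>
                   (d1 has_vector_derivative d2 t) (at t within {-1..1})) \<and>
     continuous_on {-1..1} d2"

definition nondegenerate :: "'a::euclidean_space set \<Rightarrow> bool" where
  "nondegenerate \<Sigma> \<longleftrightarrow>
     (\<exists>\<nu> :: 'a \<Rightarrow> 'a. C2_fun_on \<Sigma> \<nu> \<and>
        (\<forall>x\<in>\<Sigma>. \<nu> x \<bullet> x = 0 \<and> (\<forall>v\<in>tangent_space \<Sigma> x. \<nu> x \<bullet> v = 0) \<and>
                 span (insert x (insert (\<nu> x) (tangent_space \<Sigma> x))) = UNIV) \<and>
        (\<forall>x\<in>\<Sigma>. \<forall>\<gamma>1 \<gamma>2 d1 d2 e1 e2.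
            C2_curve \<gamma>1 d1 e1 \<and> C2_curve \<gamma>2 d2 e2 \<and>
            \<gamma>1 ` {-1..1} \<subseteq> \<Sigma> \<and> \<gamma>2 ` {-1..1} \<subseteq> \<Sigma> \<and>
            \<gamma>1 0 = x \<and> \<gamma>2 0 = x \<and>
            (\<forall>t\<in>{-1..1}. d1 t \<noteq> 0 \<and> d2 t \<noteq> 0) \<longrightarrow>
            (e1 0 \<bullet> \<nu> x) * (e2 0 \<bullet> \<nu> x) > 0))"

definition dotset :: "'a::real_inner set \<Rightarrow> 'a \<Rightarrow> real set" where
  "dotset Z z = (\<lambda>w. w \<bullet> z) ` Z"

end

theory Submission
  imports Defs
begin

text \<open>
  The argument is Kaufman's. In a chart of \<open>\<Sigma>\<close> around a point \<open>x\<close> let \<open>f\<close> be the function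
  \<open>z \<mapsto> z \<bullet> w\<close> for a unit vector \<open>w\<close>. If \<open>f\<close> and its gradient both vanish at \<open>x\<close>, then \<open>w\<close> is a
  multiple of \<open>\<nu> x\<close>, and condition (ii) makes the Hessian of \<open>f\<close> definite. Cutting \<open>\<bar>f\<bar> \<le> \<rho>\<close> into dyadic
  shells of the gradient gives, for weights with \<open>m(B(z,r)) \<le> r\<^sup>t\<close> and \<open>t = k - 1 + \<sigma>\<close> with
  \<open>k = dim \<Sigma> \<ge> 2\<close> and \<open>\<sigma>\<close> slightly larger than \<open>s\<close>, that \<open>m{\<bar>f\<bar> \<le> \<rho>}\<close> is at most a constant times
  \<open>\<rho>\<^sup>\<sigma>\<close>; here \<open>k \<ge> 2\<close> is what makes the degenerate directions harmless. If \<open>Z \<cdot> z\<close> has small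
  dimension, then at some scale \<open>2\<^sup>-\<^sup>j\<close> few intervals carry much of the mass of \<open>Z\<close>, so many pairs of
  points of \<open>Z\<close> have close images under \<open>z\<close>; counting these pairs over all such \<open>z\<close> bounds the content
  of the exceptional set at that scale by a power of \<open>2\<^sup>-\<^sup>j\<close>, which is summable.

  No measure is constructed: every scale uses finitely supported weights, and the passage to the
  limit, both for the analytic set \<open>Z\<close> and for the exceptional set, is the continuity of the dyadic
  content along increasing sequences of arbitrary sets.
\<close>

section \<open>Contents on nets\<close>

text \<open>No measurability is available for the exceptional set, so it is reached from inside:
  \<open>EJ J\<close> collects the \<open>z\<close> whose cover uses no scale beyond
  \<open>J\<close>, these sets increase with \<open>J\<close>, and it is enough to bound their
  contents independently of \<open>J\<close>. The same \<open>J\<close> selects the member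
  \<open>A J\<close> of a decreasing sequence inside \<open>Z\<close> and the resolution of the
  weights on it; apart from their Frostman bound, these weights enter the constants only through a
  lower bound \<open>c0\<close> for their mass.

  The exponents fit as follows. A shell on which the gradient has size about R contributes rho^sigma
  * R^(k - 1 - sigma). The exponent of R is positive because sigma < 1 <= k - 1, so the sum over
  dyadic R is governed by the largest shell and small gradients cost nothing. At scale 2^-j the
  count of pairs gains 2^(-j (sigma - s)). Choosing a scale by pigeonhole loses 2^(-j eta), which
  Cauchy-Schwarz squares; eta = (sigma - s) / 4 leaves 2^(-2 j eta), half of the gain.\<close>

locale net =
  fixes S :: "'i \<Rightarrow> 'x set" and lev :: "'i \<Rightarrow> nat" and w :: "'i \<Rightarrow> ennreal"
  assumes nested: "lev i \<le> lev j \<Longrightarrow> S i \<inter> S j = {} \<or> S j \<subseteq> S i"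
begin

text \<open>Covers are arbitrary index sets, since \<open>infsum\<close> in \<open>ennreal\<close>
  always exists; covers can be merged, thinned out and passed to a limit without enumerating them.
  For dyadic cubes this is the net content with cubes of side at most 1.\<close>

definition content :: "'x set \<Rightarrow> ennreal" where
  "content A = (INF C\<in>{C. A \<subseteq> \<Union>(S ` C)}. infsum w C)"

lemma content_le: "A \<subseteq> \<Union>(S ` C) \<Longrightarrow> content A \<le> infsum w C"
  unfolding content_def by (auto intro: INF_lower)

lemma content_mono: "A \<subseteq> B \<Longrightarrow> content A \<le> content B"
  unfolding content_def by (rule INF_superset_mono) auto

lemma infsum_w_Un: "infsum w (A \<union> B) \<le> infsum w A + infsum w B"
proof -
  have "infsum w (A \<union> B) = infsum w (A \<union> (B - A))" by simp
  also have "\<dots> = infsum w A + infsum w (B - A)"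
    by (rule infsum_Un_disjoint) (auto intro: nonneg_summable_on_complete)
  also have "\<dots> \<le> infsum w A + infsum w B"
    by (intro add_left_mono infsum_mono_neutral) (auto intro: nonneg_summable_on_complete)
  finally show ?thesis .
qed

lemma infsum_w_split: "infsum w {i\<in>A. P i} + infsum w {i\<in>A. \<not> P i} = infsum w A"
proof -
  have "infsum w ({i\<in>A. P i} \<union> {i\<in>A. \<not> P i}) = infsum w {i\<in>A. P i} + infsum w {i\<in>A. \<not> P i}"
    by (rule infsum_Un_disjoint) (auto intro: nonneg_summable_on_complete)
  moreover have "{i\<in>A. P i} \<union> {i\<in>A. \<not> P i} = A" by auto
  ultimately show ?thesis by simp
qed

lemma content_approx:
  assumes "content A < top" "e > 0"
  obtains C where "A \<subseteq> \<Union>(S ` C)" "infsum w C \<le> content A + ennreal e"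
proof -
  have "content A < content A + ennreal e"
    using assms ennreal_add_left_cancel_less[of "content A" 0 "ennreal e"] by simp
  then obtain C where "A \<subseteq> \<Union>(S ` C)" "infsum w C < content A + ennreal e"
    unfolding content_def INF_less_iff by blast
  then show ?thesis using that[of C] by simp
qed

text \<open>Passing to the maximal members of two covers; the discarded members still cover \<open>A1\<close>,
  whence the strong subadditivity of the content.\<close>
lemma merge_covers:
  assumes 1: "A1 \<subseteq> \<Union>(S ` C1)" and 2: "A2 \<subseteq> \<Union>(S ` C2)" and 12: "A1 \<subseteq> A2"
  shows "\<exists>C. A2 \<subseteq> \<Union>(S ` C) \<and> infsum w C + content A1 \<le> infsum w C1 + infsum w C2 \<and>
    (\<forall>i\<in>C1. i \<in> C \<or> (\<exists>j\<in>C. lev j < lev i \<and> S i \<subseteq> S j))"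
proof -
  \<comment> \<open>The inequality of levels is strict in \<open>P\<close> and weak in
    \<open>Q\<close>: ties are decided in favour of \<open>C1\<close>, so two sets never discard
    each other.\<close>
  define P where "P i \<longleftrightarrow> (\<exists>j\<in>C2. lev j < lev i \<and> S i \<subseteq> S j)" for i
  define Q where "Q i \<longleftrightarrow> (\<exists>j\<in>C1. lev j \<le> lev i \<and> S i \<subseteq> S j)" for i
  define C where "C = {i\<in>C1. \<not> P i} \<union> {i\<in>C2. \<not> Q i}"
  have cov: "i \<in> C1 \<union> C2 \<Longrightarrow> \<exists>j\<in>C. lev j \<le> lev i \<and> S i \<subseteq> S j" for i
  proof (induction "lev i" arbitrary: i rule: less_induct)
    case less
    have 1: "\<exists>j\<in>C. lev j \<le> lev i \<and> S i \<subseteq> S j" if j: "j \<in> C2" "lev j < lev i" "S i \<subseteq> S j" for j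
    proof -
      obtain l where "l \<in> C" "lev l \<le> lev j" "S j \<subseteq> S l"
        using less.hyps[OF j(2)] j(1) by auto
      then show ?thesis using j by (intro bexI[of _ l]) auto
    qed
    show ?case
    proof (cases "i \<in> C")
      case False
      then consider "P i" | "i \<in> C2" "Q i" using less.prems by (auto simp: C_def)
      then show ?thesis
      proof cases
        case 2
        then obtain j where j: "j \<in> C1" "lev j \<le> lev i" "S i \<subseteq> S j" by (auto simp: Q_def)
        show ?thesis
        proof (cases "P j")
          case True
          then show ?thesis using 1 j unfolding P_def by (meson less_le_trans order_trans)
        qed (use j in \<open>auto simp: C_def\<close>)
      qed (use 1 in \<open>auto simp: P_def\<close>)
    qed auto
  qed
  show ?thesis
  proof (intro exI[of _ C] conjI ballI)
    show "A2 \<subseteq> \<Union>(S ` C)" using 2 cov by fastforce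
    have "A1 \<subseteq> \<Union>(S ` ({i\<in>C1. P i} \<union> {i\<in>C2. Q i}))"
    proof
      fix x assume x: "x \<in> A1"
      obtain i j where ij: "i \<in> C1" "x \<in> S i" "j \<in> C2" "x \<in> S j" using x 1 2 12 by blast
      show "x \<in> \<Union>(S ` ({i\<in>C1. P i} \<union> {i\<in>C2. Q i}))"
      proof (cases "lev j < lev i")
        case True
        then have "S i \<subseteq> S j" using nested[of j i] ij by auto
        then have "P i" using ij True unfolding P_def by (intro bexI[of _ j]) auto
        then show ?thesis using ij by blast
      next
        case False
        then have "S j \<subseteq> S i" using nested[of i j] ij by auto
        then have "Q j" using ij False unfolding Q_def by (intro bexI[of _ i]) auto
        then show ?thesis using ij by blast
      qed
    qed
    then have "content A1 \<le> infsum w {i\<in>C1. P i} + infsum w {i\<in>C2. Q i}"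
      using content_le infsum_w_Un order_trans by blast
    moreover have "infsum w C \<le> infsum w {i\<in>C1. \<not> P i} + infsum w {i\<in>C2. \<not> Q i}"
      unfolding C_def by (rule infsum_w_Un)
    ultimately have "infsum w C + content A1 \<le>
        (infsum w {i\<in>C1. \<not> P i} + infsum w {i\<in>C2. \<not> Q i}) + (infsum w {i\<in>C1. P i} + infsum w {i\<in>C2. Q i})"
      by (rule add_mono[rotated])
    also have "\<dots> = (infsum w {i\<in>C1. P i} + infsum w {i\<in>C1. \<not> P i}) + (infsum w {i\<in>C2. Q i} + infsum w {i\<in>C2. \<not> Q i})"
      by (simp add: ac_simps)
    also have "\<dots> = infsum w C1 + infsum w C2" by (simp only: infsum_w_split)
    finally show "infsum w C + content A1 \<le> infsum w C1 + infsum w C2" .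
    show "i \<in> C \<or> (\<exists>j\<in>C. lev j < lev i \<and> S i \<subseteq> S j)" if i: "i \<in> C1" for i
    proof (cases "P i")
      case True
      then obtain j where j: "j \<in> C2" "lev j < lev i" "S i \<subseteq> S j" by (auto simp: P_def)
      then obtain l where "l \<in> C" "lev l \<le> lev j" "S j \<subseteq> S l" using cov[of j] by auto
      then show ?thesis using j by (meson le_less_trans order_trans)
    qed (use i in \<open>auto simp: C_def\<close>)
  qed
qed

text \<open>Covers \<open>V n\<close> of \<open>A n\<close> are built by merging \<open>V n\<close>
  with a nearly optimal cover of \<open>A (Suc n)\<close>. An index leaves only when a containing
  set of strictly smaller level takes its place. Levels are natural numbers, so every such chain
  ends in an index that stays forever. The permanent indices cover the union, and any finitely many
  of them lie in a single \<open>V n\<close>, which bounds their total weight.\<close>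

lemma content_incseq:
  assumes "incseq A"
  shows "content (\<Union>n. A n) \<le> (SUP n. content (A n))"
proof (cases "(SUP n. content (A n)) = top")
  case False
  define M where "M = (SUP n. content (A n))"
  have le_M: "content (A n) \<le> M" for n unfolding M_def by (rule SUP_upper) simp
  have fin: "content (A n) < top" for n using le_M[of n] False[folded M_def] by (metis le_less_trans top.not_eq_extremum)
  have Asub: "A n \<subseteq> A (Suc n)" for n using assms by (simp add: incseq_SucD)
  show ?thesis unfolding M_def[symmetric]
  proof (rule ennreal_le_epsilon)
    fix e :: real assume e: "e > 0"
    define I where "I n V \<longleftrightarrow> A n \<subseteq> \<Union>(S ` V) \<and>
        infsum w V \<le> content (A n) + ennreal (e * (1 - (1/2)^Suc n))" for n V
    define J where "J n V V' \<longleftrightarrow> (\<forall>i\<in>V. i \<in> V' \<or> (\<exists>j\<in>V'. lev j < lev i \<and> S i \<subseteq> S j))" for n :: nat and V V'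
    have "\<exists>V. \<forall>n. I n (V n) \<and> J n (V n) (V (Suc n))"
    proof (rule dependent_nat_choice)
      obtain C where "A 0 \<subseteq> \<Union>(S ` C)" "infsum w C \<le> content (A 0) + ennreal (e/2)"
        using content_approx[OF fin[of 0], of "e/2"] e by auto
      then show "\<exists>V. I 0 V" unfolding I_def by (intro exI[of _ C]) auto
    next
      fix V n assume V: "I n V"
      \<comment> \<open>The excess is \<open>e / 2\<close> at the start and grows by e / 2^(n + 2)
        in step \<open>n\<close>. Since \<open>merge_covers\<close> returns
        \<open>content (A n)\<close>, it is only these errors that accumulate.\<close>
      define d where "d = e * (1/2)^Suc (Suc n)"
      have d: "d > 0" using e by (simp add: d_def)
      obtain C where C: "A (Suc n) \<subseteq> \<Union>(S ` C)" "infsum w C \<le> content (A (Suc n)) + ennreal d"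
        using content_approx[OF fin d] by blast
      obtain V' where V': "A (Suc n) \<subseteq> \<Union>(S ` V')"
        "infsum w V' + content (A n) \<le> infsum w V + infsum w C" "J n V V'"
        using merge_covers[OF conjunct1[OF V[unfolded I_def]] C(1) Asub] unfolding J_def by auto
      have nn: "0 \<le> e * (1 - (1/2)^Suc n)" using e power_le_one[of "1/2::real" "Suc n"] by (intro mult_nonneg_nonneg) auto
      have "infsum w V' + content (A n) \<le>
          (content (A n) + ennreal (e * (1 - (1/2)^Suc n))) + (content (A (Suc n)) + ennreal d)"
        using V'(2) V C(2) unfolding I_def by (meson add_mono order_trans)
      also have "\<dots> = (content (A (Suc n)) + (ennreal (e * (1 - (1/2)^Suc n)) + ennreal d)) + content (A n)"
        by (simp add: ac_simps)
      also have "ennreal (e * (1 - (1/2)^Suc n)) + ennreal d = ennreal (e * (1 - (1/2)^Suc (Suc n)))"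
        using d nn by (subst ennreal_plus[symmetric]) (auto simp: d_def field_simps)
      finally have "infsum w V' \<le> content (A (Suc n)) + ennreal (e * (1 - (1/2)^Suc (Suc n)))"
        using fin[of n] ennreal_add_left_cancel_le[of "content (A n)" "infsum w V'"]
        by (auto simp: add.commute[of _ "content (A n)"])
      then show "\<exists>V'. I (Suc n) V' \<and> J n V V'" using V'(1,3) unfolding I_def by blast
    qed
    then obtain V where I: "\<And>n. I n (V n)" and J: "\<And>n. J n (V n) (V (Suc n))" by auto
    define L where "L = {i. \<exists>N. \<forall>n\<ge>N. i \<in> V n}"
    have stab: "i \<in> V n \<Longrightarrow> \<exists>j\<in>L. S i \<subseteq> S j" for i n
    proof (induction "lev i" arbitrary: i n rule: less_induct)
      case less
      show ?case
      proof (cases "\<forall>m\<ge>n. i \<in> V m")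
        case True
        then show ?thesis unfolding L_def by blast
      next
        case False
        have "\<exists>m\<ge>n. i \<in> V m \<and> i \<notin> V (Suc m)"
        proof (rule ccontr)
          assume *: "\<not> ?thesis"
          have "i \<in> V m" if "n \<le> m" for m
            using that by (induction m rule: dec_induct) (use * less.prems in auto)
          then show False using False by blast
        qed
        then obtain m where m: "m \<ge> n" "i \<in> V m" "i \<notin> V (Suc m)" by blast
        then obtain j where "j \<in> V (Suc m)" "lev j < lev i" "S i \<subseteq> S j" using J[of m] unfolding J_def by blast
        then show ?thesis using less.hyps by (meson order_trans)
      qed
    qed
    have "(\<Union>n. A n) \<subseteq> \<Union>(S ` L)" using I stab unfolding I_def by fastforce
    then have "content (\<Union>n. A n) \<le> infsum w L" by (rule content_le)
    also have "\<dots> = (SUP F\<in>{F. finite F \<and> F \<subseteq> L}. sum w F)" by (rule nonneg_infsum_complete) simp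
    also have "\<dots> \<le> M + ennreal e"
    proof (rule SUP_least, clarsimp)
      fix F assume F: "finite F" "F \<subseteq> L"
      then have "\<forall>i\<in>F. \<exists>N. \<forall>n\<ge>N. i \<in> V n" unfolding L_def by blast
      then have "\<forall>i\<in>F. eventually (\<lambda>n. i \<in> V n) sequentially" by (simp add: eventually_sequentially)
      then have "eventually (\<lambda>n. \<forall>i\<in>F. i \<in> V n) sequentially" using F(1) by (simp add: eventually_ball_finite)
      then obtain n where n: "F \<subseteq> V n" by (auto simp: eventually_sequentially)
      have "sum w F = infsum w F" using F by simp
      also have "\<dots> \<le> infsum w (V n)"
        using n by (intro infsum_mono_neutral) (auto intro: nonneg_summable_on_complete)
      also have "\<dots> \<le> content (A n) + ennreal (e * (1 - (1/2)^Suc n))" using I unfolding I_def by blast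
      also have "\<dots> \<le> M + ennreal e" using e by (intro add_mono le_M ennreal_leI) (simp add: field_simps)
      finally show "sum w F \<le> M + ennreal e" .
    qed
    finally show "content (\<Union>n. A n) \<le> M + ennreal e" .
  qed
qed (simp only: top_greatest)

lemma content_Un: "content (A \<union> B) \<le> content A + content B"
proof (cases "content A + content B = top")
  case False
  then have fin: "content A < top" "content B < top" by (auto simp flip: top.not_eq_extremum)
  show ?thesis
  proof (rule ennreal_le_epsilon)
    fix e :: real assume e: "e > 0"
    obtain C where C: "A \<subseteq> \<Union>(S ` C)" "infsum w C \<le> content A + ennreal (e/2)"
      using content_approx[OF fin(1), of "e/2"] e by auto
    obtain D where D: "B \<subseteq> \<Union>(S ` D)" "infsum w D \<le> content B + ennreal (e/2)"
      using content_approx[OF fin(2), of "e/2"] e by auto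
    have "content (A \<union> B) \<le> infsum w (C \<union> D)" using C D by (intro content_le) auto
    also have "\<dots> \<le> infsum w C + infsum w D" by (rule infsum_w_Un)
    also have "\<dots> \<le> (content A + ennreal (e/2)) + (content B + ennreal (e/2))" using C D by (intro add_mono)
    also have "\<dots> = content A + content B + ennreal e"
      using e by (simp add: ac_simps flip: ennreal_plus) 
    finally show "content (A \<union> B) \<le> content A + content B + ennreal e" .
  qed
qed (auto simp: top_add)

lemma content_empty: "content {} = 0"
  using content_le[of "{}" "{}"] by simp

lemma content_UN_finite: "finite I \<Longrightarrow> content (\<Union>i\<in>I. A i) \<le> (\<Sum>i\<in>I. content (A i))"
  by (induction I rule: finite_induct) (auto simp: content_empty intro: order_trans[OF content_Un] add_left_mono)

end

text \<open>Each point in turn receives the largest weight that keeps the constraints, which saturates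
  one of the sets containing it.\<close>
lemma greedy_weights:
  fixes w :: "'i \<Rightarrow> real"
  assumes "finite P" "finite D" "\<And>i. i \<in> D \<Longrightarrow> 0 \<le> w i" "\<And>p. p \<in> P \<Longrightarrow> \<exists>i\<in>D. p \<in> S i"
  shows "\<exists>m. (\<forall>p. 0 \<le> m p) \<and> (\<forall>i\<in>D. sum m (P \<inter> S i) \<le> w i) \<and>
             (\<forall>p\<in>P. \<exists>i\<in>D. p \<in> S i \<and> sum m (P \<inter> S i) = w i)"
  using assms(1,4)
proof (induction P rule: finite_induct)
  case empty
  then show ?case using assms(3) by (intro exI[of _ "\<lambda>_. 0"]) auto
next
  case (insert p P)
  then obtain m where m: "\<And>p. 0 \<le> m p" "\<And>i. i \<in> D \<Longrightarrow> sum m (P \<inter> S i) \<le> w i"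
    "\<And>q. q \<in> P \<Longrightarrow> \<exists>i\<in>D. q \<in> S i \<and> sum m (P \<inter> S i) = w i" by (metis insertCI)
  define Dp where "Dp = {i\<in>D. p \<in> S i}"
  have Dp: "finite Dp" "Dp \<noteq> {}" using assms(2) insert.prems[of p] by (auto simp: Dp_def)
  define r where "r = Min ((\<lambda>i. w i - sum m (P \<inter> S i)) ` Dp)"
  have r_le: "r \<le> w i - sum m (P \<inter> S i)" if "i \<in> Dp" for i using Dp that unfolding r_def by simp
  have "r \<in> (\<lambda>i. w i - sum m (P \<inter> S i)) ` Dp" using Dp unfolding r_def by (intro Min_in) auto
  then obtain i0 where i0: "i0 \<in> Dp" "r = w i0 - sum m (P \<inter> S i0)" by auto
  have r0: "0 \<le> r" using i0 m(2)[of i0] by (simp add: Dp_def)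
  define m' where "m' = m(p := r)"
  have sum': "sum m' (insert p P \<inter> S i) = sum m (P \<inter> S i) + (if p \<in> S i then r else 0)" for i
  proof -
    have eq: "sum m' (P \<inter> S i) = sum m (P \<inter> S i)" using insert.hyps by (intro sum.cong) (auto simp: m'_def)
    show ?thesis
    proof (cases "p \<in> S i")
      case True
      then have "insert p P \<inter> S i = insert p (P \<inter> S i)" by auto
      then show ?thesis using True eq insert.hyps by (simp add: m'_def)
    qed (use eq in auto)
  qed
  show ?case
  proof (intro exI[of _ m'] conjI ballI allI)
    show "0 \<le> m' q" for q using m(1) r0 by (simp add: m'_def)
    show "sum m' (insert p P \<inter> S i) \<le> w i" if "i \<in> D" for i
      using that m(2)[OF that] r_le[of i] by (auto simp: sum' Dp_def simp del: Int_insert_left)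
    show "\<exists>i\<in>D. q \<in> S i \<and> sum m' (insert p P \<inter> S i) = w i" if q: "q \<in> insert p P" for q
    proof (cases "q = p")
      case True
      then show ?thesis using i0 sum'[of i0] by (intro bexI[of _ i0]) (auto simp: Dp_def)
    next
      case False
      then obtain i where i: "i \<in> D" "q \<in> S i" "sum m (P \<inter> S i) = w i" using m(3) q by auto
      have "p \<in> S i \<longrightarrow> r = 0" using r_le[of i] r0 i by (auto simp: Dp_def)
      then show ?thesis using i by (intro bexI[of _ i]) (auto simp: sum' simp del: Int_insert_left)
    qed
  qed
qed

text \<open>The maximal saturated sets are disjoint, and each carries mass equal to its weight. They
  cover \<open>A\<close>, because every \<open>x\<close> in \<open>A\<close> lies in all the sets of
  \<open>D\<close> that contain some point \<open>p\<close> of \<open>P\<close>. So the mass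
  dominates the weight of a cover.\<close>

lemma (in net) frostman_finite:
  fixes v :: "'i \<Rightarrow> real"
  assumes "finite P" "finite D" and v: "\<And>i. 0 \<le> v i" "\<And>i. w i = ennreal (v i)"
    and P: "\<And>p. p \<in> P \<Longrightarrow> \<exists>i\<in>D. p \<in> S i"
    and A: "\<And>x. x \<in> A \<Longrightarrow> \<exists>p\<in>P. \<forall>i\<in>D. p \<in> S i \<longrightarrow> x \<in> S i"
    and inj: "\<And>i j. i \<in> D \<Longrightarrow> j \<in> D \<Longrightarrow> lev i = lev j \<Longrightarrow> S i \<inter> S j \<noteq> {} \<Longrightarrow> i = j"
  shows "\<exists>m. (\<forall>p. 0 \<le> m p) \<and> (\<forall>i\<in>D. sum m (P \<inter> S i) \<le> v i) \<and> content A \<le> ennreal (sum m P)"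
proof -
  obtain m where m: "\<And>p. 0 \<le> m p" "\<And>i. i \<in> D \<Longrightarrow> sum m (P \<inter> S i) \<le> v i"
    "\<And>q. q \<in> P \<Longrightarrow> \<exists>i\<in>D. q \<in> S i \<and> sum m (P \<inter> S i) = v i"
    using greedy_weights[OF assms(1,2), of v S] v P by metis
  define Sat where "Sat = {i\<in>D. sum m (P \<inter> S i) = v i}"
  define X where "X = {i\<in>Sat. \<not> (\<exists>j\<in>Sat. lev j < lev i \<and> S i \<subseteq> S j)}"
  have finX: "finite X" using assms(2) by (auto simp: X_def Sat_def)
  have cov: "i \<in> Sat \<Longrightarrow> \<exists>j\<in>X. S i \<subseteq> S j" for i
  proof (induction "lev i" arbitrary: i rule: less_induct)
    case less
    show ?case
    proof (cases "i \<in> X")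
      case False
      then obtain j where "j \<in> Sat" "lev j < lev i" "S i \<subseteq> S j" using less.prems by (auto simp: X_def)
      then show ?thesis using less.hyps[of j] by blast
    qed auto
  qed
  have disj: "S i \<inter> S j = {}" if "i \<in> X" "j \<in> X" "i \<noteq> j" for i j
  proof (rule ccontr)
    assume ne: "S i \<inter> S j \<noteq> {}"
    then have "lev i \<noteq> lev j" using inj[of i j] that by (auto simp: X_def Sat_def)
    then consider "lev i < lev j" | "lev j < lev i" by linarith
    then show False using that ne nested[of i j] nested[of j i]
      by cases (auto simp: X_def Int_commute)
  qed
  have "A \<subseteq> \<Union>(S ` X)"
  proof
    fix x assume "x \<in> A"
    then obtain p where p: "p \<in> P" "\<forall>i\<in>D. p \<in> S i \<longrightarrow> x \<in> S i" using A by blast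
    obtain i where i: "i \<in> D" "p \<in> S i" "sum m (P \<inter> S i) = v i" using m(3)[OF p(1)] by blast
    then have "x \<in> S i" "i \<in> Sat" using p by (auto simp: Sat_def)
    then show "x \<in> \<Union>(S ` X)" using cov by blast
  qed
  then have "content A \<le> infsum w X" by (rule content_le)
  also have "\<dots> = (\<Sum>i\<in>X. ennreal (v i))" using finX v by simp
  also have "\<dots> = ennreal (\<Sum>i\<in>X. v i)" using v by (simp add: sum_ennreal)
  also have "(\<Sum>i\<in>X. v i) = (\<Sum>i\<in>X. sum m (P \<inter> S i))" by (intro sum.cong) (auto simp: X_def Sat_def)
  also have "\<dots> = sum m (\<Union>i\<in>X. P \<inter> S i)"
    using finX assms(1) disj by (intro sum.UNION_disjoint[symmetric]) blast+
  also have "ennreal \<dots> \<le> ennreal (sum m P)" using assms(1) m(1) by (intro ennreal_leI sum_mono2) auto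
  finally show ?thesis using m by blast
qed

section \<open>Hausdorff measures\<close>

lemma hausdorff_pre_le:
  assumes "A \<subseteq> (\<Union>i. C i)" "\<And>i. bounded (C i)" "\<And>i. diameter (C i) \<le> \<delta>"
  shows "hausdorff_pre t \<delta> A \<le> (\<Sum>i. ennreal (diam_pow t (C i)))"
  unfolding hausdorff_pre_def using assms by (intro INF_lower) auto

lemma diam_pow_nonneg: "0 \<le> diam_pow t C"
  by (simp add: diam_pow_def)

text \<open>A cover whose \<open>t\<close>-sum is at most \<open>\<delta> powr t\<close> has no
  member of diameter above \<open>\<delta>\<close>, so for null sets the size restriction in
  \<open>hausdorff_pre\<close> takes care of itself.\<close>

lemma hausdorff_measure_zeroI:
  assumes t: "t > 0"
    and ex: "\<And>e. e > 0 \<Longrightarrow> \<exists>C. A \<subseteq> (\<Union>i. C i) \<and> (\<forall>i. bounded (C i)) \<and>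
                (\<Sum>i. ennreal (diam_pow t (C i))) \<le> ennreal e"
  shows "hausdorff_measure t A = 0"
proof -
  have "hausdorff_pre t \<delta> A = 0" if \<delta>: "\<delta> > 0" for \<delta>
  proof (rule antisym[OF ennreal_le_epsilon])
    fix e :: real assume e: "e > 0"
    define e' where "e' = min e (\<delta> powr t)"
    have e': "e' > 0" using e \<delta> by (simp add: e'_def)
    obtain C where C: "A \<subseteq> (\<Union>i. C i)" "\<And>i. bounded (C i)"
      "(\<Sum>i. ennreal (diam_pow t (C i))) \<le> ennreal e'" using ex[OF e'] by auto
    have "diameter (C i) \<le> \<delta>" for i
    proof (cases "C i = {}")
      case False
      have "ennreal (diam_pow t (C i)) \<le> (\<Sum>i. ennreal (diam_pow t (C i)))"
        using sum_le_suminf[of "\<lambda>i. ennreal (diam_pow t (C i))" "{i}"] by simp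
      then have "ennreal (diam_pow t (C i)) \<le> ennreal e'" using C(3) by (rule order_trans)
      then have "diam_pow t (C i) \<le> e'" using e' by (simp add: ennreal_le_iff)
      then have "diameter (C i) powr t \<le> \<delta> powr t" using False t by (simp add: diam_pow_def e'_def)
      then show ?thesis using \<delta> t powr_less_mono2[of t \<delta> "diameter (C i)"] by (meson less_eq_real_def not_less order_trans)
    qed (use \<delta> in simp)
    then have "hausdorff_pre t \<delta> A \<le> ennreal e'" using hausdorff_pre_le[OF C(1,2)] C(3) order_trans by blast
    also have "\<dots> \<le> 0 + ennreal e" by (simp add: e'_def ennreal_leI)
    finally show "hausdorff_pre t \<delta> A \<le> 0 + ennreal e" .
  qed simp
  then show ?thesis unfolding hausdorff_measure_def by (simp add: SUP_eq_const)
qed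

lemma hausdorff_measure_zeroD:
  assumes "hausdorff_measure t A = 0" "e > 0" "\<delta> > 0"
  obtains C where "A \<subseteq> (\<Union>i. C i)" "\<And>i. bounded (C i)" "\<And>i. diameter (C i) \<le> \<delta>"
    "(\<Sum>i. ennreal (diam_pow t (C i))) < ennreal e"
proof -
  have "hausdorff_pre t \<delta> A \<le> hausdorff_measure t A"
    unfolding hausdorff_measure_def using assms by (intro SUP_upper) auto
  then have "hausdorff_pre t \<delta> A < ennreal e" using assms by simp
  then show ?thesis unfolding hausdorff_pre_def INF_less_iff using that by blast
qed

lemma hausdorff_measure_zero_subset:
  assumes "hausdorff_measure t B = 0" "A \<subseteq> B"
  shows "hausdorff_measure t A = 0"
proof -
  have "hausdorff_pre t \<delta> A \<le> hausdorff_pre t \<delta> B" for \<delta>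
    unfolding hausdorff_pre_def using assms(2) by (intro INF_superset_mono) auto
  then have "hausdorff_measure t A \<le> hausdorff_measure t B"
    unfolding hausdorff_measure_def by (intro SUP_mono) auto
  then show ?thesis using assms by simp
qed

lemma hausdorff_measure_zero_mono:
  assumes H: "hausdorff_measure s A = 0" and s: "0 \<le> s" "s \<le> t" "0 < t"
  shows "hausdorff_measure t A = 0"
proof (rule hausdorff_measure_zeroI[OF s(3)])
  fix e :: real assume e: "e > 0"
  obtain C where C: "A \<subseteq> (\<Union>i. C i)" "\<And>i. bounded (C i)" "\<And>i. diameter (C i) \<le> 1"
    "(\<Sum>i. ennreal (diam_pow s (C i))) < ennreal e" by (rule hausdorff_measure_zeroD[OF H e, of 1]) auto
  have "diam_pow t (C i) \<le> diam_pow s (C i)" for i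
  proof (cases "diameter (C i) = 0")
    case False
    then have "0 < diameter (C i)" using C(2) diameter_ge_0[of "C i"] by simp
    then show ?thesis using C(3)[of i] s by (auto simp: diam_pow_def powr_mono' powr_le1)
  qed (use s in \<open>auto simp: diam_pow_def\<close>)
  then have "(\<Sum>i. ennreal (diam_pow t (C i))) \<le> (\<Sum>i. ennreal (diam_pow s (C i)))"
    by (intro suminf_le ennreal_leI) auto
  then show "\<exists>C. A \<subseteq> (\<Union>i. C i) \<and> (\<forall>i. bounded (C i)) \<and> (\<Sum>i. ennreal (diam_pow t (C i))) \<le> ennreal e"
    using C by (intro exI[of _ C]) auto
qed

lemma hausdorff_measure_zero_UN:
  fixes A :: "nat \<Rightarrow> 'a::metric_space set"
  assumes t: "t > 0" and H: "\<And>n. hausdorff_measure t (A n) = 0"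
  shows "hausdorff_measure t (\<Union>n. A n) = 0"
proof (rule hausdorff_measure_zeroI[OF t])
  fix e :: real assume e: "e > 0"
  have "\<exists>C. A n \<subseteq> (\<Union>i. C i) \<and> (\<forall>i. bounded (C i)) \<and>
      (\<Sum>i. ennreal (diam_pow t (C i))) \<le> ennreal (e * (1/2)^Suc n)" for n
  proof -
    have "e * (1/2)^Suc n > 0" using e by simp
    from hausdorff_measure_zeroD[OF H this zero_less_one, of n] show ?thesis by (metis less_imp_le)
  qed
  then obtain C where C: "\<And>n. A n \<subseteq> (\<Union>i. C n i)" "\<And>n i. bounded (C n i)"
      "\<And>n. (\<Sum>i. ennreal (diam_pow t (C n i))) \<le> ennreal (e * (1/2)^Suc n)" by metis
  define C' where "C' k = (case prod_decode k of (n, i) \<Rightarrow> C n i)" for k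
  have "(\<Sum>k. ennreal (diam_pow t (C' k))) = (\<Sum>n. \<Sum>i. ennreal (diam_pow t (C n i)))"
    using suminf_ennreal_2dimen[of "\<lambda>n. \<Sum>i. ennreal (diam_pow t (C n i))" "\<lambda>(n, i). ennreal (diam_pow t (C n i))"]
    by (simp add: C'_def case_prod_beta o_def)
  also have "\<dots> \<le> (\<Sum>n. ennreal (e * (1/2)^Suc n))" by (intro suminf_le C) auto
  also have "\<dots> = ennreal e"
    using sums_mult[OF power_half_series, of e] e by (intro suminf_ennreal_eq) auto
  finally have "(\<Sum>k. ennreal (diam_pow t (C' k))) \<le> ennreal e" .
  moreover have "(\<Union>n. A n) \<subseteq> (\<Union>k. C' k)"
  proof clarify
    fix x n assume "x \<in> A n"
    then obtain i where "x \<in> C n i" using C(1) by blast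
    then show "x \<in> (\<Union>k. C' k)" by (intro UN_I[of "prod_encode (n, i)"]) (auto simp: C'_def)
  qed
  ultimately show "\<exists>C. (\<Union>n. A n) \<subseteq> (\<Union>i. C i) \<and> (\<forall>i. bounded (C i)) \<and> (\<Sum>i. ennreal (diam_pow t (C i))) \<le> ennreal e"
    using C(2) by (intro exI[of _ C']) (auto simp: C'_def case_prod_beta)
qed

lemma hausdorff_measure_zero_Union:
  assumes "t > 0" "countable \<A>" "\<And>A. A \<in> \<A> \<Longrightarrow> hausdorff_measure t A = 0"
  shows "hausdorff_measure t (\<Union>\<A>) = 0"
proof (cases "\<A> = {}")
  case True
  have "hausdorff_measure t ({} :: 'a set) = 0"
    by (rule hausdorff_measure_zeroI[OF assms(1)]) (auto simp: diam_pow_def intro!: exI[of _ "\<lambda>_. {}"])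
  then show ?thesis using True by simp
next
  case False
  then have "\<Union>\<A> = (\<Union>n. from_nat_into \<A> n)" using assms(2) by (simp add: range_from_nat_into)
  then show ?thesis using hausdorff_measure_zero_UN[OF assms(1)] assms(3) False from_nat_into by metis
qed

lemma hausdorff_measure_zero_lipschitz:
  fixes f :: "'a::metric_space \<Rightarrow> 'b::metric_space"
  assumes H: "hausdorff_measure t A = 0" and t: "t > 0" and L: "L > 0"
    and f: "\<And>x y. dist (f x) (f y) \<le> L * dist x y"
  shows "hausdorff_measure t (f ` A) = 0"
proof (rule hausdorff_measure_zeroI[OF t])
  fix e :: real assume e: "e > 0"
  then have "e / L powr t > 0" using L by simp
  then obtain C where C: "A \<subseteq> (\<Union>i. C i)" "\<And>i. bounded (C i)"
    "(\<Sum>i. ennreal (diam_pow t (C i))) < ennreal (e / L powr t)" by (rule hausdorff_measure_zeroD[OF H, of "e / L powr t" 1]) auto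
  have bd: "dist (f x) (f y) \<le> L * diameter (C i)" if "x \<in> C i" "y \<in> C i" for x y i
  proof -
    have "dist (f x) (f y) \<le> L * dist x y" by (rule f)
    also have "\<dots> \<le> L * diameter (C i)" using that C(2) L diameter_bounded_bound by (intro mult_left_mono) auto
    finally show ?thesis .
  qed
  have bdd: "bounded (f ` C i)" for i
    unfolding bounded_two_points by (intro exI[of _ "L * diameter (C i)"]) (use bd in blast)
  have "diam_pow t (f ` C i) \<le> L powr t * diam_pow t (C i)" for i
  proof (cases "C i = {}")
    case False
    have "diameter (f ` C i) \<le> L * diameter (C i)"
      using False bd unfolding diameter_def[of "f ` C i"] by (auto intro!: cSUP_least)
    then have "diameter (f ` C i) powr t \<le> (L * diameter (C i)) powr t"
      using t bdd by (intro powr_mono2) (auto simp: diameter_ge_0)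
    also have "\<dots> = L powr t * diameter (C i) powr t" using L C(2) by (simp add: powr_mult diameter_ge_0)
    finally show ?thesis using False t by (simp add: diam_pow_def)
  qed (auto simp: diam_pow_def)
  then have "(\<Sum>i. ennreal (diam_pow t (f ` C i))) \<le> (\<Sum>i. ennreal (L powr t) * ennreal (diam_pow t (C i)))"
    using L by (intro suminf_le) (auto simp: diam_pow_nonneg simp flip: ennreal_mult intro!: ennreal_leI)
  also have "\<dots> = ennreal (L powr t) * (\<Sum>i. ennreal (diam_pow t (C i)))" by simp
  also have "\<dots> \<le> ennreal (L powr t) * ennreal (e / L powr t)" using C(3) by (intro mult_left_mono) auto
  also have "\<dots> = ennreal e" using L e by (simp flip: ennreal_mult)
  finally have "(\<Sum>i. ennreal (diam_pow t (f ` C i))) \<le> ennreal e" .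
  then show "\<exists>C. f ` A \<subseteq> (\<Union>i. C i) \<and> (\<forall>i. bounded (C i)) \<and> (\<Sum>i. ennreal (diam_pow t (C i))) \<le> ennreal e"
    using C(1) bdd by (intro exI[of _ "\<lambda>i. f ` C i"]) blast
qed

text \<open>The grid is laid along an orthonormal basis of \<open>V\<close>, which makes the
  exponent the dimension of \<open>V\<close> and not that of the ambient space. Mesh
  \<open>\<eta> / dim V\<close> in each coordinate keeps cells within diameter
  \<open>\<eta>\<close>. A coordinate takes at most 2 N + 1 values with N <= dim V * D / \<eta> + 1,
  which explains the summand 3.\<close>

lemma subspace_cells:
  fixes V :: "'a::euclidean_space set"
  assumes V: "subspace V" "X \<subseteq> V" and D: "\<And>x y. x \<in> X \<Longrightarrow> y \<in> X \<Longrightarrow> dist x y \<le> D" and "0 \<le> D" "0 < \<eta>"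
  shows "\<exists>\<F>. finite \<F> \<and> real (card \<F>) \<le> (2 * real (dim V) * D / \<eta> + 3) ^ dim V \<and> X \<subseteq> \<Union>\<F> \<and>
    (\<forall>F\<in>\<F>. \<forall>x\<in>F. \<forall>y\<in>F. x \<in> X \<and> dist x y \<le> \<eta>)"
proof (cases "X = {}")
  case False
  then obtain x1 where x1: "x1 \<in> X" by auto
  define d where "d = dim V"
  obtain B where B: "B \<subseteq> V" "pairwise orthogonal B" "\<And>x. x \<in> B \<Longrightarrow> norm x = 1"
    "independent B" "card B = d" "span B = V" using orthonormal_basis_subspace[OF V(1)] unfolding d_def by metis
  have finB: "finite B" using B(4) independent_imp_finite by blast
  define N where "N = \<lceil>d * D / \<eta>\<rceil>"
  have "0 \<le> d * D / \<eta>" using assms by simp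
  then have N0: "N \<ge> 0" unfolding N_def by linarith
  have Nle: "real_of_int N \<le> d * D / \<eta> + 1" unfolding N_def by linarith
  define cell where "cell x = (\<lambda>b\<in>B. \<lfloor>(b \<bullet> (x - x1)) * d / \<eta>\<rfloor>)" for x
  define I where "I = PiE B (\<lambda>_. {-N..N})"
  define \<F> where "\<F> = (\<lambda>z. {x\<in>X. cell x = z}) ` I"
  have finI: "finite I" using finB unfolding I_def by (intro finite_PiE) auto
  have "card I = nat (2 * N + 1) ^ d"
    using finB B(5) N0 by (simp add: I_def card_PiE)
  then have "real (card I) = real_of_int (2 * N + 1) ^ d" using N0 by simp
  also have "\<dots> \<le> (2 * real d * D / \<eta> + 3) ^ d" using N0 Nle by (intro power_mono) auto
  finally have cI: "real (card I) \<le> (2 * real d * D / \<eta> + 3) ^ d" .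
  have "cell x \<in> I" if x: "x \<in> X" for x
  proof -
    have "\<lfloor>(b \<bullet> (x - x1)) * d / \<eta>\<rfloor> \<in> {-N..N}" if "b \<in> B" for b
    proof -
      have "\<bar>b \<bullet> (x - x1)\<bar> \<le> norm b * norm (x - x1)" by (rule Cauchy_Schwarz_ineq2)
      also have "\<dots> \<le> D" using B(3)[OF that] D[OF x x1] by (simp add: dist_norm)
      finally have "\<bar>(b \<bullet> (x - x1)) * d / \<eta>\<bar> \<le> d * D / \<eta>"
        using assms(5) by (auto simp: abs_mult mult.commute[of D] mult.commute[of _ "real d"] intro!: divide_right_mono mult_left_mono)
      also have "\<dots> \<le> N" by (simp add: N_def)
      finally have "\<bar>(b \<bullet> (x - x1)) * d / \<eta>\<bar> \<le> real_of_int N" .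
      then show ?thesis by (simp only: atLeastAtMost_iff) linarith
    qed
    then show ?thesis by (auto simp: I_def cell_def)
  qed
  then have "X \<subseteq> \<Union>\<F>" by (auto simp: \<F>_def)
  moreover have "dist x y \<le> \<eta>" if xy: "x \<in> X" "y \<in> X" "cell x = cell y" for x y
  proof -
    have b: "\<bar>(x - y) \<bullet> b\<bar> * d \<le> \<eta>" if "b \<in> B" for b
    proof -
      have "\<lfloor>(b \<bullet> (x - x1)) * d / \<eta>\<rfloor> = \<lfloor>(b \<bullet> (y - x1)) * d / \<eta>\<rfloor>"
        using fun_cong[OF xy(3), of b] that by (simp add: cell_def)
      then have "\<bar>(b \<bullet> (x - x1)) * d / \<eta> - (b \<bullet> (y - x1)) * d / \<eta>\<bar> < 1" by linarith
      also have "(b \<bullet> (x - x1)) * d / \<eta> - (b \<bullet> (y - x1)) * d / \<eta> = ((x - y) \<bullet> b) * d / \<eta>"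
        by (simp add: inner_simps inner_commute field_simps diff_divide_distrib)
      finally show ?thesis using assms(5) by (simp add: abs_mult)
    qed
    have "x - y \<in> span B" using B(6) V xy by (simp add: subspace_diff subset_iff)
    then have "x - y = (\<Sum>b\<in>B. ((x - y) \<bullet> b) *\<^sub>R b)"
      using orthonormal_basis_expand[OF B(2,3) _ finB] by simp
    then have "norm (x - y) \<le> (\<Sum>b\<in>B. norm (((x - y) \<bullet> b) *\<^sub>R b))" by (metis norm_sum)
    also have "\<dots> = (\<Sum>b\<in>B. \<bar>(x - y) \<bullet> b\<bar>)" using B(3) by (intro sum.cong) auto
    also have "\<dots> \<le> \<eta>"
    proof (cases "d = 0")
      case True
      then show ?thesis using B(5) finB assms(5) by simp
    next
      case False
      have "(\<Sum>b\<in>B. \<bar>(x - y) \<bullet> b\<bar>) \<le> (\<Sum>b\<in>B. \<eta> / d)" using b False by (intro sum_mono) (simp add: field_simps)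
      also have "\<dots> = \<eta>" using B(5) False by simp
      finally show ?thesis .
    qed
    finally show ?thesis by (simp add: dist_norm)
  qed
  moreover have "finite \<F>" "card \<F> \<le> card I" using finI by (auto simp: \<F>_def card_image_le)
  ultimately show ?thesis using cI unfolding d_def[symmetric]
    by (intro exI[of _ \<F>]) (auto simp: \<F>_def)
qed (use assms in \<open>auto intro!: exI[of _ "{}"] zero_le_power\<close>)

lemma hausdorff_measure_zero_finite_covers:
  assumes t: "t > 0"
    and ex: "\<And>e. e > 0 \<Longrightarrow> \<exists>\<F> \<eta>. finite \<F> \<and> A \<subseteq> \<Union>\<F> \<and> 0 < \<eta> \<and>
      (\<forall>F\<in>\<F>. \<forall>x\<in>F. \<forall>y\<in>F. dist x y \<le> \<eta>) \<and> card \<F> * \<eta> powr t \<le> e"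
  shows "hausdorff_measure t A = 0"
proof (rule hausdorff_measure_zeroI[OF t])
  fix e :: real assume "e > 0"
  from ex[OF this] obtain \<F> \<eta> where F: "finite \<F>" "A \<subseteq> \<Union>\<F>" "0 < \<eta>"
    "\<And>F x y. F \<in> \<F> \<Longrightarrow> x \<in> F \<Longrightarrow> y \<in> F \<Longrightarrow> dist x y \<le> \<eta>" "card \<F> * \<eta> powr t \<le> e" by metis
  obtain C0 where C0: "bij_betw C0 {0..<card \<F>} \<F>" using ex_bij_betw_nat_finite[OF F(1)] by blast
  define C where "C i = (if i < card \<F> then C0 i else {})" for i
  have mem: "C0 i \<in> \<F>" if "i < card \<F>" for i using C0 that by (auto dest: bij_betwE)
  have bdd: "bounded (C i)" for i
    unfolding bounded_two_points C_def by (intro exI[of _ \<eta>]) (use F(4)[OF mem] in auto)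
  have dp: "diam_pow t (C i) \<le> (if i < card \<F> then \<eta> powr t else 0)" for i
  proof (cases "i < card \<F> \<and> C0 i \<noteq> {}")
    case True
    then have "diameter (C i) \<le> \<eta>"
      using F(3) F(4)[OF mem] unfolding C_def diameter_def by (auto intro!: cSUP_least)
    then show ?thesis using True t diameter_ge_0[OF bdd[of i]] by (auto simp: diam_pow_def C_def intro!: powr_mono2)
  qed (auto simp: C_def diam_pow_def)
  have "(\<Sum>i. ennreal (diam_pow t (C i))) = (\<Sum>i\<in>{..<card \<F>}. ennreal (diam_pow t (C i)))"
    by (intro suminf_finite) (auto simp: C_def diam_pow_def)
  also have "\<dots> \<le> (\<Sum>i\<in>{..<card \<F>}. ennreal (\<eta> powr t))"
    using dp by (intro sum_mono ennreal_leI) (metis lessThan_iff)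
  also have "\<dots> = ennreal (card \<F> * \<eta> powr t)" by (simp add: ennreal_mult ennreal_of_nat_eq_real_of_nat)
  also have "\<dots> \<le> ennreal e" using F by (intro ennreal_leI) auto
  finally have "(\<Sum>i. ennreal (diam_pow t (C i))) \<le> ennreal e" .
  moreover have "A \<subseteq> (\<Union>i. C i)"
  proof
    fix x assume "x \<in> A"
    then obtain F' where F': "F' \<in> \<F>" "x \<in> F'" using F by blast
    have "F' \<in> C0 ` {0..<card \<F>}" using bij_betw_imp_surj_on[OF C0] F'(1) by simp
    then obtain i where "i < card \<F>" "x \<in> C0 i" using F'(2) by auto
    then show "x \<in> (\<Union>i. C i)" by (auto simp: C_def intro!: exI[of _ i])
  qed
  ultimately show "\<exists>C. A \<subseteq> (\<Union>i. C i) \<and> (\<forall>i. bounded (C i)) \<and> (\<Sum>i. ennreal (diam_pow t (C i))) \<le> ennreal e"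
    using bdd by blast
qed

text \<open>Guarantees that the infimum in \<open>hausdorff_dim\<close> is taken over a nonempty
  set, and bounds the dimension of every subset of the line by 1.\<close>

lemma hausdorff_measure_UNIV:
  fixes t :: real
  assumes t: "t > DIM('a)"
  shows "hausdorff_measure t (UNIV :: 'a::euclidean_space set) = 0"
proof -
  define d where "d = DIM('a)"
  have t0: "t > 0" using t by linarith
  have "hausdorff_measure t (cball (0::'a) (real n)) = 0" for n
  proof (rule hausdorff_measure_zero_finite_covers[OF t0])
    fix e :: real assume e: "e > 0"
    define K where "K = (4 * real d * n + 3) ^ d"
    have K: "K > 0" unfolding K_def by (intro zero_less_power add_nonneg_pos) auto
    \<comment> \<open>A ball needs at most K * \<eta>^-d cells of diameter \<eta>; the choice makes
      K * \<eta>^(t - d) at most \<open>e\<close>.\<close>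
    define \<eta> where "\<eta> = min 1 ((e / K) powr (1 / (t - d)))"
    have \<eta>: "\<eta> > 0" "\<eta> \<le> 1" using e K by (auto simp: \<eta>_def)
    have D: "dist x y \<le> 2 * real n" if "x \<in> cball (0::'a) n" "y \<in> cball 0 n" for x y
      using that norm_triangle_ineq4[of x y] by (auto simp: dist_norm)
    obtain \<F> where F: "finite \<F>" "real (card \<F>) \<le> (2 * real d * (2 * n) / \<eta> + 3) ^ d" "cball (0::'a) n \<subseteq> \<Union>\<F>"
      "\<forall>F\<in>\<F>. \<forall>x\<in>F. \<forall>y\<in>F. dist x y \<le> \<eta>"
      using subspace_cells[OF subspace_UNIV subset_UNIV D _ \<eta>(1), of "cball 0 n"] unfolding d_def dim_UNIV by force
    have "2 * real d * (2 * n) / \<eta> + 3 \<le> (4 * real d * n + 3) / \<eta>" using \<eta> by (simp add: field_simps)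
    then have "(2 * real d * (2 * n) / \<eta> + 3) ^ d \<le> ((4 * real d * n + 3) / \<eta>) ^ d"
      using \<eta> by (intro power_mono) auto
    also have "\<dots> = K * \<eta> powr - d" using \<eta> by (simp add: K_def power_divide powr_minus powr_realpow divide_inverse power_mult_distrib power_inverse)
    finally have "card \<F> * \<eta> powr t \<le> K * \<eta> powr - d * \<eta> powr t"
      using F(2) by (intro mult_right_mono) auto
    also have "\<dots> = K * \<eta> powr (t - d)" by (simp add: mult.assoc flip: powr_add)
    also have "\<dots> \<le> K * ((e / K) powr (1 / (t - d))) powr (t - d)"
      using \<eta> K t by (intro mult_left_mono powr_mono2) (auto simp: \<eta>_def d_def)
    also have "\<dots> = e" using e K t by (simp add: powr_powr d_def)
    finally show "\<exists>\<F> \<eta>. finite \<F> \<and> cball (0::'a) n \<subseteq> \<Union>\<F> \<and> 0 < \<eta> \<and>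
      (\<forall>F\<in>\<F>. \<forall>x\<in>F. \<forall>y\<in>F. dist x y \<le> \<eta>) \<and> card \<F> * \<eta> powr t \<le> e" using F \<eta> by blast
  qed
  then have "hausdorff_measure t (\<Union>n. cball (0::'a) (real n)) = 0" by (rule hausdorff_measure_zero_UN[OF t0])
  moreover have "(\<Union>n. cball (0::'a) (real n)) = UNIV" using real_arch_simple by (auto simp: set_eq_iff)
  ultimately show ?thesis by simp
qed

section \<open>Dyadic contents\<close>

text \<open>An index is a level \<open>l\<close> and an integer vector. The cubes are half open with
  side 2^-l, so each level partitions the space and nesting holds exactly.\<close>

definition dcube :: "nat \<times> ('m::finite \<Rightarrow> int) \<Rightarrow> (real ^ 'm) set" where
  "dcube i = {x. \<forall>j. \<lfloor>2 ^ fst i * x $ j\<rfloor> = snd i j}"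

definition dweight :: "real \<Rightarrow> nat \<times> ('m::finite \<Rightarrow> int) \<Rightarrow> real" where
  "dweight t i = 2 powr - (t * real (fst i))"

lemma dweight_pos: "0 < dweight t i"
  by (simp add: dweight_def)

lemma dweight_eq: "dweight t i = (1 / 2 ^ fst i) powr t"
proof -
  have "(1 / 2 ^ fst i :: real) = 2 powr - real (fst i)" by (simp add: powr_minus powr_realpow divide_inverse)
  then show ?thesis by (simp add: dweight_def powr_powr mult.commute)
qed

text \<open>The coarse label is a function of the fine one, which is the nesting of the
  cubes.\<close>

lemma floor_power2_coarsen:
  assumes "a \<le> b"
  shows "\<lfloor>2 ^ a * (u::real)\<rfloor> = \<lfloor>2 ^ b * u\<rfloor> div 2 ^ (b - a)"
proof -
  have "(2::real) ^ b = 2 ^ (b - a) * 2 ^ a" using assms by (simp flip: power_add)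
  then have "2 ^ a * u = 2 ^ b * u / real_of_int (2 ^ (b - a))" by simp
  then show ?thesis using floor_divide_real_eq_div[of "2 ^ (b - a)" "2 ^ b * u"] by simp
qed

lemma dcube_nested: "fst i \<le> fst j \<Longrightarrow> dcube i \<inter> dcube j = {} \<or> dcube j \<subseteq> dcube i"
proof -
  assume "fst i \<le> fst j"
  then have "y \<in> dcube i" if "x \<in> dcube i" "x \<in> dcube j" "y \<in> dcube j" for x y
    using that unfolding dcube_def by (auto simp: floor_power2_coarsen)
  then show ?thesis by blast
qed

interpretation dyadic: net dcube fst "\<lambda>i. ennreal (dweight t i)" for t
  by unfold_locales (rule dcube_nested)

abbreviation dcontent :: "real \<Rightarrow> (real ^ 'm::finite) set \<Rightarrow> ennreal" where
  "dcontent t \<equiv> dyadic.content t"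

lemma dcube_inj: "x \<in> dcube i \<Longrightarrow> x \<in> dcube j \<Longrightarrow> fst i = fst j \<Longrightarrow> i = j"
  by (auto simp: dcube_def prod_eq_iff)

lemma mem_dcube: "x \<in> dcube (l, \<lambda>j. \<lfloor>2 ^ l * x $ j\<rfloor>)"
  by (simp add: dcube_def)

lemma dist_dcube_le:
  fixes x y :: "real ^ 'm"
  assumes "x \<in> dcube i" "y \<in> dcube i"
  shows "dist x y \<le> CARD('m) / 2 ^ fst i"
proof -
  have "\<bar>x $ j - y $ j\<bar> \<le> 1 / 2 ^ fst i" for j
  proof -
    have "\<lfloor>2 ^ fst i * x $ j\<rfloor> = \<lfloor>2 ^ fst i * y $ j\<rfloor>" using assms by (simp add: dcube_def)
    then have "\<bar>2 ^ fst i * x $ j - 2 ^ fst i * y $ j\<bar> < 1" by linarith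
    then have "2 ^ fst i * \<bar>x $ j - y $ j\<bar> < 1" by (simp add: abs_mult flip: right_diff_distrib)
    then show ?thesis by (simp add: field_simps)
  qed
  then have "(\<Sum>j\<in>UNIV. \<bar>(x - y) $ j\<bar>) \<le> (\<Sum>j\<in>(UNIV::'m set). 1 / 2 ^ fst i)" by (intro sum_mono) simp
  then show ?thesis using norm_le_l1_cart[of "x - y"] by (simp add: dist_norm)
qed

text \<open>The source of every factor \<open>3 ^ CARD('m)\<close>: moving a coordinate by at most
  one side length changes its label by at most one.\<close>

lemma dcubes_cover_small_set:
  fixes X :: "(real ^ 'm) set"
  assumes "\<And>y. y \<in> X \<Longrightarrow> dist x y \<le> 1 / 2 ^ l"
  shows "\<exists>F. finite F \<and> card F \<le> 3 ^ CARD('m) \<and> (\<forall>i\<in>F. fst i = l) \<and> X \<subseteq> \<Union>(dcube ` F)"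
proof -
  define z where "z j = \<lfloor>2 ^ l * x $ j\<rfloor>" for j
  define F where "F = Pair l ` (PiE UNIV (\<lambda>j. {z j - 1..z j + 1}))"
  have "card (PiE UNIV (\<lambda>j. {z j - 1..z j + 1})) = 3 ^ CARD('m)" by (simp add: card_PiE)
  moreover have "finite (PiE UNIV (\<lambda>j. {z j - 1..z j + 1}))" by (intro finite_PiE) auto
  ultimately have "finite F" "card F \<le> 3 ^ CARD('m)" unfolding F_def by (auto intro: order_trans[OF card_image_le])
  moreover have "X \<subseteq> \<Union>(dcube ` F)"
  proof
    fix y assume y: "y \<in> X"
    have "\<lfloor>2 ^ l * y $ j\<rfloor> \<in> {z j - 1..z j + 1}" for j
    proof -
      have "\<bar>x $ j - y $ j\<bar> \<le> 1 / 2 ^ l"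
        using component_le_norm_cart[of "x - y" j] assms[OF y] by (simp add: dist_norm)
      then have "2 ^ l * \<bar>x $ j - y $ j\<bar> \<le> 1" by (simp add: field_simps)
      then have "\<bar>2 ^ l * x $ j - 2 ^ l * y $ j\<bar> \<le> 1" by (simp add: abs_mult flip: right_diff_distrib)
      then show ?thesis unfolding z_def by (simp; linarith)
    qed
    then have "(l, \<lambda>j. \<lfloor>2 ^ l * y $ j\<rfloor>) \<in> F" unfolding F_def by (intro imageI) auto
    then show "y \<in> \<Union>(dcube ` F)" using mem_dcube by blast
  qed
  moreover have "fst i = l" if "i \<in> F" for i using that by (auto simp: F_def)
  ultimately show ?thesis by blast
qed

lemma finite_dcubes_meeting:
  fixes A :: "(real ^ 'm) set"
  assumes "bounded A"
  shows "finite {i. fst i = l \<and> dcube i \<inter> A \<noteq> {}}"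
proof -
  obtain b where b: "\<And>x. x \<in> A \<Longrightarrow> norm x \<le> b" using assms bounded_iff by blast
  define N where "N = \<lceil>2 ^ l * b\<rceil> + 1"
  have "{i. fst i = l \<and> dcube i \<inter> A \<noteq> {}} \<subseteq> Pair l ` (PiE UNIV (\<lambda>j. {-N..N}))"
  proof clarsimp
    fix z assume "dcube (l, z) \<inter> A \<noteq> {}"
    then obtain x where x: "x \<in> dcube (l, z)" "x \<in> A" by blast
    have "z j \<in> {-N..N}" for j
    proof -
      have "\<bar>x $ j\<bar> \<le> b" using component_le_norm_cart[of x j] b[OF x(2)] by simp
      then have "\<bar>2 ^ l * x $ j\<bar> \<le> 2 ^ l * b" by (simp add: abs_mult)
      moreover have "z j = \<lfloor>2 ^ l * x $ j\<rfloor>" using x by (simp add: dcube_def)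
      ultimately show ?thesis unfolding N_def by (simp; linarith)
    qed
    then show "(l, z) \<in> Pair l ` (UNIV \<rightarrow>\<^sub>E {-N..N})" by (intro imageI) auto
  qed
  moreover have "finite (Pair l ` (PiE (UNIV::'m set) (\<lambda>j. {-N..N})))" by (intro finite_imageI finite_PiE) auto
  ultimately show ?thesis by (rule finite_subset)
qed

text \<open>Cubes are admissible covering sets of diameter at most \<open>CARD('m)\<close> times
  their side, so a cover by cubes of small total weight is one of small
  \<open>t\<close>-sum.\<close>

lemma hausdorff_measure_zero_if_dcontent_zero:
  fixes A :: "(real ^ 'm) set"
  assumes t: "t > 0" and c: "dcontent t A = 0"
  shows "hausdorff_measure t A = 0"
proof (rule hausdorff_measure_zeroI[OF t])
  fix e :: real assume e: "e > 0"
  define K where "K = real CARD('m) powr t"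
  have K: "K > 0" by (simp add: K_def)
  have eK: "e / K > 0" using e K by simp
  obtain \<C> where C: "A \<subseteq> \<Union>(dcube ` \<C>)" "infsum (\<lambda>i. ennreal (dweight t i)) \<C> \<le> ennreal (e / K)"
    using dyadic.content_approx[of t A "e / K"] c eK by auto
  \<comment> \<open>Covers in \<open>hausdorff_pre\<close> are sequences. The cubes are listed along
    \<open>to_nat\<close>, and the gaps are filled with the empty set, which \<open>diam_pow\<close>
    counts as 0.\<close>
  define D where "D n = (if n \<in> to_nat ` \<C> then dcube (from_nat n :: nat \<times> ('m \<Rightarrow> int)) else {})" for n
  define g where "g n = (if n \<in> to_nat ` \<C> then ennreal (dweight t (from_nat n :: nat \<times> ('m \<Rightarrow> int))) else 0)" for n
  have bdd: "bounded (dcube i)" for i :: "nat \<times> ('m \<Rightarrow> int)"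
    unfolding bounded_two_points using dist_dcube_le[of _ i] by blast
  have diam: "diam_pow t (dcube i) \<le> K * dweight t i" for i :: "nat \<times> ('m \<Rightarrow> int)"
  proof (cases "dcube i = {}")
    case True
    then show ?thesis using K dweight_pos[of t i] by (simp add: diam_pow_def)
  next
    case False
    have "diameter (dcube i) \<le> CARD('m) / 2 ^ fst i"
      using False dist_dcube_le[of _ i] unfolding diameter_def by (auto intro!: cSUP_least)
    then have "diameter (dcube i) powr t \<le> (CARD('m) / 2 ^ fst i) powr t"
      using t diameter_ge_0[OF bdd] by (intro powr_mono2) auto
    also have "\<dots> = K * dweight t i"
      by (simp add: K_def dweight_eq powr_divide)
    finally show ?thesis using False t by (simp add: diam_pow_def)
  qed
  have "(\<Sum>n. ennreal (diam_pow t (D n))) \<le> (\<Sum>n. ennreal K * g n)"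
  proof (intro suminf_le)
    show "ennreal (diam_pow t (D n)) \<le> ennreal K * g n" for n
    proof (cases "n \<in> to_nat ` \<C>")
      case True
      then show ?thesis using ennreal_leI[OF diam[of "from_nat n"]] K dweight_pos[of t "from_nat n :: nat \<times> ('m \<Rightarrow> int)"]
        by (simp add: D_def g_def ennreal_mult less_imp_le)
    qed (simp add: D_def g_def diam_pow_def)
  qed auto
  also have "\<dots> = ennreal K * (\<Sum>n. g n)" by simp
  also have "(\<Sum>n. g n) = infsum g UNIV"
    using has_sum_imp_sums[OF has_sum_infsum, of g] nonneg_summable_on_complete[of UNIV g] sums_unique by force
  also have "\<dots> = infsum (\<lambda>n. ennreal (dweight t (from_nat n :: nat \<times> ('m \<Rightarrow> int)))) (to_nat ` \<C>)"
    by (intro infsum_cong_neutral) (auto simp: g_def)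
  also have "\<dots> = infsum (\<lambda>i. ennreal (dweight t i)) \<C>"
    by (subst infsum_reindex) (auto simp: o_def inj_on_def)
  also have "ennreal K * \<dots> \<le> ennreal K * ennreal (e / K)" by (intro mult_left_mono C) auto
  also have "\<dots> = ennreal e" using K e by (simp flip: ennreal_mult)
  finally have "(\<Sum>n. ennreal (diam_pow t (D n))) \<le> ennreal e" .
  moreover have "A \<subseteq> (\<Union>n. D n)"
  proof
    fix x assume "x \<in> A"
    then obtain i where "i \<in> \<C>" "x \<in> dcube i" using C by blast
    then have "x \<in> D (to_nat i)" by (auto simp: D_def)
    then show "x \<in> (\<Union>n. D n)" by blast
  qed
  moreover have "\<forall>n. bounded (D n)" using bdd by (auto simp: D_def)
  ultimately show "\<exists>C. A \<subseteq> (\<Union>i. C i) \<and> (\<forall>i. bounded (C i)) \<and> (\<Sum>i. ennreal (diam_pow t (C i))) \<le> ennreal e"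
    by blast
qed

section \<open>Finitely supported weights with Frostman bounds\<close>

lemma sum_UN_le:
  fixes m :: "'a \<Rightarrow> real"
  assumes "finite I" "\<And>i. i \<in> I \<Longrightarrow> finite (A i)" "\<And>x. 0 \<le> m x"
  shows "sum m (\<Union>i\<in>I. A i) \<le> (\<Sum>i\<in>I. sum m (A i))"
  using assms(1,2)
proof (induction I rule: finite_induct)
  case (insert i I)
  have "sum m (A i \<union> (\<Union>i\<in>I. A i)) \<le> sum m (A i) + sum m (\<Union>i\<in>I. A i)"
    using insert by (subst sum_Un) (auto intro!: sum_nonneg assms(3))
  then show ?case using insert by simp
qed simp

text \<open>A stand-in for a measure giving each cube mass at most its side to the power
  \<open>t\<close>. It is tested only on cubes of side at least 2^-l, which is what allows a finite
  support.\<close>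

definition dyadic_weights :: "real \<Rightarrow> nat \<Rightarrow> (real ^ 'm) set \<Rightarrow> (real ^ 'm \<Rightarrow> real) \<Rightarrow> bool" where
  "dyadic_weights t l P m \<longleftrightarrow> finite P \<and> (\<forall>p. 0 \<le> m p) \<and>
     (\<forall>i. fst i \<le> l \<longrightarrow> sum m (P \<inter> dcube i) \<le> dweight t i)"

text \<open>A finite substitute for Frostman's lemma, valid for every bounded set.\<close>
lemma frostman_weights:
  fixes A :: "(real ^ 'm) set"
  assumes A: "bounded A"
  shows "\<exists>P m. dyadic_weights t l P m \<and> P \<subseteq> A \<and> dcontent t A \<le> ennreal (sum m P)"
proof -
  define D where "D = {i. fst i \<le> l \<and> dcube i \<inter> A \<noteq> {}}"
  have "D = (\<Union>k\<in>{..l}. {i. fst i = k \<and> dcube i \<inter> A \<noteq> {}})" by (auto simp: D_def)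
  then have finD: "finite D" using finite_dcubes_meeting[OF A] by auto
  define rep where "rep i = (SOME x. x \<in> dcube i \<inter> A)" for i
  have rep: "rep i \<in> dcube i" "rep i \<in> A" if "dcube i \<inter> A \<noteq> {}" for i
    using someI_ex[of "\<lambda>x. x \<in> dcube i \<inter> A"] that unfolding rep_def by auto
  \<comment> \<open>One representative per cube of level \<open>l\<close> meeting \<open>A\<close>.
    A cube of level at most \<open>l\<close> containing the representative contains the whole small
    cube, hence all points of \<open>A\<close> it represents.\<close>
  define P where "P = rep ` {i. fst i = l \<and> dcube i \<inter> A \<noteq> {}}"
  have finP: "finite P" unfolding P_def by (intro finite_imageI finite_dcubes_meeting A)
  have PA: "P \<subseteq> A" using rep(2) unfolding P_def by blast
  have "\<exists>m. (\<forall>p. 0 \<le> m p) \<and> (\<forall>i\<in>D. sum m (P \<inter> dcube i) \<le> dweight t i) \<and> dcontent t A \<le> ennreal (sum m P)"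
  proof (rule dyadic.frostman_finite[OF finP finD])
    show "\<exists>i\<in>D. p \<in> dcube i" if "p \<in> P" for p
      using that PA mem_dcube[of p l] by (intro bexI[of _ "(l, \<lambda>j. \<lfloor>2 ^ l * p $ j\<rfloor>)"]) (auto simp: D_def)
    show "\<exists>p\<in>P. \<forall>i\<in>D. p \<in> dcube i \<longrightarrow> x \<in> dcube i" if x: "x \<in> A" for x
    proof -
      define k where "k = (l, \<lambda>j. \<lfloor>2 ^ l * x $ j\<rfloor>)"
      have k: "x \<in> dcube k" "fst k = l" using mem_dcube[of x l] by (auto simp: k_def)
      then have ne: "dcube k \<inter> A \<noteq> {}" using x by blast
      have "x \<in> dcube i" if "i \<in> D" "rep k \<in> dcube i" for i
        using dyadic.nested[of i k] rep[OF ne] that k by (auto simp: D_def)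
      moreover have "rep k \<in> P" using ne k by (auto simp: P_def)
      ultimately show ?thesis by blast
    qed
    show "0 \<le> dweight t i" for i :: "nat \<times> ('m \<Rightarrow> int)" using dweight_pos[of t i] by simp
    show "i = j" if "fst i = fst j" "dcube i \<inter> dcube j \<noteq> {}" for i j :: "nat \<times> ('m \<Rightarrow> int)"
      using that dcube_inj by blast
  qed simp
  then obtain m where m: "\<And>p. 0 \<le> m p" "\<And>i. i \<in> D \<Longrightarrow> sum m (P \<inter> dcube i) \<le> dweight t i"
    "dcontent t A \<le> ennreal (sum m P)" by blast
  have "sum m (P \<inter> dcube i) \<le> dweight t i" if "fst i \<le> l" for i
  proof (cases "i \<in> D")
    case False
    then have "P \<inter> dcube i = {}" using that PA by (auto simp: D_def)
    then show ?thesis using dweight_pos[of t i] by simp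
  qed (use m in auto)
  then show ?thesis using finP PA m unfolding dyadic_weights_def by blast
qed

lemma dyadic_weights_ball:
  fixes X :: "(real ^ 'm) set"
  assumes m: "dyadic_weights t l P m" and X: "\<And>y. y \<in> X \<Longrightarrow> dist x y \<le> 1 / 2 ^ k" and k: "k \<le> l"
  shows "sum m (P \<inter> X) \<le> 3 ^ CARD('m) * (1 / 2 ^ k) powr t"
proof -
  have P: "finite P" "\<And>p. 0 \<le> m p" "\<And>i. fst i \<le> l \<Longrightarrow> sum m (P \<inter> dcube i) \<le> dweight t i"
    using m by (auto simp: dyadic_weights_def)
  obtain F where F: "finite F" "card F \<le> 3 ^ CARD('m)" "\<And>i. i \<in> F \<Longrightarrow> fst i = k" "X \<subseteq> \<Union>(dcube ` F)"
    using dcubes_cover_small_set[of X x k, OF X] by blast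
  have "sum m (P \<inter> X) \<le> sum m (\<Union>i\<in>F. P \<inter> dcube i)" using P F by (intro sum_mono2) auto
  also have "\<dots> \<le> (\<Sum>i\<in>F. sum m (P \<inter> dcube i))" using sum_UN_le[OF F(1), of "\<lambda>i. P \<inter> dcube i" m] P by auto
  also have "\<dots> \<le> (\<Sum>i\<in>F. (1 / 2 ^ k) powr t)" using P(3) F(3) k by (intro sum_mono) (metis dweight_eq)
  also have "\<dots> = card F * (1 / 2 ^ k) powr t" by simp
  also have "\<dots> \<le> 3 ^ CARD('m) * (1 / 2 ^ k) powr t"
  proof (intro mult_right_mono)
    show "real (card F) \<le> 3 ^ CARD('m)" using F(2) by simp
  qed simp
  finally show ?thesis .
qed

lemma dyadic_weights_small_set:
  fixes X :: "(real ^ 'm) set"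
  assumes m: "dyadic_weights t l P m" and t: "t > 0"
    and r: "\<And>x y. x \<in> X \<Longrightarrow> y \<in> X \<Longrightarrow> dist x y \<le> r" "1 / 2 ^ l \<le> r" "r \<le> 1"
  shows "sum m (P \<inter> X) \<le> 3 ^ CARD('m) * 2 powr t * r powr t"
proof (cases "X = {}")
  case False
  then obtain x where x: "x \<in> X" by blast
  \<comment> \<open>The diameter is rounded up to a power of 1/2, at the cost of a factor 2; since
    \<open>r\<close> is at least 2^-l, the level \<open>k\<close> stays among the tested
    ones.\<close>
  have "\<exists>k. r \<le> 1 / 2 ^ k \<and> 1 / 2 ^ k \<le> 2 * r \<and> k \<le> l"
    using r(2)
  proof (induction l)
    case 0
    then show ?case using r(3) by (intro exI[of _ 0]) auto
  next
    case (Suc l)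
    show ?case
    proof (cases "1 / 2 ^ l \<le> r")
      case True
      then show ?thesis using Suc.IH by (meson le_SucI)
    next
      case False
      then show ?thesis using Suc.prems by (intro exI[of _ l]) (auto simp: field_simps)
    qed
  qed
  then obtain k where k: "r \<le> 1 / 2 ^ k" "1 / 2 ^ k \<le> 2 * r" "k \<le> l" by blast
  have r0: "0 < r" using r(2) by (rule less_le_trans[rotated]) simp
  have "dist x y \<le> 1 / 2 ^ k" if "y \<in> X" for y using r(1)[OF x that] k(1) by simp
  then have "sum m (P \<inter> X) \<le> 3 ^ CARD('m) * (1 / 2 ^ k) powr t" by (rule dyadic_weights_ball[OF m _ k(3)])
  also have "\<dots> \<le> 3 ^ CARD('m) * (2 * r) powr t"
    using t by (intro mult_left_mono powr_mono2 k(2)) auto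
  also have "\<dots> = 3 ^ CARD('m) * 2 powr t * r powr t" using r0 by (simp add: powr_mult)
  finally show ?thesis .
qed simp

section \<open>Analytic sets\<close>

lemma open_baire_cylinder: "open {\<tau> :: nat \<Rightarrow> nat. \<forall>i<N. \<tau> i = \<sigma> i}"
proof -
  have "open ((\<lambda>\<tau> :: nat \<Rightarrow> nat. \<tau> i) -` {\<sigma> i})" for i
    by (rule open_vimage) (auto intro: continuous_on_product_coordinates open_discrete)
  then have "open (\<Inter>i\<in>{..<N}. (\<lambda>\<tau> :: nat \<Rightarrow> nat. \<tau> i) -` {\<sigma> i})" by (intro open_INT) auto
  also have "(\<Inter>i\<in>{..<N}. (\<lambda>\<tau> :: nat \<Rightarrow> nat. \<tau> i) -` {\<sigma> i}) = {\<tau>. \<forall>i<N. \<tau> i = \<sigma> i}" by auto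
  finally show ?thesis .
qed

lemma open_baire_contains_cylinder:
  fixes V :: "(nat \<Rightarrow> nat) set"
  assumes "open V" "\<sigma> \<in> V"
  shows "\<exists>N. \<forall>\<tau>. (\<forall>i<N. \<tau> i = \<sigma> i) \<longrightarrow> \<tau> \<in> V"
proof -
  have "openin (product_topology (\<lambda>i. euclidean) UNIV) V"
    using assms(1) by (simp add: euclidean_product_topology)
  from product_topology_open_contains_basis[OF this assms(2)]
  obtain X where "\<sigma> \<in> PiE UNIV X \<and> (\<forall>i. openin euclidean (X i)) \<and>
      finite {i. X i \<noteq> topspace euclidean} \<and> PiE UNIV X \<subseteq> V" ..
  then have X: "\<sigma> \<in> PiE UNIV X" "finite {i. X i \<noteq> UNIV}" "PiE UNIV X \<subseteq> V" by simp_all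
  obtain N where N: "{i. X i \<noteq> UNIV} \<subseteq> {..<N}" using finite_nat_bounded[OF X(2)] by blast
  have "\<tau> \<in> V" if "\<forall>i<N. \<tau> i = \<sigma> i" for \<tau>
  proof -
    have "\<tau> i \<in> X i" for i using X(1) N that by (cases "X i = UNIV") (auto simp: PiE_iff)
    then show ?thesis using X(3) by (auto simp: PiE_iff subset_iff)
  qed
  then show ?thesis by blast
qed

lemma compact_baire_box: "compact {\<sigma> :: nat \<Rightarrow> nat. \<forall>i. \<sigma> i \<le> m i}"
proof -
  have "compactin (product_topology (\<lambda>i. euclidean) UNIV) (PiE UNIV (\<lambda>i. {..m i}))"
    by (subst compactin_PiE) (auto simp: finite_imp_compact)
  moreover have "PiE UNIV (\<lambda>i. {..m i}) = {\<sigma> :: nat \<Rightarrow> nat. \<forall>i. \<sigma> i \<le> m i}" by (auto simp: PiE_iff)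
  ultimately show ?thesis by (simp add: euclidean_product_topology)
qed

text \<open>The truncations of the points of the unbounded box lie in the compact box.\<close>
lemma baire_box_subset_open:
  fixes V :: "(nat \<Rightarrow> nat) set"
  assumes V: "open V" "{\<sigma>. \<forall>i. \<sigma> i \<le> m i} \<subseteq> V"
  shows "\<exists>k. {\<sigma>. \<forall>i<k. \<sigma> i \<le> m i} \<subseteq> V"
proof -
  define W where "W N = {\<sigma> :: nat \<Rightarrow> nat. \<forall>\<tau>. (\<forall>i<N. \<tau> i = \<sigma> i) \<longrightarrow> \<tau> \<in> V}" for N
  have op: "open (W N)" for N
  proof (subst open_subopen, intro ballI)
    fix \<sigma> assume "\<sigma> \<in> W N"
    then show "\<exists>T. open T \<and> \<sigma> \<in> T \<and> T \<subseteq> W N"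
      by (intro exI[of _ "{\<tau>. \<forall>i<N. \<tau> i = \<sigma> i}"]) (auto simp: W_def open_baire_cylinder)
  qed
  have "\<sigma> \<in> (\<Union>N\<in>UNIV. W N)" if "\<forall>i. \<sigma> i \<le> m i" for \<sigma>
    using open_baire_contains_cylinder[OF V(1), of \<sigma>] V(2) that by (auto simp: W_def)
  then have "{\<sigma>. \<forall>i. \<sigma> i \<le> m i} \<subseteq> (\<Union>N\<in>UNIV. W N)" by blast
  then obtain I where I: "finite I" "{\<sigma>. \<forall>i. \<sigma> i \<le> m i} \<subseteq> (\<Union>N\<in>I. W N)"
    by (rule compactE_image[OF compact_baire_box op])
  obtain k where k: "I \<subseteq> {..<k}" using finite_nat_bounded[OF I(1)] by blast
  have "\<tau> \<in> V" if "\<forall>i<k. \<tau> i \<le> m i" for \<tau>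
  proof -
    define \<sigma> where "\<sigma> i = (if i < k then \<tau> i else 0)" for i
    have "\<forall>i. \<sigma> i \<le> m i" using that by (auto simp: \<sigma>_def)
    then obtain N where "N \<in> I" "\<sigma> \<in> W N" using I by blast
    moreover from \<open>N \<in> I\<close> have "\<forall>i<N. \<tau> i = \<sigma> i" using k by (auto simp: \<sigma>_def)
    ultimately show ?thesis unfolding W_def by blast
  qed
  then show ?thesis by blast
qed

text \<open>Choquet's capacitability argument. In the parametrisation by sequences the coordinates
  are bounded one after another; by \<open>content_incseq\<close> each bound can be chosen with the
  content still above \<open>c0\<close>. The sets \<open>A k\<close> are images of boxes with
  finitely many bounded coordinates, and the lower bound is kept for them rather than for the image
  of the compact limit box. What compactness contributes is the last clause: an open cover of
  \<open>Z\<close> has a finite part that already covers some \<open>A k\<close>.\<close>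

lemma analytic_compact_approximation:
  fixes Z :: "(real ^ 'm) set"
  assumes Z: "analytic_set Z" and c: "dcontent t Z \<noteq> 0"
  shows "\<exists>A c0. decseq A \<and> (\<forall>k. A k \<subseteq> Z \<and> bounded (A k) \<and> ennreal c0 \<le> dcontent t (A k)) \<and> (0::real) < c0 \<and>
    (\<forall>\<U>. (\<forall>U\<in>\<U>. open U) \<longrightarrow> Z \<subseteq> \<Union>\<U> \<longrightarrow> (\<exists>(k::nat) \<U>'. finite \<U>' \<and> \<U>' \<subseteq> \<U> \<and> A k \<subseteq> \<Union>\<U>'))"
proof -
  have "Z \<noteq> {}" using c dyadic.content_empty by metis
  then obtain f :: "(nat \<Rightarrow> nat) \<Rightarrow> real ^ 'm" where f: "continuous_on UNIV f" "Z = range f"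
    using Z unfolding analytic_set_def by auto
  have "0 < dcontent t Z" using c by (simp add: zero_less_iff_neq_zero)
  then obtain a where a: "0 < a" "a < dcontent t Z" using dense by blast
  then have "a < top" using less_top by fastforce
  then obtain c0 where c0: "a = ennreal c0" "0 < c0" using a(1) by (cases a) auto
  have "\<exists>B. \<forall>k. (ennreal c0 < dcontent t (f ` B k) \<and> (k = 0 \<longrightarrow> B k = UNIV)) \<and>
      (\<exists>m. B (Suc k) = B k \<inter> {\<sigma>. \<sigma> k \<le> m})"
  proof (rule dependent_nat_choice)
    show "\<exists>B. ennreal c0 < dcontent t (f ` B) \<and> (0 = (0::nat) \<longrightarrow> B = UNIV)"
      using a c0 f by (intro exI[of _ UNIV]) auto
  next
    fix B and k :: nat
    assume B: "ennreal c0 < dcontent t (f ` B) \<and> (k = 0 \<longrightarrow> B = UNIV)"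
    have "incseq (\<lambda>m. f ` (B \<inter> {\<sigma>. \<sigma> k \<le> m}))" by (auto simp: incseq_def)
    moreover have "f ` B = (\<Union>m. f ` (B \<inter> {\<sigma>. \<sigma> k \<le> m}))" by auto
    ultimately have "dcontent t (f ` B) \<le> (SUP m. dcontent t (f ` (B \<inter> {\<sigma>. \<sigma> k \<le> m})))"
      using dyadic.content_incseq by metis
    then have "ennreal c0 < (SUP m. dcontent t (f ` (B \<inter> {\<sigma>. \<sigma> k \<le> m})))" using B less_le_trans by blast
    then obtain m where "ennreal c0 < dcontent t (f ` (B \<inter> {\<sigma>. \<sigma> k \<le> m}))" unfolding less_SUP_iff by blast
    then show "\<exists>B'. (ennreal c0 < dcontent t (f ` B') \<and> (Suc k = 0 \<longrightarrow> B' = UNIV)) \<and> (\<exists>m. B' = B \<inter> {\<sigma>. \<sigma> k \<le> m})"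
      by blast
  qed
  then obtain B where B: "\<And>k. ennreal c0 < dcontent t (f ` B k)" "B 0 = UNIV"
    "\<And>k. \<exists>m. B (Suc k) = B k \<inter> {\<sigma>. \<sigma> k \<le> m}" by metis
  then obtain m where m: "\<And>k. B (Suc k) = B k \<inter> {\<sigma>. \<sigma> k \<le> m k}" by metis
  have Beq: "B k = {\<sigma>. \<forall>i<k. \<sigma> i \<le> m i}" for k
    by (induction k) (auto simp: B m less_Suc_eq)
  have cov: "\<exists>k \<U>'. finite \<U>' \<and> \<U>' \<subseteq> \<U> \<and> f ` B k \<subseteq> \<Union>\<U>'" if U: "\<forall>U\<in>\<U>. open U" "Z \<subseteq> \<Union>\<U>" for \<U>
  proof -
    have op: "open (f -` U)" if "U \<in> \<U>" for U using that U f(1) by (intro open_vimage) auto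
    have sub: "{\<sigma>. \<forall>i. \<sigma> i \<le> m i} \<subseteq> (\<Union>U\<in>\<U>. f -` U)" using U(2) f(2) by blast
    have "\<exists>\<U>'\<subseteq>\<U>. finite \<U>' \<and> {\<sigma>. \<forall>i. \<sigma> i \<le> m i} \<subseteq> (\<Union>U\<in>\<U>'. f -` U)"
      by (rule compactE_image[OF compact_baire_box _ sub]) (use op in blast)+
    then obtain \<U>' where U': "\<U>' \<subseteq> \<U>" "finite \<U>'" "{\<sigma>. \<forall>i. \<sigma> i \<le> m i} \<subseteq> (\<Union>U\<in>\<U>'. f -` U)" by blast
    have "open (\<Union>U\<in>\<U>'. f -` U)" using U' op by blast
    from baire_box_subset_open[OF this U'(3)] obtain k where "B k \<subseteq> (\<Union>U\<in>\<U>'. f -` U)" using Beq by auto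
    then have "f ` B k \<subseteq> \<Union>\<U>'" by blast
    then show ?thesis using U' by blast
  qed
  \<comment> \<open>The covering clause, applied to balls around the origin, gives an index
    \<open>k0\<close> from which on the images are bounded; the final sequence starts there.\<close>
  have "\<forall>U\<in>range (ball (0::real^'m) \<circ> real). open U" "Z \<subseteq> \<Union>(range (ball (0::real^'m) \<circ> real))"
    using reals_Archimedean2 by auto
  from cov[OF this] obtain k0 \<U>' where k0: "finite \<U>'" "\<U>' \<subseteq> range (ball (0::real^'m) \<circ> real)" "f ` B k0 \<subseteq> \<Union>\<U>'" by blast
  have "bounded (\<Union>\<U>')" using k0(1,2) by (intro bounded_Union) auto
  then have bd: "bounded (f ` B k0)" using k0(3) bounded_subset by blast
  have dec: "B k \<subseteq> B l" if "l \<le> k" for k l using that by (auto simp: Beq)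
  show ?thesis
  proof (intro exI[of _ "\<lambda>k. f ` B (k0 + k)"] exI[of _ c0] conjI allI impI)
    show "decseq (\<lambda>k. f ` B (k0 + k))" unfolding decseq_def by (intro allI impI image_mono dec) simp
    show "f ` B (k0 + k) \<subseteq> Z" for k using f by auto
    show "bounded (f ` B (k0 + k))" for k by (rule bounded_subset[OF bd image_mono[OF dec]]) simp
    show "ennreal c0 \<le> dcontent t (f ` B (k0 + k))" for k using B(1) by (simp add: less_imp_le)
    show "0 < c0" by (rule c0)
    fix \<U> :: "(real ^ 'm) set set" assume "\<forall>U\<in>\<U>. open U" "Z \<subseteq> \<Union>\<U>"
    from cov[OF this] obtain k \<U>' where k: "finite \<U>'" "\<U>' \<subseteq> \<U>" "f ` B k \<subseteq> \<Union>\<U>'" by blast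
    moreover have "f ` B (k0 + k) \<subseteq> f ` B k" by (intro image_mono dec) simp
    ultimately show "\<exists>k \<U>'. finite \<U>' \<and> \<U>' \<subseteq> \<U> \<and> f ` B (k0 + k) \<subseteq> \<Union>\<U>'"
      by (intro exI[of _ k] exI[of _ \<U>'] conjI) (assumption | (rule order_trans, assumption, assumption))+
  qed
qed

section \<open>Sublevel sets of functions with controlled gradient\<close>

text \<open>\<open>g\<close> is the gradient of \<open>f\<close> along \<open>L\<close>. Regularity
  is expressed by two-point inequalities, a quadratic Taylor remainder and a Lipschitz bound, so
  that it passes to arbitrary subsets of \<open>X\<close>.\<close>

definition regular_gradient :: "'a::euclidean_space set \<Rightarrow> real \<Rightarrow> real \<Rightarrow> 'a set \<Rightarrow> ('a \<Rightarrow> real) \<Rightarrow> ('a \<Rightarrow> 'a) \<Rightarrow> bool" where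
  "regular_gradient L M R0 X f g \<longleftrightarrow>
     (\<forall>v\<in>X. g v \<in> L \<and> norm (g v) \<le> R0) \<and>
     (\<forall>v\<in>X. \<forall>v'\<in>X. \<bar>f v' - f v - g v \<bullet> (v' - v)\<bar> \<le> M * (dist v v')\<^sup>2 \<and> dist (g v) (g v') \<le> M * dist v v')"

text \<open>The Frostman bound phrased with diameters, because a chart does not respect cubes;
  \<open>\<delta>\<close> is the resolution inherited from the weights on the manifold.\<close>

definition spread_weights :: "real \<Rightarrow> real \<Rightarrow> real \<Rightarrow> 'a::euclidean_space set \<Rightarrow> ('a \<Rightarrow> real) \<Rightarrow> bool" where
  "spread_weights C t \<delta> Q m \<longleftrightarrow> finite Q \<and> (\<forall>p. 0 \<le> m p) \<and>
     (\<forall>Y r. (\<forall>x\<in>Y. \<forall>y\<in>Y. dist x y \<le> r) \<longrightarrow> \<delta> \<le> r \<longrightarrow> sum m (Q \<inter> Y) \<le> C * r powr t)"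

lemma regular_gradient_subset:
  "regular_gradient L M R0 X f g \<Longrightarrow> Y \<subseteq> X \<Longrightarrow> regular_gradient L M R0 Y f g"
  unfolding regular_gradient_def by blast

lemma spread_weights_cover:
  fixes m :: "'a::euclidean_space \<Rightarrow> real" and b :: real
  assumes m: "spread_weights C t \<delta> Q m" and F: "finite \<F>" "Q \<inter> Y \<subseteq> \<Union>\<F>"
    and le: "\<And>F. F \<in> \<F> \<Longrightarrow> sum m (Q \<inter> F) \<le> b"
  shows "sum m (Q \<inter> Y) \<le> card \<F> * b"
proof -
  have Q: "finite Q" "\<And>p. 0 \<le> m p" using m by (auto simp: spread_weights_def)
  have "sum m (Q \<inter> Y) \<le> sum m (\<Union>F\<in>\<F>. Q \<inter> F)" using Q F by (intro sum_mono2) auto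
  also have "\<dots> \<le> (\<Sum>F\<in>\<F>. sum m (Q \<inter> F))" using sum_UN_le[of \<F> "\<lambda>F. Q \<inter> F" m] Q F by auto
  also have "\<dots> \<le> (\<Sum>F\<in>\<F>. b)" by (intro sum_mono le)
  finally show ?thesis by simp
qed

lemma dim_orthogonal_hyperplane:
  fixes L :: "'a::euclidean_space set"
  assumes L: "subspace L" and e: "e \<in> L" "norm e = 1"
  shows "subspace {x\<in>L. e \<bullet> x = 0}" "dim {x\<in>L. e \<bullet> x = 0} = dim L - 1"
proof -
  show "subspace {x\<in>L. e \<bullet> x = 0}"
    using L by (auto simp: subspace_def inner_simps)
  have "span {e} \<subseteq> L" using L e by (simp add: span_minimal)
  from dim_subspace_orthogonal_to_vectors[OF subspace_span L this]
  have "dim {y\<in>L. \<forall>x\<in>span {e}. orthogonal x y} + dim (span {e}) = dim L" .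
  moreover have "{y\<in>L. \<forall>x\<in>span {e}. orthogonal x y} = {x\<in>L. e \<bullet> x = 0}"
    by (auto simp: span_singleton orthogonal_def)
  moreover have "dim (span {e}) = 1" using e dim_span[of "{e}"] dim_singleton[of e] by auto
  ultimately show "dim {x\<in>L. e \<bullet> x = 0} = dim L - 1" by simp
qed

text \<open>On \<open>Y\<close> the direction of the gradient is nearly constant, so that a point of the
  sublevel set is determined up to \<open>\<rho> / R\<close> by its projection along this direction.\<close>
lemma sublevel_weight_small_piece:
  fixes L :: "'a::euclidean_space set"
  assumes L: "subspace L" "Y \<subseteq> L" and reg: "regular_gradient L M R0 Y f g" and m: "spread_weights C t \<delta> Q m"
    and M: "M > 0" and R: "0 < R" "R \<le> R0" "\<And>v. v \<in> Y \<Longrightarrow> R \<le> norm (g v)"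
    and Y: "\<And>v v'. v \<in> Y \<Longrightarrow> v' \<in> Y \<Longrightarrow> dist v v' \<le> R / (8 * M)"
    and \<rho>: "0 < \<rho>" "\<delta> \<le> \<rho>" and C: "C \<ge> 0"
  shows "sum m (Q \<inter> {v\<in>Y. \<bar>f v\<bar> \<le> \<rho>}) \<le>
    (real (dim L - 1) * R\<^sup>2 / (4 * M * \<rho>) + 3) ^ (dim L - 1) * (C * ((4 + R0) * \<rho> / R) powr t)"
proof (cases "{v\<in>Y. \<bar>f v\<bar> \<le> \<rho>} = {}")
  case True
  then have "sum m (Q \<inter> {v\<in>Y. \<bar>f v\<bar> \<le> \<rho>}) = 0" by (simp only: Int_empty_right sum.empty)
  then show ?thesis using R M \<rho> C by simp
next
  case False
  define Y' where "Y' = {v\<in>Y. \<bar>f v\<bar> \<le> \<rho>}"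
  obtain v1 where v1: "v1 \<in> Y" "\<bar>f v1\<bar> \<le> \<rho>" using False by blast
  define e where "e = g v1 /\<^sub>R norm (g v1)"
  have g1: "norm (g v1) \<ge> R" using R(3) v1 by blast
  have g0: "norm (g v1) \<noteq> 0" using g1 R(1) by linarith
  then have ge: "g v1 = norm (g v1) *\<^sub>R e" by (simp add: e_def)
  have "g v1 \<in> L" using reg v1(1) by (simp add: regular_gradient_def)
  then have e: "e \<in> L" "norm e = 1"
    using g0 L(1) by (simp_all add: e_def subspace_scale)
  define \<pi> where "\<pi> v = v - (e \<bullet> v) *\<^sub>R e" for v
  define \<eta> where "\<eta> = \<rho> / R"
  have \<eta>: "\<eta> > 0" using \<rho> R by (simp add: \<eta>_def)
  have ee: "e \<bullet> e = 1" using e(2) by (simp add: dot_square_norm)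
  have \<pi>_diff: "\<pi> v - \<pi> v' = \<pi> (v - v')" for v v' by (simp add: \<pi>_def inner_simps algebra_simps)
  have norm_\<pi>: "norm (\<pi> v) \<le> norm v" for v
  proof -
    have "orthogonal (\<pi> v) ((e \<bullet> v) *\<^sub>R e)"
      by (simp add: \<pi>_def orthogonal_def inner_simps ee inner_commute)
    from norm_add_Pythagorean[OF this] have "(norm (\<pi> v))\<^sup>2 \<le> (norm v)\<^sup>2" by (simp add: \<pi>_def)
    then show ?thesis by (rule power2_le_imp_le) simp
  qed
  have "\<pi> ` Y' \<subseteq> {x\<in>L. e \<bullet> x = 0}"
    using L e ee by (auto simp: \<pi>_def Y'_def inner_simps subspace_diff subspace_scale subset_iff)
  moreover have "dist x y \<le> R / (8 * M)" if "x \<in> \<pi> ` Y'" "y \<in> \<pi> ` Y'" for x y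
  proof -
    obtain v v' where v: "v \<in> Y" "v' \<in> Y" "x = \<pi> v" "y = \<pi> v'" using \<open>x \<in> \<pi> ` Y'\<close> \<open>y \<in> \<pi> ` Y'\<close> by (auto simp: Y'_def)
    then have "dist x y = norm (\<pi> (v - v'))" by (simp add: dist_norm \<pi>_diff)
    also have "\<dots> \<le> dist v v'" using norm_\<pi> by (simp add: dist_norm)
    also have "\<dots> \<le> R / (8 * M)" by (rule Y[OF v(1,2)])
    finally show ?thesis .
  qed
  ultimately obtain \<F> where F: "finite \<F>"
    "real (card \<F>) \<le> (2 * real (dim L - 1) * (R / (8 * M)) / \<eta> + 3) ^ (dim L - 1)" "\<pi> ` Y' \<subseteq> \<Union>\<F>"
    "\<forall>F\<in>\<F>. \<forall>x\<in>F. \<forall>y\<in>F. x \<in> \<pi> ` Y' \<and> dist x y \<le> \<eta>"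
    using subspace_cells[OF dim_orthogonal_hyperplane(1)[OF L(1) e], of "\<pi> ` Y'" "R / (8 * M)" \<eta>]
      dim_orthogonal_hyperplane(2)[OF L(1) e] \<eta> R M by auto
  \<comment> \<open>With d the distance of the points, the Taylor error and the turning of the
    gradient contribute at most R/8 * d each, because \<open>Y\<close> has diameter at most
    \<open>R / (8 * M)\<close>. Hence the component along \<open>e\<close> is at most 2 \<eta> +
    d/4, so d <= 3 \<eta> + d/4, which gives d <= 4 \<eta>.\<close>
  have close: "dist v v' \<le> 4 * \<eta>" if v: "v \<in> Y'" "v' \<in> Y'" "dist (\<pi> v) (\<pi> v') \<le> \<eta>" for v v'
  proof -
    define d where "d = norm (v' - v)"
    have vY: "v \<in> Y" "v' \<in> Y" "\<bar>f v\<bar> \<le> \<rho>" "\<bar>f v'\<bar> \<le> \<rho>" using v by (auto simp: Y'_def)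
    have d: "0 \<le> d" "d \<le> R / (8 * M)" using Y[OF vY(2,1)] by (auto simp: d_def dist_norm)
    have T: "\<bar>f v' - f v - g v \<bullet> (v' - v)\<bar> \<le> M * d\<^sup>2"
      using reg vY by (auto simp: regular_gradient_def d_def dist_norm norm_minus_commute)
    have "M * d\<^sup>2 \<le> R / 8 * d"
      using mult_right_mono[OF d(2) d(1)] M by (simp add: power2_eq_square field_simps)
    then have 1: "\<bar>g v \<bullet> (v' - v)\<bar> \<le> 2 * \<rho> + R / 8 * d" using T vY by linarith
    have "norm (g v1 - g v) \<le> M * dist v1 v" using reg vY v1 by (auto simp: regular_gradient_def dist_norm)
    also have "\<dots> \<le> R / 8" using Y[OF v1(1) vY(1)] M by (simp add: field_simps)
    finally have 2: "\<bar>(g v1 - g v) \<bullet> (v' - v)\<bar> \<le> R / 8 * d"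
      using Cauchy_Schwarz_ineq2[of "g v1 - g v" "v' - v"] unfolding d_def
      by (meson mult_right_mono norm_ge_zero order_trans)
    have "g v1 \<bullet> (v' - v) = g v \<bullet> (v' - v) + (g v1 - g v) \<bullet> (v' - v)" by (simp add: inner_simps)
    then have "\<bar>g v1 \<bullet> (v' - v)\<bar> \<le> 2 * \<rho> + R / 4 * d" using 1 2 by linarith
    moreover have "\<bar>g v1 \<bullet> (v' - v)\<bar> = norm (g v1) * \<bar>e \<bullet> (v' - v)\<bar>" by (subst ge) (simp add: abs_mult)
    moreover have "R * \<bar>e \<bullet> (v' - v)\<bar> \<le> norm (g v1) * \<bar>e \<bullet> (v' - v)\<bar>" using g1 by (intro mult_right_mono) auto
    ultimately have "R * \<bar>e \<bullet> (v' - v)\<bar> \<le> 2 * \<rho> + R / 4 * d" by linarith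
    then have 3: "\<bar>e \<bullet> (v' - v)\<bar> \<le> 2 * \<eta> + d / 4" using R(1) by (simp add: \<eta>_def field_simps)
    have "v' - v = \<pi> (v' - v) + (e \<bullet> (v' - v)) *\<^sub>R e" by (simp add: \<pi>_def)
    then have "d \<le> norm (\<pi> (v' - v)) + \<bar>e \<bullet> (v' - v)\<bar>"
      unfolding d_def using norm_triangle_ineq[of "\<pi> (v' - v)" "(e \<bullet> (v' - v)) *\<^sub>R e"] e(2) by simp
    moreover have "norm (\<pi> (v' - v)) \<le> \<eta>" using v(3) by (simp add: dist_norm \<pi>_diff[symmetric] norm_minus_commute)
    ultimately have "d \<le> 4 * \<eta>" using 3 \<eta> by linarith
    then show ?thesis by (simp add: d_def dist_norm norm_minus_commute)
  qed
  define G where "G F = {v\<in>Y'. \<pi> v \<in> F}" for F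
  have bG: "sum m (Q \<inter> G F) \<le> C * ((4 + R0) * \<rho> / R) powr t" if "F \<in> \<F>" for F
  proof -
    \<comment> \<open>The factor \<open>4 + R0\<close> in place of 4 makes the radius at least
      \<open>\<rho>\<close>, hence at least the resolution \<open>\<delta>\<close>, because R <=
      R0.\<close>
    have "4 * \<eta> \<le> (4 + R0) * \<rho> / R" "\<delta> \<le> (4 + R0) * \<rho> / R"
    proof -
      show "4 * \<eta> \<le> (4 + R0) * \<rho> / R" using R \<rho> by (simp add: \<eta>_def field_simps)
      have "\<rho> * R \<le> \<rho> * (4 + R0)" using R \<rho> by (intro mult_left_mono) auto
      then have "\<rho> \<le> (4 + R0) * \<rho> / R" using R by (simp add: field_simps)
      then show "\<delta> \<le> (4 + R0) * \<rho> / R" using \<rho> by simp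
    qed
    moreover have "\<forall>x\<in>G F. \<forall>y\<in>G F. dist x y \<le> 4 * \<eta>" using close F(4) that by (auto simp: G_def)
    ultimately show ?thesis using m unfolding spread_weights_def by (meson order_trans)
  qed
  have "sum m (Q \<inter> Y') \<le> real (card (G ` \<F>)) * (C * ((4 + R0) * \<rho> / R) powr t)"
    using F(1,3) bG by (intro spread_weights_cover[OF m]) (auto simp: G_def)
  also have "\<dots> \<le> real (card \<F>) * (C * ((4 + R0) * \<rho> / R) powr t)"
    using C F(1) by (intro mult_right_mono) (auto simp: card_image_le)
  also have "\<dots> \<le> (2 * real (dim L - 1) * (R / (8 * M)) / \<eta> + 3) ^ (dim L - 1) * (C * ((4 + R0) * \<rho> / R) powr t)"
    using C F(2) by (intro mult_right_mono) auto
  also have "2 * real (dim L - 1) * (R / (8 * M)) / \<eta> = real (dim L - 1) * R\<^sup>2 / (4 * M * \<rho>)"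
    using R M \<rho> by (simp add: \<eta>_def power2_eq_square field_simps)
  finally show ?thesis by (simp add: Y'_def)
qed

text \<open>A set of diameter \<open>N * R\<close> splits into pieces of diameter
  \<open>R / (8 * M)\<close>, and their number does not depend on \<open>R\<close>. With k = dim L -
  1, a piece meets the sublevel set in about (R^2 / \<rho>)^k cells of weight (\<rho> / R)^t each,
  and the product is \<rho>^s R^(k - s). The condition \<rho> <= R^2 lets the additive constant in
  the number of cells be absorbed.\<close>

lemma sublevel_weight_shell:
  fixes L :: "'a::euclidean_space set"
  assumes L: "subspace L" "X \<subseteq> L" and reg: "regular_gradient L M R0 X f g" and m: "spread_weights C t \<delta> Q m"
    and M: "M > 0" and R: "0 < R" "R \<le> R0" "\<rho> \<le> R\<^sup>2"
    and Y: "Y \<subseteq> X" "\<And>v. v \<in> Y \<Longrightarrow> R \<le> norm (g v)" "\<And>v v'. v \<in> Y \<Longrightarrow> v' \<in> Y \<Longrightarrow> dist v v' \<le> N * R"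
    and \<rho>: "0 < \<rho>" "\<delta> \<le> \<rho>" and C: "C \<ge> 0" and N: "N \<ge> 0" and t: "t = real (dim L - 1) + s" "0 < s"
  shows "sum m (Q \<inter> {v\<in>Y. \<bar>f v\<bar> \<le> \<rho>}) \<le>
    (16 * real (dim L) * N * M + 3) ^ dim L * ((real (dim L - 1) / (4 * M) + 3) ^ (dim L - 1) * (C * (4 + R0) powr t)) *
      \<rho> powr s * R powr (real (dim L - 1) - s)"
proof -
  define k where "k = dim L - 1"
  have R0: "R0 > 0" using R by simp
  obtain \<F> where F: "finite \<F>" "real (card \<F>) \<le> (2 * real (dim L) * (N * R) / (R / (8 * M)) + 3) ^ dim L" "Y \<subseteq> \<Union>\<F>"
    "\<forall>F\<in>\<F>. \<forall>x\<in>F. \<forall>y\<in>F. x \<in> Y \<and> dist x y \<le> R / (8 * M)"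
    using subspace_cells[OF L(1) subset_trans[OF Y(1) L(2)] Y(3), of "R / (8 * M)"] R M N by auto
  define K where "K = (real k / (4 * M) + 3) ^ k * (C * (4 + R0) powr t)"
  have K: "K \<ge> 0" using M C by (simp add: K_def)
  have "sum m (Q \<inter> {v\<in>F. \<bar>f v\<bar> \<le> \<rho>}) \<le> K * \<rho> powr s * R powr (real k - s)" if FF: "F \<in> \<F>" for F
  proof -
    have FY: "F \<subseteq> Y" using F(4) that by blast
    have "sum m (Q \<inter> {v\<in>F. \<bar>f v\<bar> \<le> \<rho>}) \<le>
      (real k * R\<^sup>2 / (4 * M * \<rho>) + 3) ^ k * (C * ((4 + R0) * \<rho> / R) powr t)"
      unfolding k_def
    proof (rule sublevel_weight_small_piece[OF L(1) _ _ m M R(1,2) _ _ \<rho> C])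
      show "F \<subseteq> L" using FY Y L by blast
      show "regular_gradient L M R0 F f g" using regular_gradient_subset[OF reg] FY Y by blast
    qed (use FY Y F(4) FF in auto)
    also have "\<dots> \<le> ((real k / (4 * M) + 3) * (R\<^sup>2 / \<rho>)) ^ k * (C * ((4 + R0) * \<rho> / R) powr t)"
    proof (intro mult_right_mono power_mono)
      have "3 \<le> 3 * (R\<^sup>2 / \<rho>)" using R(3) \<rho> by (simp add: field_simps)
      moreover have "real k * R\<^sup>2 / (4 * M * \<rho>) = real k / (4 * M) * (R\<^sup>2 / \<rho>)" by simp
      ultimately show "real k * R\<^sup>2 / (4 * M * \<rho>) + 3 \<le> (real k / (4 * M) + 3) * (R\<^sup>2 / \<rho>)"
        unfolding distrib_right by linarith
    qed (use M \<rho> C in auto)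
    also have "\<dots> = K * ((R\<^sup>2 / \<rho>) ^ k * (\<rho> / R) powr t)"
    proof -
      have "((4 + R0) * \<rho> / R) powr t = (4 + R0) powr t * (\<rho> / R) powr t"
        using R0 \<rho> R by (simp add: powr_mult[symmetric])
      then show ?thesis unfolding K_def power_mult_distrib by simp
    qed
    also have "(R\<^sup>2 / \<rho>) ^ k * (\<rho> / R) powr t = \<rho> powr s * R powr (real k - s)"
    proof -
      have 1: "(R\<^sup>2 / \<rho>) ^ k = R powr (2 * k) / \<rho> powr k"
      proof -
        have "(R\<^sup>2) ^ k = R powr (2 * k)" using powr_realpow[OF R(1), of "2 * k"] by (simp add: power_mult)
        then show ?thesis using \<rho> by (simp add: power_divide powr_realpow)
      qed
      have 2: "(\<rho> / R) powr t = \<rho> powr t / R powr t" using R \<rho> by (simp add: powr_divide)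
      have 3: "\<rho> powr t / \<rho> powr k = \<rho> powr s" using t by (simp add: k_def flip: powr_diff)
      have 4: "R powr (2 * k) / R powr t = R powr (real k - s)" using t by (simp add: k_def flip: powr_diff)
      show ?thesis unfolding 1 2 3[symmetric] 4[symmetric] by simp
    qed
    finally show ?thesis by (simp add: mult.assoc)
  qed
  then have "sum m (Q \<inter> {v\<in>Y. \<bar>f v\<bar> \<le> \<rho>}) \<le> card ((\<lambda>F. {v\<in>F. \<bar>f v\<bar> \<le> \<rho>}) ` \<F>) * (K * \<rho> powr s * R powr (real k - s))"
    by (intro spread_weights_cover[OF m]) (use F(1,3) in \<open>blast+\<close>)
  also have "\<dots> \<le> (16 * real (dim L) * N * M + 3) ^ dim L * (K * \<rho> powr s * R powr (real k - s))"
  proof (intro mult_right_mono)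
    have "real (card ((\<lambda>F. {v\<in>F. \<bar>f v\<bar> \<le> \<rho>}) ` \<F>)) \<le> real (card \<F>)" using F(1) by (simp add: card_image_le)
    also have "\<dots> \<le> (16 * real (dim L) * N * M + 3) ^ dim L" using F(2) R M by (simp add: field_simps)
    finally show "real (card ((\<lambda>F. {v\<in>F. \<bar>f v\<bar> \<le> \<rho>}) ` \<F>)) \<le> (16 * real (dim L) * N * M + 3) ^ dim L" .
  qed (use K in auto)
  finally show ?thesis by (simp add: K_def k_def mult.assoc)
qed

text \<open>Since \<open>g\<close> expands distances, the points with |g| <= x form a set of
  diameter at most 2 x / a. The core x = sqrt \<rho> has weight of order \<rho>^(t/2), which is at
  most \<rho>^s because t >= 1 + s > 2 s. Above the core, where \<rho> <= x^2, dyadic shells of the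
  gradient contribute \<rho>^s x^\<kappa> with \<kappa> > 0, a geometric sum dominated by its last
  term.\<close>

lemma sublevel_weight_immersed:
  fixes L :: "'a::euclidean_space set"
  assumes L: "subspace L" "X \<subseteq> L" "2 \<le> dim L" and M: "M > 0" and a: "a > 0" and R0: "R0 > 0" and C: "C \<ge> 0"
    and s: "0 < s" "s < 1" and t: "t = real (dim L - 1) + s"
  shows "\<exists>K>0. \<forall>f g Q m \<delta> \<rho>. regular_gradient L M R0 X f g \<longrightarrow> (\<forall>v\<in>X. \<forall>v'\<in>X. a * dist v v' \<le> dist (g v) (g v')) \<longrightarrow>
    spread_weights C t \<delta> Q m \<longrightarrow> \<delta> \<le> \<rho> \<longrightarrow> 0 < \<rho> \<longrightarrow> \<rho> \<le> 1 \<longrightarrow>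
    sum m (Q \<inter> {v\<in>X. \<bar>f v\<bar> \<le> \<rho>}) \<le> K * \<rho> powr s"
proof -
  define \<kappa> where "\<kappa> = real (dim L - 1) - s"
  have \<kappa>: "\<kappa> > 0" using L(3) s by (simp add: \<kappa>_def)
  define K1 where "K1 = (16 * real (dim L) * (4 / a) * M + 3) ^ dim L *
    ((real (dim L - 1) / (4 * M) + 3) ^ (dim L - 1) * (C * (4 + R0) powr t))"
  have K1: "K1 \<ge> 0" using M C a by (simp add: K1_def)
  \<comment> \<open>Chosen so that K5 + K1 = K5 * 2^\<kappa>: adding one shell to the bound for
    \<open>x\<close> then reproduces the bound for \<open>2 * x\<close>.\<close>
  define K5 where "K5 = K1 / (2 powr \<kappa> - 1)"
  have p\<kappa>: "2 powr \<kappa> > 1" using \<kappa> by simp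
  have K5: "K5 \<ge> 0" using K1 p\<kappa> by (simp add: K5_def)
  have K51: "K5 + K1 = K5 * 2 powr \<kappa>" proof -
    have "K1 = K5 * (2 powr \<kappa> - 1)" using p\<kappa> \<kappa> by (simp add: K5_def)
    then show ?thesis by (simp add: algebra_simps)
  qed
  define K4 where "K4 = C * (2 / a + 1) powr t"
  have K4: "K4 \<ge> 0" using C by (simp add: K4_def)
  define K where "K = K4 + K5 * (2 * R0 + 1) powr \<kappa> + 1"
  have K: "K > 0" using K4 K5 by (simp add: K_def add_nonneg_pos)
  have "sum m (Q \<inter> {v\<in>X. \<bar>f v\<bar> \<le> \<rho>}) \<le> K * \<rho> powr s"
    if reg: "regular_gradient L M R0 X f g" and imm: "\<forall>v\<in>X. \<forall>v'\<in>X. a * dist v v' \<le> dist (g v) (g v')"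
      and m: "spread_weights C t \<delta> Q m" and \<rho>: "\<delta> \<le> \<rho>" "0 < \<rho>" "\<rho> \<le> 1" for f g Q m \<delta> \<rho>
  proof -
    have Q: "finite Q" "\<And>p. 0 \<le> m p" using m by (auto simp: spread_weights_def)
    have sq: "0 < sqrt \<rho>" "\<rho> \<le> sqrt \<rho>" "sqrt \<rho> \<le> 1"
      using \<rho> real_sqrt_le_iff[of "\<rho>\<^sup>2" \<rho>] mult_left_le_one_le[of \<rho> \<rho>] by (auto simp: power2_eq_square)
    define S where "S x = {v\<in>X. \<bar>f v\<bar> \<le> \<rho> \<and> norm (g v) \<le> x}" for x
    have diam: "dist v v' \<le> 2 * x / a" if "v \<in> X" "v' \<in> X" "norm (g v) \<le> x" "norm (g v') \<le> x" for v v' x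
    proof -
      have "a * dist v v' \<le> dist (g v) (g v')" using imm that by blast
      also have "\<dots> \<le> 2 * x" using norm_triangle_ineq4[of "g v" "g v'"] that by (simp add: dist_norm)
      finally show ?thesis using a by (simp add: field_simps)
    qed
    have base: "sum m (Q \<inter> S (sqrt \<rho>)) \<le> K4 * \<rho> powr s"
    proof -
      have "\<forall>x\<in>S (sqrt \<rho>). \<forall>y\<in>S (sqrt \<rho>). dist x y \<le> (2 / a + 1) * sqrt \<rho>"
        using diam[of _ _ "sqrt \<rho>"] sq by (force simp: S_def distrib_right)
      moreover have "\<delta> \<le> (2 / a + 1) * sqrt \<rho>"
      proof -
        have "0 \<le> 2 / a * sqrt \<rho>" using a sq by simp
        then show ?thesis using \<rho> sq unfolding distrib_right by linarith
      qed
      ultimately have "sum m (Q \<inter> S (sqrt \<rho>)) \<le> C * ((2 / a + 1) * sqrt \<rho>) powr t"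
        using m unfolding spread_weights_def by blast
      also have "\<dots> = K4 * sqrt \<rho> powr t" using a sq by (simp add: K4_def powr_mult)
      also have "sqrt \<rho> powr t = \<rho> powr (t / 2)" using \<rho> by (simp add: powr_half_sqrt[symmetric] powr_powr)
      also have "\<rho> powr (t / 2) \<le> \<rho> powr s"
        using \<rho> t s L(3) by (intro powr_mono') auto
      finally show ?thesis using K4 by (simp add: mult_left_mono)
    qed
    have step: "sum m (Q \<inter> S (sqrt \<rho> * 2 ^ n)) \<le> (K4 + K5 * (sqrt \<rho> * 2 ^ n) powr \<kappa>) * \<rho> powr s"
      if "\<forall>i<n. sqrt \<rho> * 2 ^ i \<le> R0" for n
      using that
    proof (induction n)
      case 0
      have "K4 * \<rho> powr s \<le> (K4 + K5 * sqrt \<rho> powr \<kappa>) * \<rho> powr s" using K5 by (intro mult_right_mono) auto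
      then show ?case using base by simp
    next
      case (Suc n)
      define x where "x = sqrt \<rho> * 2 ^ n"
      have x: "0 < x" "x \<le> R0" "sqrt \<rho> \<le> x" using sq Suc.prems by (auto simp: x_def)
      have "(sqrt \<rho>)\<^sup>2 \<le> x\<^sup>2" using x sq by (intro power_mono) auto
      then have x2: "\<rho> \<le> x\<^sup>2" using \<rho> by simp
      define Y where "Y = {v\<in>X. x \<le> norm (g v) \<and> norm (g v) \<le> 2 * x}"
      have "sum m (Q \<inter> {v\<in>Y. \<bar>f v\<bar> \<le> \<rho>}) \<le> K1 * \<rho> powr s * x powr \<kappa>"
        unfolding K1_def \<kappa>_def
      proof (rule sublevel_weight_shell[OF L(1,2) reg m M x(1,2) x2 _ _ _ \<rho>(2,1) C _ t s(1)])
        show "dist v v' \<le> 4 / a * x" if "v \<in> Y" "v' \<in> Y" for v v'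
          using diam[of v v' "2 * x"] that by (simp add: Y_def)
      qed (use a in \<open>auto simp: Y_def\<close>)
      moreover have "sum m (Q \<inter> S (2 * x)) \<le> sum m (Q \<inter> S x \<union> Q \<inter> {v\<in>Y. \<bar>f v\<bar> \<le> \<rho>})"
        using Q by (intro sum_mono2) (auto simp: S_def Y_def)
      moreover have "\<dots> \<le> sum m (Q \<inter> S x) + sum m (Q \<inter> {v\<in>Y. \<bar>f v\<bar> \<le> \<rho>})"
        using Q by (subst sum_Un) (auto intro!: sum_nonneg)
      moreover have "sum m (Q \<inter> S x) \<le> (K4 + K5 * x powr \<kappa>) * \<rho> powr s"
        using Suc unfolding x_def by simp
      ultimately have "sum m (Q \<inter> S (2 * x)) \<le> (K4 + K5 * x powr \<kappa>) * \<rho> powr s + K1 * \<rho> powr s * x powr \<kappa>"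
        by linarith
      also have "\<dots> = (K4 + (K5 + K1) * x powr \<kappa>) * \<rho> powr s" by (simp add: algebra_simps)
      also have "(K5 + K1) * x powr \<kappa> = K5 * (2 * x) powr \<kappa>" using x by (simp add: K51 powr_mult)
      finally show ?case by (simp add: x_def mult.left_commute)
    qed
    obtain n0 where "R0 / sqrt \<rho> < 2 ^ n0" using real_arch_pow[of 2 "R0 / sqrt \<rho>"] by auto
    then have ex: "R0 < sqrt \<rho> * 2 ^ n0" using sq by (simp add: field_simps)
    \<comment> \<open>The first dyadic multiple of sqrt \<rho> exceeding \<open>R0\<close> bounds
      every gradient and is at most 2 * R0, unless it is sqrt \<rho> itself, which is at most
      1.\<close>
    define n where "n = (LEAST n. R0 < sqrt \<rho> * 2 ^ n)"
    have n: "R0 < sqrt \<rho> * 2 ^ n" unfolding n_def by (rule LeastI[of "\<lambda>n. R0 < sqrt \<rho> * 2 ^ n", OF ex])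
    have ln: "\<forall>i<n. sqrt \<rho> * 2 ^ i \<le> R0" unfolding n_def using not_less_Least[of _ "\<lambda>n. R0 < sqrt \<rho> * 2 ^ n"] by (auto simp: not_less)
    have up: "sqrt \<rho> * 2 ^ n \<le> 2 * R0 + 1"
    proof (cases n)
      case 0
      then have "sqrt \<rho> * 2 ^ n = sqrt \<rho>" by simp
      then show ?thesis using sq(3) R0 by linarith
    next
      case (Suc k)
      then show ?thesis using ln[rule_format, of k] by simp
    qed
    have "norm (g v) \<le> sqrt \<rho> * 2 ^ n" if "v \<in> X" for v
      using reg that n by (force simp: regular_gradient_def)
    then have "{v\<in>X. \<bar>f v\<bar> \<le> \<rho>} = S (sqrt \<rho> * 2 ^ n)" by (auto simp: S_def)
    then have "sum m (Q \<inter> {v\<in>X. \<bar>f v\<bar> \<le> \<rho>}) \<le> (K4 + K5 * (sqrt \<rho> * 2 ^ n) powr \<kappa>) * \<rho> powr s"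
      using step[OF ln] by simp
    also have "\<dots> \<le> K * \<rho> powr s"
    proof (intro mult_right_mono)
      have "(sqrt \<rho> * 2 ^ n) powr \<kappa> \<le> (2 * R0 + 1) powr \<kappa>" using up sq \<kappa> by (intro powr_mono2) auto
      then have "K5 * (sqrt \<rho> * 2 ^ n) powr \<kappa> \<le> K5 * (2 * R0 + 1) powr \<kappa>" using K5 by (rule mult_left_mono)
      then show "K4 + K5 * (sqrt \<rho> * 2 ^ n) powr \<kappa> \<le> K" by (simp add: K_def)
    qed simp
    finally show ?thesis .
  qed
  then show ?thesis using K by blast
qed

text \<open>The quantitative trichotomy value, gradient, Hessian. One alternative holds on all of
  \<open>X\<close> with one constant; the Hessian appears through the expansion of
  \<open>g\<close>.\<close>

definition transversal :: "real \<Rightarrow> 'a::metric_space set \<Rightarrow> ('a \<Rightarrow> real) \<Rightarrow> ('a \<Rightarrow> 'b::real_normed_vector) \<Rightarrow> bool" where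
  "transversal a X f g \<longleftrightarrow> (\<forall>v\<in>X. a \<le> \<bar>f v\<bar>) \<or> (\<forall>v\<in>X. a \<le> norm (g v)) \<or>
     (\<forall>v\<in>X. \<forall>v'\<in>X. a * dist v v' \<le> dist (g v) (g v'))"

text \<open>The constant precedes \<open>f\<close> in the quantifiers and so serves all unit vectors
  at once. If |f| >= a, the sublevel set is empty for small \<rho>; if |g| >= a, the whole of
  \<open>X\<close> is a single shell with \<open>R = a\<close>. For \<rho> above a, respectively
  a^2, the total weight is already bounded by a constant times \<rho>^s.\<close>

lemma sublevel_weight:
  fixes L :: "'a::euclidean_space set"
  assumes L: "subspace L" "X \<subseteq> L" "2 \<le> dim L" and M: "M > 0" and a: "a > 0" "a \<le> R0" and C: "C \<ge> 0"
    and s: "0 < s" "s < 1" and t: "t = real (dim L - 1) + s"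
    and D: "\<And>x y. x \<in> X \<Longrightarrow> y \<in> X \<Longrightarrow> dist x y \<le> D" "0 \<le> D"
  shows "\<exists>K>0. \<forall>f g Q m \<delta> \<rho>. regular_gradient L M R0 X f g \<longrightarrow> transversal a X f g \<longrightarrow>
    spread_weights C t \<delta> Q m \<longrightarrow> \<delta> \<le> \<rho> \<longrightarrow> 0 < \<rho> \<longrightarrow> \<rho> \<le> 1 \<longrightarrow>
    sum m (Q \<inter> {v\<in>X. \<bar>f v\<bar> \<le> \<rho>}) \<le> K * \<rho> powr s"
proof -
  have R0: "R0 > 0" using a by simp
  obtain K3 where K3: "K3 > 0"
    "\<And>f g Q m \<delta> \<rho>. regular_gradient L M R0 X f g \<Longrightarrow> (\<forall>v\<in>X. \<forall>v'\<in>X. a * dist v v' \<le> dist (g v) (g v')) \<Longrightarrow>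
    spread_weights C t \<delta> Q m \<Longrightarrow> \<delta> \<le> \<rho> \<Longrightarrow> 0 < \<rho> \<Longrightarrow> \<rho> \<le> 1 \<Longrightarrow>
    sum m (Q \<inter> {v\<in>X. \<bar>f v\<bar> \<le> \<rho>}) \<le> K3 * \<rho> powr s"
    using sublevel_weight_immersed[OF L M a(1) R0 C s t] by blast
  define T where "T = C * (D + 1) powr t"
  have T: "T \<ge> 0" using C by (simp add: T_def)
  define K2 where "K2 = (16 * real (dim L) * (D / a) * M + 3) ^ dim L *
    ((real (dim L - 1) / (4 * M) + 3) ^ (dim L - 1) * (C * (4 + R0) powr t)) * a powr (real (dim L - 1) - s)"
  have K2: "K2 \<ge> 0" using M C a D by (simp add: K2_def)
  define K where "K = K3 + K2 + T / a powr s + T / (a\<^sup>2) powr s"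
  have K: "K > 0" "K3 \<le> K" "K2 \<le> K" "T / a powr s \<le> K" "T / (a\<^sup>2) powr s \<le> K"
    using K3(1) K2 T by (auto simp: K_def intro!: add_pos_nonneg add_nonneg_nonneg)
  have "sum m (Q \<inter> {v\<in>X. \<bar>f v\<bar> \<le> \<rho>}) \<le> K * \<rho> powr s"
    if reg: "regular_gradient L M R0 X f g" and tr: "transversal a X f g"
      and m: "spread_weights C t \<delta> Q m" and \<rho>: "\<delta> \<le> \<rho>" "0 < \<rho>" "\<rho> \<le> 1" for f g Q m \<delta> \<rho>
  proof -
    have Q: "finite Q" "\<And>p. 0 \<le> m p" using m by (auto simp: spread_weights_def)
    have up: "b * \<rho> powr s \<le> K * \<rho> powr s" if "b \<le> K" for b using that by (intro mult_right_mono) auto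
    have "sum m (Q \<inter> X) \<le> T"
    proof -
      have "\<forall>x\<in>X. \<forall>y\<in>X. dist x y \<le> D + 1" using D(1) by (meson add_increasing2 zero_le_one)
      moreover have "\<delta> \<le> D + 1" using \<rho> D(2) by linarith
      ultimately show ?thesis using m unfolding spread_weights_def T_def by blast
    qed
    moreover have "sum m (Q \<inter> {v\<in>X. \<bar>f v\<bar> \<le> \<rho>}) \<le> sum m (Q \<inter> X)" using Q by (intro sum_mono2) auto
    ultimately have tot: "sum m (Q \<inter> {v\<in>X. \<bar>f v\<bar> \<le> \<rho>}) \<le> T" by linarith
    have big: "sum m (Q \<inter> {v\<in>X. \<bar>f v\<bar> \<le> \<rho>}) \<le> T / b powr s * \<rho> powr s" if "b \<le> \<rho>" "0 < b" for b
    proof -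
      have "b powr s \<le> \<rho> powr s" using that s by (intro powr_mono2) auto
      then have "T * b powr s \<le> T * \<rho> powr s" using T by (rule mult_left_mono)
      then have "T \<le> T / b powr s * \<rho> powr s" using that by (simp add: field_simps)
      then show ?thesis using tot by linarith
    qed
    consider (A) "\<forall>v\<in>X. a \<le> \<bar>f v\<bar>" | (B) "\<forall>v\<in>X. a \<le> norm (g v)"
      | (C) "\<forall>v\<in>X. \<forall>v'\<in>X. a * dist v v' \<le> dist (g v) (g v')" using tr unfolding transversal_def by blast
    then show ?thesis
    proof cases
      case A
      show ?thesis
      proof (cases "a \<le> \<rho>")
        case True
        then show ?thesis using big[of a] a(1) up[OF K(4)] by linarith
      next
        case False
        then have "Q \<inter> {v\<in>X. \<bar>f v\<bar> \<le> \<rho>} = {}" using A by force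
        then have "sum m (Q \<inter> {v\<in>X. \<bar>f v\<bar> \<le> \<rho>}) = 0" by (simp only: sum.empty)
        then show ?thesis using K(1) by simp
      qed
    next
      case B
      show ?thesis
      proof (cases "a\<^sup>2 \<le> \<rho>")
        case True
        then show ?thesis using big[of "a\<^sup>2"] a(1) up[OF K(5)] by (smt (verit) zero_less_power)
      next
        case False
        then have "\<rho> \<le> a\<^sup>2" by simp
        have "sum m (Q \<inter> {v\<in>X. \<bar>f v\<bar> \<le> \<rho>}) \<le> (16 * real (dim L) * (D / a) * M + 3) ^ dim L *
          ((real (dim L - 1) / (4 * M) + 3) ^ (dim L - 1) * (C * (4 + R0) powr t)) * \<rho> powr s * a powr (real (dim L - 1) - s)"
        proof (rule sublevel_weight_shell[OF L(1,2) reg m M a \<open>\<rho> \<le> a\<^sup>2\<close> subset_refl _ _ \<rho>(2,1) C _ t s(1)])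
          show "dist v v' \<le> D / a * a" if "v \<in> X" "v' \<in> X" for v v' using D(1)[OF that] a by simp
        qed (use B a D in auto)
        also have "\<dots> = K2 * \<rho> powr s" by (simp add: K2_def)
        finally show ?thesis using up[OF K(3)] by linarith
      qed
    next
      case C
      then show ?thesis using K3(2)[OF reg C m \<rho>] up[OF K(2)] by linarith
    qed
  qed
  then show ?thesis using K(1) by blast
qed

section \<open>Charts of nondegenerate manifolds\<close>

text \<open>The mean value inequality for \<open>f - A\<close>. With \<open>A = 0\<close> it yields
  Lipschitz bounds, with the derivative at one endpoint the Taylor remainder, and with a fixed
  second derivative the linearisation of the first one.\<close>

lemma blinfun_linearization:
  fixes f :: "'a::euclidean_space \<Rightarrow> 'b::real_normed_vector" and F :: "'a \<Rightarrow> 'a \<Rightarrow>\<^sub>L 'b"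
  assumes S: "convex S" "\<And>x. x \<in> S \<Longrightarrow> (f has_derivative blinfun_apply (F x)) (at x)"
    "\<And>x. x \<in> S \<Longrightarrow> norm (F x - A) \<le> B" and ab: "a \<in> S" "b \<in> S"
  shows "norm (f b - f a - A (b - a)) \<le> B * norm (b - a)"
proof -
  define h where "h x = f x - A x" for x
  have der: "(h has_derivative blinfun_apply (F x - A)) (at x within S)" if "x \<in> S" for x
  proof -
    have "blinfun_apply (F x - A) = (\<lambda>y. F x y - A y)" by (simp add: fun_eq_iff blinfun.diff_left)
    then show ?thesis unfolding h_def
      using has_derivative_diff[OF has_derivative_at_withinI[OF S(2)[OF that]]
        bounded_linear_imp_has_derivative[OF blinfun.bounded_linear_right]] by simp
  qed
  have "norm (h b - h a) \<le> B * norm (b - a)"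
    by (rule differentiable_bound[OF S(1) der _ ab(2,1)]) (use S(3) in \<open>auto simp: norm_blinfun.rep_eq\<close>)
  then show ?thesis by (simp add: h_def blinfun.bilinear_simps algebra_simps)
qed

text \<open>For orthonormal \<open>B\<close> this is the vector of \<open>span B\<close>
  representing the functional \<open>l \<mapsto> A l \<bullet> w\<close> there; with
  \<open>A\<close> the derivative of a chart, it is the gradient along \<open>span B\<close> of the
  height function in direction \<open>w\<close>.\<close>

definition partial_gradient :: "'a set \<Rightarrow> ('a::euclidean_space \<Rightarrow>\<^sub>L 'b::real_inner) \<Rightarrow> 'b \<Rightarrow> 'a" where
  "partial_gradient B A w = (\<Sum>b\<in>B. (A b \<bullet> w) *\<^sub>R b)"

lemma partial_gradient_mem: "subspace L \<Longrightarrow> B \<subseteq> L \<Longrightarrow> partial_gradient B A w \<in> L"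
  unfolding partial_gradient_def by (auto intro!: subspace_sum subspace_scale)

lemma partial_gradient_inner:
  assumes B: "finite B" "pairwise orthogonal B" "\<And>b. b \<in> B \<Longrightarrow> norm b = 1" and l: "l \<in> span B"
  shows "partial_gradient B A w \<bullet> l = A l \<bullet> w"
proof -
  have "(\<Sum>b\<in>B. (l \<bullet> b) *\<^sub>R b) = l" using orthonormal_basis_expand[OF B(2,3) l B(1)] by simp
  then have "A l \<bullet> w = A (\<Sum>b\<in>B. (l \<bullet> b) *\<^sub>R b) \<bullet> w" by simp
  also have "\<dots> = (\<Sum>b\<in>B. (l \<bullet> b) * (A b \<bullet> w))"
    by (simp add: blinfun.sum_right blinfun.scaleR_right inner_sum_left)
  also have "\<dots> = partial_gradient B A w \<bullet> l"
    by (simp add: partial_gradient_def inner_sum_left inner_commute[of l] mult.commute)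
  finally show ?thesis by simp
qed

lemma partial_gradient_diff_left: "partial_gradient B (A - A') w = partial_gradient B A w - partial_gradient B A' w"
  by (simp add: partial_gradient_def blinfun.bilinear_simps inner_simps scaleR_diff_left sum_subtractf)

lemma partial_gradient_diff_right: "partial_gradient B A (w - w') = partial_gradient B A w - partial_gradient B A w'"
  by (simp add: partial_gradient_def inner_simps scaleR_diff_left sum_subtractf)

lemma norm_partial_gradient_le:
  assumes B: "finite B" "pairwise orthogonal B" "\<And>b. b \<in> B \<Longrightarrow> norm b = 1"
  shows "norm (partial_gradient B A w) \<le> norm A * norm w"
proof -
  define l where "l = partial_gradient B A w"
  have "l \<in> span B" unfolding l_def by (intro partial_gradient_mem) (auto simp: span_superset)
  then have "l \<bullet> l = A l \<bullet> w" using partial_gradient_inner[OF B, of l A w] by (simp add: l_def)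
  also have "\<dots> \<le> norm (A l) * norm w" by (rule norm_cauchy_schwarz)
  also have "\<dots> \<le> norm A * norm l * norm w" by (intro mult_right_mono norm_blinfun) auto
  finally have "norm l * norm l \<le> norm l * (norm A * norm w)" by (simp add: dot_square_norm power2_eq_square mult_ac)
  then show ?thesis unfolding l_def[symmetric]
    by (cases "l = 0") (auto simp: mult_le_cancel_left)
qed

text \<open>Tangent vectors are velocities of curves that are merely differentiable at 0, so they
  are tested directly on the points of the curve: these deviate from the hyperplane orthogonal to
  \<open>w\<close> by o(t), while a velocity with nonzero component along \<open>w\<close> would
  move them away linearly.\<close>

lemma tangent_space_orthogonal:
  fixes \<Sigma> :: "'a::euclidean_space set"
  assumes w: "\<And>e. e > 0 \<Longrightarrow> \<exists>d>0. \<forall>y\<in>\<Sigma>. dist y x < d \<longrightarrow> \<bar>w \<bullet> (y - x)\<bar> \<le> e * norm (y - x)"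
    and \<tau>: "\<tau> \<in> tangent_space \<Sigma> x"
  shows "w \<bullet> \<tau> = 0"
proof -
  obtain \<gamma> where \<gamma>: "\<gamma> ` {-1..1} \<subseteq> \<Sigma>" "\<gamma> (0::real) = x"
    "(\<gamma> has_vector_derivative \<tau>) (at 0 within {-1..1})" using \<tau> unfolding tangent_space_def by blast
  show ?thesis
  proof (rule ccontr)
    assume "w \<bullet> \<tau> \<noteq> 0"
    \<comment> \<open>The errors at time \<open>t\<close> add up to at most
      \<open>t * (e * S)\<close>; with \<open>e\<close> at most |w . \<tau>| / (2 S) this is half of
      what it has to dominate.\<close>
    define S where "S = norm w + norm \<tau> + 1"
    have S: "S > 0" by (simp add: S_def add_nonneg_pos)
    define e where "e = min 1 (\<bar>w \<bullet> \<tau>\<bar> / (2 * S))"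
    have e: "0 < e" "e \<le> 1" using S \<open>w \<bullet> \<tau> \<noteq> 0\<close> by (auto simp: e_def)
    obtain d where d: "d > 0" "\<forall>y\<in>\<Sigma>. dist y x < d \<longrightarrow> \<bar>w \<bullet> (y - x)\<bar> \<le> e * norm (y - x)"
      using w[OF e(1)] by blast
    obtain d' where d': "d' > 0" "\<forall>t\<in>{-1..1}. norm (t - 0) < d' \<longrightarrow> norm (\<gamma> t - \<gamma> 0 - (t - 0) *\<^sub>R \<tau>) \<le> e * norm (t - 0)"
      using \<gamma>(3) e(1) unfolding has_vector_derivative_def has_derivative_within_alt by blast
    define t where "t = min 1 (min (d' / 2) (d / (2 * (norm \<tau> + 1))))"
    have "0 < norm \<tau> + 1" by (simp add: add_nonneg_pos)
    then have "0 < t" using d(1) d'(1) by (simp add: t_def)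
    moreover have "t \<le> 1" "t \<le> d' / 2" "t \<le> d / (2 * (norm \<tau> + 1))"
      unfolding t_def by (meson min.cobounded1 min.cobounded2 order_trans)+
    ultimately have t: "0 < t" "t \<le> 1" "t < d'" "t \<le> d / (2 * (norm \<tau> + 1))"
      using d'(1) by auto
    then have 1: "norm (\<gamma> t - x - t *\<^sub>R \<tau>) \<le> e * t" using d'(2)[rule_format, of t] \<gamma>(2) by simp
    have "norm (\<gamma> t - x) \<le> norm (\<gamma> t - x - t *\<^sub>R \<tau>) + norm (t *\<^sub>R \<tau>)"
      using norm_triangle_ineq[of "\<gamma> t - x - t *\<^sub>R \<tau>" "t *\<^sub>R \<tau>"] by simp
    also have "\<dots> \<le> 1 * t + t * norm \<tau>"
    proof -
      have "e * t \<le> 1 * t" using e t by (intro mult_right_mono) auto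
      moreover have "norm (t *\<^sub>R \<tau>) = t * norm \<tau>" using t by simp
      ultimately show ?thesis using 1 by linarith
    qed
    finally have 2: "norm (\<gamma> t - x) \<le> t * (norm \<tau> + 1)" by (simp add: algebra_simps)
    also have "\<dots> \<le> d / 2" using t(4) \<open>0 < norm \<tau> + 1\<close> by (simp add: field_simps)
    also have "\<dots> < d" using d(1) by simp
    finally have "dist (\<gamma> t) x < d" by (simp add: dist_norm)
    moreover have "\<gamma> t \<in> \<Sigma>" using t by (intro subsetD[OF \<gamma>(1)] imageI) auto
    ultimately have "\<bar>w \<bullet> (\<gamma> t - x)\<bar> \<le> e * norm (\<gamma> t - x)" using d(2) by blast
    also have "\<dots> \<le> e * (t * (norm \<tau> + 1))" using 2 e by (intro mult_left_mono) auto
    finally have 3: "\<bar>w \<bullet> (\<gamma> t - x)\<bar> \<le> e * (t * (norm \<tau> + 1))" .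
    have "\<bar>w \<bullet> (\<gamma> t - x - t *\<^sub>R \<tau>)\<bar> \<le> norm w * norm (\<gamma> t - x - t *\<^sub>R \<tau>)" by (rule Cauchy_Schwarz_ineq2)
    also have "\<dots> \<le> norm w * (e * t)" using 1 by (intro mult_left_mono) auto
    finally have "\<bar>w \<bullet> (\<gamma> t - x) - t * (w \<bullet> \<tau>)\<bar> \<le> norm w * (e * t)" by (simp add: inner_simps)
    then have "\<bar>t * (w \<bullet> \<tau>)\<bar> \<le> norm w * (e * t) + e * (t * (norm \<tau> + 1))" using 3 by linarith
    also have "\<dots> = t * (e * S)" by (simp add: S_def algebra_simps)
    finally have "t * \<bar>w \<bullet> \<tau>\<bar> \<le> t * (e * S)" using t by (simp add: abs_mult)
    then have "\<bar>w \<bullet> \<tau>\<bar> \<le> e * S" using t by simp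
    also have "\<dots> \<le> \<bar>w \<bullet> \<tau>\<bar> / (2 * S) * S" using S by (intro mult_right_mono) (auto simp: e_def)
    also have "\<dots> = \<bar>w \<bullet> \<tau>\<bar> / 2" using S by simp
    finally show False using \<open>w \<bullet> \<tau> \<noteq> 0\<close> by simp
  qed
qed

text \<open>The derivative is bounded below on \<open>L\<close>, so |y - \<phi> v| is at least a
  fixed multiple of the parameter distance, while \<open>w\<close> sees only the remainder of the
  linearisation. Continuity of the inverse chart brings the parameters of nearby points close to
  \<open>v\<close>.\<close>

lemma chart_orthogonal:
  fixes \<phi> :: "'a::euclidean_space \<Rightarrow> 'b::euclidean_space"
  assumes hom: "homeomorphism (V \<inter> L) (\<Sigma> \<inter> U) \<phi> \<psi>" and U: "open U" and v: "v \<in> V \<inter> L" and L: "subspace L"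
    and der: "(\<phi> has_derivative \<phi>') (at v)" and inj: "inj_on \<phi>' L" and w: "\<And>l. l \<in> L \<Longrightarrow> w \<bullet> \<phi>' l = 0" and e: "e > 0"
  shows "\<exists>d>0. \<forall>y\<in>\<Sigma>. dist y (\<phi> v) < d \<longrightarrow> \<bar>w \<bullet> (y - \<phi> v)\<bar> \<le> e * norm (y - \<phi> v)"
proof -
  have lin: "bounded_linear \<phi>'" using der has_derivative_bounded_linear by blast
  have "\<exists>c>0. \<forall>l\<in>L. norm (\<phi>' l) \<ge> c * norm l"
  proof (rule injective_imp_isometric[OF closed_subspace[OF L] L lin])
    show "\<forall>x\<in>L. \<phi>' x = 0 \<longrightarrow> x = 0"
      using inj L bounded_linear.linear[OF lin] by (metis inj_onD linear_0 subspace_0)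
  qed
  then obtain c where c: "c > 0" "\<And>l. l \<in> L \<Longrightarrow> c * norm l \<le> norm (\<phi>' l)" by auto
  \<comment> \<open>The first entry preserves half of the lower bound \<open>c\<close>; the second
    makes \<open>norm w * \<epsilon>\<close> at most \<open>e * (c / 2)\<close>.\<close>
  define \<epsilon> where "\<epsilon> = min (c / 2) (e * (c / 2) / (norm w + 1))"
  have \<epsilon>: "\<epsilon> > 0" "\<epsilon> \<le> c / 2"
    unfolding \<epsilon>_def using c(1) e by (simp add: add_nonneg_pos) (rule min.cobounded1)
  have "\<epsilon> \<le> e * (c / 2) / (norm w + 1)" unfolding \<epsilon>_def by (rule min.cobounded2)
  then have "\<epsilon> * (norm w + 1) \<le> e * (c / 2)" by (subst (asm) pos_le_divide_eq) (simp_all add: add_nonneg_pos)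
  moreover have "norm w * \<epsilon> \<le> \<epsilon> * (norm w + 1)" using \<epsilon> by (simp add: algebra_simps)
  ultimately have \<epsilon>w: "norm w * \<epsilon> \<le> e * (c / 2)" by linarith
  obtain d1 where d1: "d1 > 0" "\<And>y. norm (y - v) < d1 \<Longrightarrow> norm (\<phi> y - \<phi> v - \<phi>' (y - v)) \<le> \<epsilon> * norm (y - v)"
    using der \<epsilon>(1) unfolding has_derivative_at_alt by blast
  have xU: "\<phi> v \<in> \<Sigma> \<inter> U" "\<psi> (\<phi> v) = v" using hom v by (auto simp: homeomorphism_def)
  have "continuous_on (\<Sigma> \<inter> U) \<psi>" using hom by (simp add: homeomorphism_def)
  then obtain d2 where d2: "d2 > 0" "\<And>y. y \<in> \<Sigma> \<inter> U \<Longrightarrow> dist y (\<phi> v) < d2 \<Longrightarrow> dist (\<psi> y) v < d1"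
    using xU d1(1) unfolding continuous_on_iff by metis
  obtain d3 where d3: "d3 > 0" "ball (\<phi> v) d3 \<subseteq> U" using U xU open_contains_ball by blast
  show ?thesis
  proof (intro exI[of _ "min d2 d3"] conjI ballI impI)
    show "0 < min d2 d3" using d2 d3 by simp
    fix y assume y: "y \<in> \<Sigma>" "dist y (\<phi> v) < min d2 d3"
    then have yU: "y \<in> \<Sigma> \<inter> U" using d3 by (auto simp: dist_commute subset_iff)
    define u where "u = \<psi> y"
    have u: "u \<in> V \<inter> L" "\<phi> u = y" using hom yU by (auto simp: homeomorphism_def u_def)
    have uv: "u - v \<in> L" using u v L by (simp add: subspace_diff)
    have "norm (u - v) < d1" using d2(2)[OF yU] y(2) by (simp add: u_def dist_norm)
    then have 1: "norm (y - \<phi> v - \<phi>' (u - v)) \<le> \<epsilon> * norm (u - v)" using d1(2)[of u] u by simp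
    have "c * norm (u - v) \<le> norm (\<phi>' (u - v))" using c(2) uv by blast
    also have "\<dots> \<le> norm (y - \<phi> v) + norm (y - \<phi> v - \<phi>' (u - v))"
      using norm_triangle_ineq4[of "y - \<phi> v" "y - \<phi> v - \<phi>' (u - v)"] by simp
    also have "\<dots> \<le> norm (y - \<phi> v) + c / 2 * norm (u - v)"
      using 1 mult_right_mono[OF \<epsilon>(2), of "norm (u - v)"] by simp
    finally have 2: "c / 2 * norm (u - v) \<le> norm (y - \<phi> v)" by simp
    have "w \<bullet> (y - \<phi> v) = w \<bullet> (y - \<phi> v - \<phi>' (u - v))" using w[OF uv] by (simp add: inner_diff_right)
    then have "\<bar>w \<bullet> (y - \<phi> v)\<bar> \<le> norm w * norm (y - \<phi> v - \<phi>' (u - v))" using Cauchy_Schwarz_ineq2 by metis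
    also have "\<dots> \<le> norm w * (\<epsilon> * norm (u - v))" using 1 by (intro mult_left_mono) auto
    also have "\<dots> \<le> e * (c / 2) * norm (u - v)" using mult_right_mono[OF \<epsilon>w, of "norm (u - v)"] by (simp add: mult.assoc)
    also have "\<dots> \<le> e * norm (y - \<phi> v)" using mult_left_mono[OF 2, of e] e by (simp add: mult.assoc)
    finally show "\<bar>w \<bullet> (y - \<phi> v)\<bar> \<le> e * norm (y - \<phi> v)" .
  qed
qed

text \<open>The test curve is the image of a straight segment through \<open>v\<close> in direction
  \<open>l\<close>. Its acceleration at 0 is a positive multiple of \<open>\<phi>2 v l l\<close>,
  and its velocity never vanishes because the derivative is injective on \<open>L\<close>.\<close>

lemma second_derivative_nonzero:
  fixes \<phi> :: "'a::euclidean_space \<Rightarrow> 'b::euclidean_space"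
  assumes V: "open V" and v: "v \<in> V \<inter> L" and L: "subspace L"
    and d1: "\<And>u. u \<in> V \<Longrightarrow> (\<phi> has_derivative blinfun_apply (\<phi>1 u)) (at u)"
    and d2: "\<And>u. u \<in> V \<Longrightarrow> (\<phi>1 has_derivative blinfun_apply (\<phi>2 u)) (at u)"
    and c: "continuous_on V \<phi>2" and inj: "\<And>u. u \<in> V \<inter> L \<Longrightarrow> inj_on (\<phi>1 u) L"
    and \<Sigma>: "\<phi> ` (V \<inter> L) \<subseteq> \<Sigma>"
    and curves: "\<And>\<gamma> d e. C2_curve \<gamma> d e \<Longrightarrow> \<gamma> ` {-1..1} \<subseteq> \<Sigma> \<Longrightarrow> \<gamma> 0 = \<phi> v \<Longrightarrow> (\<forall>t\<in>{-1..1}. d t \<noteq> 0) \<Longrightarrow> e 0 \<bullet> \<nu> \<noteq> 0"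
    and l: "l \<in> L" "l \<noteq> 0"
  shows "\<phi>2 v l l \<bullet> \<nu> \<noteq> 0"
proof -
  obtain r where r: "r > 0" "cball v r \<subseteq> V" using V v open_contains_cball by blast
  \<comment> \<open>Rescales time so that the segment stays within distance \<open>r\<close> of
    \<open>v\<close> for all of [-1, 1], the domain on which curves are required.\<close>
  define \<epsilon> where "\<epsilon> = r / norm l"
  have \<epsilon>: "\<epsilon> > 0" using r l by (simp add: \<epsilon>_def)
  define p where "p t = v + (t * \<epsilon>) *\<^sub>R l" for t
  have pV: "p t \<in> V \<inter> L" if "t \<in> {-1..1}" for t
  proof -
    have "\<bar>t\<bar> * r \<le> r" using that r by (intro mult_left_le_one_le) auto
    then have "dist v (p t) \<le> r" using l r by (simp add: p_def dist_norm \<epsilon>_def abs_mult)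
    then show ?thesis using r v l L by (auto simp: p_def subset_iff subspace_add subspace_scale)
  qed
  have p': "(p has_derivative (\<lambda>h. (h * \<epsilon>) *\<^sub>R l)) (at t within {-1..1})" for t
    unfolding p_def by (auto intro!: derivative_eq_intros)
  have pc: "continuous_on {-1..1} p" unfolding p_def by (intro continuous_intros)
  define d where "d t = \<epsilon> *\<^sub>R \<phi>1 (p t) l" for t
  define e where "e t = \<epsilon>\<^sup>2 *\<^sub>R \<phi>2 (p t) l l" for t
  have "((\<lambda>t. \<phi> (p t)) has_vector_derivative d t) (at t within {-1..1})" if "t \<in> {-1..1}" for t
  proof -
    have "p t \<in> V" using pV[OF that] by blast
    from has_derivative_compose[OF p' d1[OF this]] show ?thesis
      by (simp add: has_vector_derivative_def d_def blinfun.scaleR_right mult.commute)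
  qed
  moreover have "(d has_vector_derivative e t) (at t within {-1..1})" if "t \<in> {-1..1}" for t
  proof -
    have "p t \<in> V" using pV[OF that] by blast
    from has_derivative_compose[OF p' d2[OF this]]
    have "((\<lambda>t. \<phi>1 (p t)) has_derivative (\<lambda>h. \<phi>2 (p t) ((h * \<epsilon>) *\<^sub>R l))) (at t within {-1..1})" .
    from bounded_linear.has_derivative[OF blinfun.bounded_linear_left[of l] this]
    have "((\<lambda>t. \<phi>1 (p t) l) has_derivative (\<lambda>h. \<phi>2 (p t) ((h * \<epsilon>) *\<^sub>R l) l)) (at t within {-1..1})" .
    from has_derivative_scaleR_right[OF this, of \<epsilon>] show ?thesis
      by (simp add: has_vector_derivative_def d_def[abs_def] e_def blinfun.scaleR_right blinfun.scaleR_left power2_eq_square mult_ac)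
  qed
  moreover have "continuous_on {-1..1} e"
  proof -
    have "continuous_on {-1..1} (\<lambda>t. \<phi>2 (p t))" using pV by (intro continuous_on_compose2[OF c pc]) auto
    then show ?thesis unfolding e_def by (intro continuous_intros)
  qed
  ultimately have "C2_curve (\<lambda>t. \<phi> (p t)) d e" by (auto simp: C2_curve_def)
  moreover have "(\<lambda>t. \<phi> (p t)) ` {-1..1} \<subseteq> \<Sigma>" using pV \<Sigma> by blast
  moreover have "\<phi> (p 0) = \<phi> v" by (simp add: p_def)
  moreover have "\<forall>t\<in>{-1..1}. d t \<noteq> 0"
  proof
    fix t :: real assume "t \<in> {-1..1}"
    from inj[OF pV[OF this]] have "\<phi>1 (p t) l \<noteq> \<phi>1 (p t) 0" using l L by (metis inj_onD subspace_0)
    then show "d t \<noteq> 0" using \<epsilon> by (simp add: d_def blinfun.zero_right)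
  qed
  ultimately have "e 0 \<bullet> \<nu> \<noteq> 0" by (rule curves)
  then show ?thesis using \<epsilon> by (simp add: e_def p_def)
qed

text \<open>The infinitesimal form of \<open>transversal\<close> at one point: \<open>x\<close> is
  the point, \<open>G w\<close> the gradient in direction \<open>w\<close>, and \<open>A2\<close>
  the second derivative of the chart.\<close>

definition curved :: "real \<Rightarrow> 'a set \<Rightarrow> ('b \<Rightarrow> 'a) \<Rightarrow> ('a::euclidean_space \<Rightarrow>\<^sub>L 'a \<Rightarrow>\<^sub>L 'b) \<Rightarrow> 'b \<Rightarrow> 'b::euclidean_space \<Rightarrow> bool" where
  "curved a L G A2 x w \<longleftrightarrow> a \<le> \<bar>x \<bullet> w\<bar> \<or> a \<le> norm (G w) \<or> (\<forall>l\<in>L. a * (norm l)\<^sup>2 \<le> \<bar>A2 l l \<bullet> w\<bar>)"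

text \<open>If the first two alternatives fail, the third gets its constant from the compact unit
  sphere of \<open>L\<close> and extends by quadratic homogeneity.\<close>

lemma curved_pointwise:
  fixes L :: "'a::euclidean_space set" and A2 :: "'a \<Rightarrow>\<^sub>L 'a \<Rightarrow>\<^sub>L 'b::euclidean_space"
  assumes L: "subspace L"
    and q: "x \<bullet> w = 0 \<Longrightarrow> G w = 0 \<Longrightarrow> \<forall>l\<in>L. l \<noteq> 0 \<longrightarrow> A2 l l \<bullet> w \<noteq> 0"
  shows "\<exists>a>0. curved a L G A2 x w"
proof (cases "x \<bullet> w = 0 \<and> G w = 0")
  case False
  then consider "x \<bullet> w \<noteq> 0" | "G w \<noteq> 0" by blast
  then show ?thesis
  proof cases
    case 1
    then show ?thesis by (intro exI[of _ "\<bar>x \<bullet> w\<bar>"]) (simp add: curved_def)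
  next
    case 2
    then show ?thesis by (intro exI[of _ "norm (G w)"]) (simp add: curved_def)
  qed
next
  case True
  define S where "S = L \<inter> sphere 0 1"
  have S: "compact S" unfolding S_def using closed_subspace[OF L] by (simp add: closed_Int_compact)
  define h where "h l = \<bar>A2 l l \<bullet> w\<bar>" for l
  have h: "continuous_on S h" unfolding h_def by (intro continuous_intros)
  have "\<exists>a>0. \<forall>l\<in>S. a \<le> h l"
  proof (cases "S = {}")
    case True
    then show ?thesis by (intro exI[of _ 1]) simp
  next
    case False
    obtain l0 where l0: "l0 \<in> S" "\<forall>l\<in>S. h l0 \<le> h l" using continuous_attains_inf[OF S False h] by blast
    then have "l0 \<in> L" "l0 \<noteq> 0" by (auto simp: S_def)
    then have "h l0 > 0" using q True by (simp add: h_def)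
    then show ?thesis using l0 by blast
  qed
  then obtain a where a: "a > 0" "\<forall>l\<in>S. a \<le> h l" by blast
  have "a * (norm l)\<^sup>2 \<le> \<bar>A2 l l \<bullet> w\<bar>" if l: "l \<in> L" for l
  proof (cases "l = 0")
    case False
    define u where "u = l /\<^sub>R norm l"
    have "u \<in> S" using False l L by (simp add: S_def u_def subspace_scale)
    then have "a \<le> h u" using a by blast
    then have "a * (norm l)\<^sup>2 \<le> h u * (norm l)\<^sup>2" by (intro mult_right_mono) auto
    also have "\<dots> = \<bar>(norm l *\<^sub>R norm l *\<^sub>R A2 u u) \<bullet> w\<bar>" by (simp add: h_def power2_eq_square abs_mult)
    also have "norm l *\<^sub>R norm l *\<^sub>R A2 u u = A2 (norm l *\<^sub>R u) (norm l *\<^sub>R u)"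
      by (simp add: blinfun.scaleR_left blinfun.scaleR_right)
    also have "norm l *\<^sub>R u = l" using False by (simp add: u_def)
    finally show ?thesis .
  qed simp
  then show ?thesis using a(1) unfolding curved_def by blast
qed

text \<open>Each alternative survives a small change of \<open>w\<close> with half its constant, so
  finitely many directions on the unit sphere determine a common constant.\<close>

lemma curved_uniform:
  fixes L :: "'a::euclidean_space set" and A2 :: "'a \<Rightarrow>\<^sub>L 'a \<Rightarrow>\<^sub>L 'b::euclidean_space"
  assumes G: "\<And>w w'. norm (G w - G w') \<le> N * norm (w - w')"
    and pt: "\<And>w. norm w = 1 \<Longrightarrow> \<exists>a>0. curved a L G A2 x w"
  shows "\<exists>a>0. \<forall>w. norm w = 1 \<longrightarrow> curved a L G A2 x w"
proof -
  define K where "K = norm x + \<bar>N\<bar> + norm A2 + 1"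
  have K: "K > 0" "norm x \<le> K" "N \<le> K" "norm A2 \<le> K"
    unfolding K_def using norm_ge_zero[of x] norm_ge_zero[of A2] by linarith+
  have stable: "curved (a / 2) L G A2 x w'" if c: "curved a L G A2 x w" and a: "a > 0" and w: "dist w w' < a / (2 * K)" for a w w'
  proof -
    have d: "K * norm (w - w') \<le> a / 2" using w K(1) by (simp add: dist_norm field_simps)
    consider (A) "a \<le> \<bar>x \<bullet> w\<bar>" | (B) "a \<le> norm (G w)" | (C) "\<forall>l\<in>L. a * (norm l)\<^sup>2 \<le> \<bar>A2 l l \<bullet> w\<bar>"
      using c unfolding curved_def by blast
    then show ?thesis
    proof cases
      case A
      have "\<bar>x \<bullet> w - x \<bullet> w'\<bar> \<le> norm x * norm (w - w')" using Cauchy_Schwarz_ineq2[of x "w - w'"] by (simp add: inner_diff_right)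
      also have "\<dots> \<le> K * norm (w - w')" using K by (intro mult_right_mono) auto
      finally show ?thesis using A d unfolding curved_def by linarith
    next
      case B
      have "norm (G w) \<le> norm (G w') + norm (G w - G w')" by (rule norm_triangle_sub)
      moreover have "norm (G w - G w') \<le> K * norm (w - w')" using G[of w w'] K mult_right_mono[OF K(3), of "norm (w - w')"] by simp
      ultimately show ?thesis using B d unfolding curved_def by linarith
    next
      case C
      have "a / 2 * (norm l)\<^sup>2 \<le> \<bar>A2 l l \<bullet> w'\<bar>" if l: "l \<in> L" for l
      proof -
        have "norm (A2 l l) \<le> norm (A2 l) * norm l" by (rule norm_blinfun)
        also have "\<dots> \<le> norm A2 * norm l * norm l" by (intro mult_right_mono norm_blinfun) auto
        also have "\<dots> \<le> K * norm l * norm l" using K by (intro mult_right_mono) auto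
        finally have n: "norm (A2 l l) \<le> K * (norm l)\<^sup>2" by (simp add: power2_eq_square mult.assoc)
        have "\<bar>A2 l l \<bullet> w - A2 l l \<bullet> w'\<bar> \<le> norm (A2 l l) * norm (w - w')"
          using Cauchy_Schwarz_ineq2[of "A2 l l" "w - w'"] by (simp add: inner_diff_right)
        also have "\<dots> \<le> K * (norm l)\<^sup>2 * norm (w - w')" using n by (intro mult_right_mono) auto
        also have "\<dots> = K * norm (w - w') * (norm l)\<^sup>2" by simp
        also have "\<dots> \<le> a / 2 * (norm l)\<^sup>2" using d by (intro mult_right_mono) auto
        finally show ?thesis using C[rule_format, OF l] by linarith
      qed
      then show ?thesis unfolding curved_def by blast
    qed
  qed
  have "\<forall>w. \<exists>a. norm w = 1 \<longrightarrow> a > 0 \<and> curved a L G A2 x w" using pt by blast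
  then obtain A where A: "\<And>w. norm w = 1 \<Longrightarrow> A w > 0 \<and> curved (A w) L G A2 x w" by metis
  have sub: "sphere 0 1 \<subseteq> (\<Union>w\<in>sphere (0::'b) 1. ball w (A w / (2 * K)))"
    using A K(1) by force
  have "\<exists>T\<subseteq>sphere (0::'b) 1. finite T \<and> sphere 0 1 \<subseteq> (\<Union>w\<in>T. ball w (A w / (2 * K)))"
    by (rule compactE_image[OF compact_sphere _ sub]) blast+
  then obtain T where T: "T \<subseteq> sphere (0::'b) 1" "finite T" "sphere 0 1 \<subseteq> (\<Union>w\<in>T. ball w (A w / (2 * K)))" by blast
  define a where "a = Min (insert 1 ((\<lambda>w. A w / 2) ` T))"
  have a: "a > 0" using T A by (auto simp: a_def)
  have "curved a L G A2 x w'" if w': "norm w' = 1" for w'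
  proof -
    have "w' \<in> sphere 0 1" using w' by simp
    then obtain w where w: "w \<in> T" "dist w w' < A w / (2 * K)" using T(3) by auto
    then have nw: "norm w = 1" using T(1) by auto
    have "curved (A w / 2) L G A2 x w'" using stable[OF _ _ w(2)] A[OF nw] by blast
    moreover have "a \<le> A w / 2" unfolding a_def using w(1) T(2) by (intro Min_le) auto
    ultimately show ?thesis unfolding curved_def
      by (meson mult_right_mono order_trans zero_le_power2)
  qed
  then show ?thesis using a by blast
qed

text \<open>Here \<open>w\<close> is orthogonal to the point and to every tangent vector. Removing
  its component along \<open>\<nu>\<close> leaves a vector orthogonal to a spanning set, hence zero,
  so the second derivative in direction \<open>w\<close> is a nonzero multiple of the one along
  \<open>\<nu>\<close>.\<close>

lemma curved_at_nondegenerate_point: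
  fixes \<Sigma> :: "'a::euclidean_space set" and \<phi> :: "'b::euclidean_space \<Rightarrow> 'a"
  assumes V: "open V" and U: "open U" and v: "v \<in> V \<inter> L" and L: "subspace L"
    and hom: "homeomorphism (V \<inter> L) (\<Sigma> \<inter> U) \<phi> \<psi>"
    and d1: "\<And>u. u \<in> V \<Longrightarrow> (\<phi> has_derivative blinfun_apply (\<phi>1 u)) (at u)"
    and d2: "\<And>u. u \<in> V \<Longrightarrow> (\<phi>1 has_derivative blinfun_apply (\<phi>2 u)) (at u)"
    and c: "continuous_on V \<phi>2" and inj: "\<And>u. u \<in> V \<inter> L \<Longrightarrow> inj_on (\<phi>1 u) L"
    and nd: "nondegenerate \<Sigma>" and w: "norm w = 1" "\<phi> v \<bullet> w = 0" "\<And>l. l \<in> L \<Longrightarrow> \<phi>1 v l \<bullet> w = 0"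
    and l: "l \<in> L" "l \<noteq> 0"
  shows "\<phi>2 v l l \<bullet> w \<noteq> 0"
proof -
  have vV: "v \<in> V" using v by simp
  have im: "\<phi> ` (V \<inter> L) = \<Sigma> \<inter> U" using hom by (simp add: homeomorphism_def)
  then have x: "\<phi> v \<in> \<Sigma>" using v by blast
  obtain \<nu> where nu: "\<forall>x\<in>\<Sigma>. \<nu> x \<bullet> x = 0 \<and> (\<forall>v\<in>tangent_space \<Sigma> x. \<nu> x \<bullet> v = 0) \<and>
                 span (insert x (insert (\<nu> x) (tangent_space \<Sigma> x))) = UNIV"
    "\<forall>x\<in>\<Sigma>. \<forall>\<gamma>1 \<gamma>2 d1 d2 e1 e2.
            C2_curve \<gamma>1 d1 e1 \<and> C2_curve \<gamma>2 d2 e2 \<and>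
            \<gamma>1 ` {-1..1} \<subseteq> \<Sigma> \<and> \<gamma>2 ` {-1..1} \<subseteq> \<Sigma> \<and>
            \<gamma>1 0 = x \<and> \<gamma>2 0 = x \<and>
            (\<forall>t\<in>{-1..1}. d1 t \<noteq> 0 \<and> d2 t \<noteq> 0) \<longrightarrow>
            (e1 0 \<bullet> \<nu> x) * (e2 0 \<bullet> \<nu> x) > 0"
    using nd unfolding nondegenerate_def by (elim exE conjE) (rule that)
  define n where "n = \<nu> (\<phi> v)"
  define T where "T = tangent_space \<Sigma> (\<phi> v)"
  have n: "n \<bullet> \<phi> v = 0" "\<And>\<tau>. \<tau> \<in> T \<Longrightarrow> n \<bullet> \<tau> = 0" "span (insert (\<phi> v) (insert n T)) = UNIV"
    using nu(1) x unfolding n_def T_def by blast+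
  \<comment> \<open>Condition (ii) with the same curve taken twice: a positive square means a
    nonzero normal acceleration.\<close>
  have curves: "e 0 \<bullet> n \<noteq> 0" if "C2_curve \<gamma> d e" "\<gamma> ` {-1..1} \<subseteq> \<Sigma>" "\<gamma> 0 = \<phi> v" "\<forall>t\<in>{-1..1}. d t \<noteq> 0" for \<gamma> d e
  proof -
    have "(e 0 \<bullet> n) * (e 0 \<bullet> n) > 0" unfolding n_def using nu(2) x that by blast
    then show ?thesis by auto
  qed
  have "\<phi>2 v l l \<bullet> n \<noteq> 0"
  proof (rule second_derivative_nonzero[OF V v L d1 d2 c inj, where \<Sigma> = \<Sigma>])
    show "\<phi> ` (V \<inter> L) \<subseteq> \<Sigma>" using im by blast
  qed (use curves l in auto)
  moreover have "\<exists>c. w = c *\<^sub>R n"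
  proof -
    have wT: "w \<bullet> \<tau> = 0" if "\<tau> \<in> T" for \<tau>
    proof (rule tangent_space_orthogonal[OF _ that[unfolded T_def]])
      fix e :: real assume e: "e > 0"
      have wl: "w \<bullet> \<phi>1 v l = 0" if "l \<in> L" for l using w(3)[OF that] by (simp add: inner_commute)
      show "\<exists>d>0. \<forall>y\<in>\<Sigma>. dist y (\<phi> v) < d \<longrightarrow> \<bar>w \<bullet> (y - \<phi> v)\<bar> \<le> e * norm (y - \<phi> v)"
        by (rule chart_orthogonal[OF hom U v L d1[OF vV] inj[OF v] wl e])
    qed
    define c where "c = (w \<bullet> n) / (n \<bullet> n)"
    define u where "u = w - c *\<^sub>R n"
    have "u \<bullet> n = 0" by (cases "n = 0") (simp_all add: u_def c_def inner_diff_left)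
    moreover have "u \<bullet> \<phi> v = 0" using w(2) n(1) by (simp add: u_def inner_diff_left inner_commute[of w])
    moreover have "u \<bullet> \<tau> = 0" if "\<tau> \<in> T" for \<tau> using wT n(2) that by (simp add: u_def inner_diff_left)
    ultimately have "\<And>y. y \<in> insert (\<phi> v) (insert n T) \<Longrightarrow> orthogonal u y" by (auto simp: orthogonal_def)
    then have "orthogonal u u" using orthogonal_to_span[of u "insert (\<phi> v) (insert n T)" u] n(3) by blast
    then have "w = c *\<^sub>R n" by (simp add: orthogonal_self u_def)
    then show ?thesis by blast
  qed
  ultimately show ?thesis using w(1) by auto
qed

text \<open>The constant \<open>b\<close> belongs to the base point \<open>v0\<close> alone. On a
  ball where the chart and its first two derivatives vary by at most \<open>b / 2\<close>, the
  alternative valid at \<open>v0\<close> persists with \<open>b / 2\<close>, for every unit vector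
  \<open>w\<close> simultaneously.\<close>

lemma local_chart:
  fixes \<Sigma> :: "'a::euclidean_space set"
  assumes M: "C2_submanifold k \<Sigma>" and nd: "nondegenerate \<Sigma>" and x: "x0 \<in> \<Sigma>"
  shows "\<exists>U L X (\<phi> :: 'a \<Rightarrow> 'a) M R0 a \<Lambda> D. open U \<and> x0 \<in> U \<and> subspace L \<and> dim L = k \<and> X \<subseteq> L \<and> inj_on \<phi> X \<and>
    \<Sigma> \<inter> U \<subseteq> \<phi> ` X \<and> (\<forall>v\<in>X. \<forall>v'\<in>X. dist (\<phi> v) (\<phi> v') \<le> \<Lambda> * dist v v' \<and> dist v v' \<le> D) \<and>
    0 \<le> D \<and> 0 < M \<and> 0 < a \<and> a \<le> R0 \<and> 0 \<le> \<Lambda> \<and>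
    (\<forall>w. norm w = 1 \<longrightarrow> (\<exists>g. regular_gradient L M R0 X (\<lambda>v. \<phi> v \<bullet> w) g \<and> transversal a X (\<lambda>v. \<phi> v \<bullet> w) g))"
proof -
  from bspec[OF M[unfolded C2_submanifold_def] x]
  obtain U V L and \<phi> \<psi> :: "'a \<Rightarrow> 'a" and \<phi>' where ch: "open U \<and> x0 \<in> U \<and> open V \<and> subspace L \<and> dim L = k \<and>
        C2_on \<phi> V \<and> homeomorphism (V \<inter> L) (\<Sigma> \<inter> U) \<phi> \<psi> \<and>
        (\<forall>v\<in>V. (\<phi> has_derivative \<phi>' v) (at v)) \<and> (\<forall>v\<in>V \<inter> L. inj_on (\<phi>' v) L)"
    by (elim exE) (rule that)
  then have U: "open U" "x0 \<in> U" and V: "open V" and L: "subspace L" "dim L = k" and C2: "C2_on \<phi> V"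
    and hom: "homeomorphism (V \<inter> L) (\<Sigma> \<inter> U) \<phi> \<psi>" by blast+
  obtain \<phi>1 :: "'a \<Rightarrow> 'a \<Rightarrow>\<^sub>L 'a" and \<phi>2 :: "'a \<Rightarrow> 'a \<Rightarrow>\<^sub>L ('a \<Rightarrow>\<^sub>L 'a)" where
    d1: "\<And>u. u \<in> V \<Longrightarrow> (\<phi> has_derivative blinfun_apply (\<phi>1 u)) (at u)"
    and d2: "\<And>u. u \<in> V \<Longrightarrow> (\<phi>1 has_derivative blinfun_apply (\<phi>2 u)) (at u)"
    and c2: "continuous_on V \<phi>2" using C2 unfolding C2_on_def by metis
  have inj: "inj_on (\<phi>1 u) L" if "u \<in> V \<inter> L" for u
  proof -
    have "\<phi>' u = \<phi>1 u" using ch d1[of u] that has_derivative_unique by blast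
    then show ?thesis using ch that by metis
  qed
  define v0 where "v0 = \<psi> x0"
  have v0: "v0 \<in> V \<inter> L" "\<phi> v0 = x0" using hom x U(2) by (auto simp: homeomorphism_def v0_def)
  then have v0V: "v0 \<in> V" by simp
  obtain B where B: "B \<subseteq> L" "pairwise orthogonal B" "\<And>b. b \<in> B \<Longrightarrow> norm b = 1" "independent B" "span B = L"
    using orthonormal_basis_subspace[OF L(1)] by metis
  have finB: "finite B" using B(4) independent_imp_finite by blast
  note on = finB B(2,3)
  define G where "G v w = partial_gradient B (\<phi>1 v) w" for v w
  have GL: "G v w \<in> L" for v w unfolding G_def by (rule partial_gradient_mem[OF L(1) B(1)])
  have Gl: "G v w \<bullet> l = \<phi>1 v l \<bullet> w" if "l \<in> L" for v w l
    unfolding G_def using partial_gradient_inner[OF on] that B(5) by blast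
  have G_le: "norm (G v w) \<le> norm (\<phi>1 v)" if "norm w = 1" for v w
    using norm_partial_gradient_le[OF on, of "\<phi>1 v" w] that by (simp add: G_def)
  have G_diff: "norm (G v w - G v' w) \<le> norm (\<phi>1 v - \<phi>1 v')" if "norm w = 1" for v v' w
    using norm_partial_gradient_le[OF on, of "\<phi>1 v - \<phi>1 v'" w] that by (simp add: G_def partial_gradient_diff_left)
  have "\<exists>a>0. \<forall>w. norm w = 1 \<longrightarrow> curved a L (G v0) (\<phi>2 v0) (\<phi> v0) w"
  proof (rule curved_uniform)
    show "norm (G v0 w - G v0 w') \<le> norm (\<phi>1 v0) * norm (w - w')" for w w'
      using norm_partial_gradient_le[OF on, of "\<phi>1 v0" "w - w'"] by (simp add: G_def partial_gradient_diff_right)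
    show "\<exists>a>0. curved a L (G v0) (\<phi>2 v0) (\<phi> v0) w" if w: "norm w = 1" for w
    proof (rule curved_pointwise[OF L(1)])
      assume 0: "\<phi> v0 \<bullet> w = 0" "G v0 w = 0"
      have "\<phi>1 v0 l \<bullet> w = 0" if "l \<in> L" for l using Gl[OF that, of v0 w] 0(2) by simp
      from curved_at_nondegenerate_point[OF V U(1) v0(1) L(1) hom d1 d2 c2 inj nd w 0(1) this]
      show "\<forall>l\<in>L. l \<noteq> 0 \<longrightarrow> \<phi>2 v0 l l \<bullet> w \<noteq> 0" by blast
    qed
  qed
  then obtain b where b: "b > 0" "\<And>w. norm w = 1 \<Longrightarrow> curved b L (G v0) (\<phi>2 v0) (\<phi> v0) w" by blast
  define a where "a = b / 2"
  have a: "a > 0" "b = 2 * a" using b by (simp_all add: a_def)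
  have cont: "\<exists>r>0. \<forall>u. dist u v0 < r \<longrightarrow> dist (h u) (h v0) < a" if "isCont h v0" for h :: "'a \<Rightarrow> 'c::metric_space"
    using that a(1) unfolding continuous_at_eps_delta by blast
  obtain r0 where r0: "r0 > 0" "\<forall>u. dist u v0 < r0 \<longrightarrow> dist (\<phi> u) (\<phi> v0) < a"
    using cont[of \<phi>] d1[OF v0V] has_derivative_continuous by blast
  obtain r1 where r1: "r1 > 0" "\<forall>u. dist u v0 < r1 \<longrightarrow> dist (\<phi>1 u) (\<phi>1 v0) < a"
    using cont[of \<phi>1] d2[OF v0V] has_derivative_continuous by blast
  have "isCont \<phi>2 v0" using c2 V v0V by (simp add: continuous_on_eq_continuous_at)
  then obtain r2 where r2: "r2 > 0" "\<forall>u. dist u v0 < r2 \<longrightarrow> dist (\<phi>2 u) (\<phi>2 v0) < a"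
    using cont[of \<phi>2] by blast
  obtain r3 where r3: "r3 > 0" "ball v0 r3 \<subseteq> V" using V v0V open_contains_ball by blast
  define r where "r = min (min r0 r1) (min r2 r3)"
  have r: "r > 0" using r0 r1 r2 r3 by (simp add: r_def)
  define W where "W = ball v0 r"
  have WV: "W \<subseteq> V" using r3(2) by (auto simp: W_def r_def)
  have cW: "convex W" by (simp add: W_def)
  have v0W: "v0 \<in> W" using r by (simp add: W_def)
  have near: "norm (\<phi> u - \<phi> v0) \<le> a" "norm (\<phi>1 u - \<phi>1 v0) \<le> a" "norm (\<phi>2 u - \<phi>2 v0) \<le> a" if "u \<in> W" for u
    using that r0(2) r1(2) r2(2) by (auto simp: W_def r_def dist_commute dist_norm norm_minus_commute less_imp_le)
  define X where "X = W \<inter> L"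
  define M where "M = norm (\<phi>2 v0) + a"
  define R0 where "R0 = norm (\<phi>1 v0) + a"
  have pos: "0 < M" "a \<le> R0" "0 \<le> R0" using a by (simp_all add: M_def R0_def add_nonneg_pos)
  have n1: "norm (\<phi>1 u) \<le> R0" if "u \<in> W" for u
    using near(2)[OF that] norm_triangle_sub[of "\<phi>1 u" "\<phi>1 v0"] by (simp add: R0_def)
  have n2: "norm (\<phi>2 u) \<le> M" if "u \<in> W" for u
    using near(3)[OF that] norm_triangle_sub[of "\<phi>2 u" "\<phi>2 v0"] by (simp add: M_def)
  have lin1: "norm (\<phi>1 u - \<phi>1 v - \<phi>2 v0 (u - v)) \<le> a * norm (u - v)" if "u \<in> W" "v \<in> W" for u v
    by (rule blinfun_linearization[OF cW d2 near(3) that(2,1)]) (use WV in auto)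
  have lip1: "norm (\<phi>1 u - \<phi>1 v) \<le> M * norm (u - v)" if "u \<in> W" "v \<in> W" for u v
    using blinfun_linearization[OF cW d2 _ that(2,1), of 0 M] n2 WV by auto
  have lip: "norm (\<phi> u - \<phi> v) \<le> R0 * norm (u - v)" if "u \<in> W" "v \<in> W" for u v
    using blinfun_linearization[OF cW d1 _ that(2,1), of 0 R0] n1 WV by auto
  have taylor: "norm (\<phi> u - \<phi> v - \<phi>1 v (u - v)) \<le> M * (norm (u - v))\<^sup>2" if uv: "u \<in> W" "v \<in> W" for u v
  proof -
    have seg: "closed_segment v u \<subseteq> W" using cW uv by (simp add: closed_segment_subset)
    have "norm (\<phi> u - \<phi> v - \<phi>1 v (u - v)) \<le> (M * norm (u - v)) * norm (u - v)"
    proof (rule blinfun_linearization[OF convex_closed_segment])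
      show "(\<phi> has_derivative blinfun_apply (\<phi>1 y)) (at y)" if "y \<in> closed_segment v u" for y
        using that seg WV d1 by blast
      show "norm (\<phi>1 y - \<phi>1 v) \<le> M * norm (u - v)" if y: "y \<in> closed_segment v u" for y
      proof -
        have "norm (\<phi>1 y - \<phi>1 v) \<le> M * norm (y - v)" using lip1 y seg uv by blast
        also have "\<dots> \<le> M * norm (u - v)" using segment_bound1[OF y] pos by (intro mult_left_mono) auto
        finally show ?thesis .
      qed
    qed auto
    then show ?thesis by (simp add: power2_eq_square)
  qed
  have grad: "regular_gradient L M R0 X (\<lambda>v. \<phi> v \<bullet> w) (\<lambda>v. G v w)" if w: "norm w = 1" for w
    unfolding regular_gradient_def
  proof (intro conjI ballI)
    fix v v' assume v: "v \<in> X" and v': "v' \<in> X"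
    then have vW: "v \<in> W" "v' \<in> W" and vL: "v' - v \<in> L" using L by (auto simp: X_def subspace_diff)
    have "\<phi> v' \<bullet> w - \<phi> v \<bullet> w - G v w \<bullet> (v' - v) = (\<phi> v' - \<phi> v - \<phi>1 v (v' - v)) \<bullet> w"
      using Gl[OF vL] by (simp add: inner_diff_left)
    also have "\<bar>\<dots>\<bar> \<le> norm (\<phi> v' - \<phi> v - \<phi>1 v (v' - v)) * norm w" by (rule Cauchy_Schwarz_ineq2)
    also have "\<dots> \<le> M * (dist v v')\<^sup>2" using taylor[OF vW(2,1)] w by (simp add: dist_norm norm_minus_commute)
    finally show "\<bar>\<phi> v' \<bullet> w - \<phi> v \<bullet> w - G v w \<bullet> (v' - v)\<bar> \<le> M * (dist v v')\<^sup>2" .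
    show "dist (G v w) (G v' w) \<le> M * dist v v'"
      using G_diff[OF w, of v v'] lip1[OF vW] by (simp add: dist_norm)
    show "G v w \<in> L" by (rule GL)
    have "norm (G v w) \<le> norm (\<phi>1 v)" by (rule G_le[OF w])
    also have "\<dots> \<le> R0" by (rule n1[OF vW(1)])
    finally show "norm (G v w) \<le> R0" .
  qed
  have trans: "transversal a X (\<lambda>v. \<phi> v \<bullet> w) (\<lambda>v. G v w)" if w: "norm w = 1" for w
  proof -
    consider (A) "b \<le> \<bar>\<phi> v0 \<bullet> w\<bar>" | (B) "b \<le> norm (G v0 w)" | (C) "\<forall>l\<in>L. b * (norm l)\<^sup>2 \<le> \<bar>\<phi>2 v0 l l \<bullet> w\<bar>"
      using b(2)[OF w] unfolding curved_def by blast
    then show ?thesis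
    proof cases
      case A
      have "a \<le> \<bar>\<phi> v \<bullet> w\<bar>" if "v \<in> X" for v
      proof -
        have "\<bar>\<phi> v \<bullet> w - \<phi> v0 \<bullet> w\<bar> \<le> norm (\<phi> v - \<phi> v0)"
          using Cauchy_Schwarz_ineq2[of "\<phi> v - \<phi> v0" w] w by (simp add: inner_diff_left)
        also have "\<dots> \<le> a" using near(1) that by (simp add: X_def)
        finally show ?thesis using A a by linarith
      qed
      then show ?thesis unfolding transversal_def by blast
    next
      case B
      have "a \<le> norm (G v w)" if "v \<in> X" for v
      proof -
        have "norm (G v0 w - G v w) \<le> norm (\<phi>1 v - \<phi>1 v0)" using G_diff[OF w, of v0 v] by (simp add: norm_minus_commute)
        also have "\<dots> \<le> a" using near(2) that by (simp add: X_def)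
        finally show ?thesis using B a norm_triangle_sub[of "G v0 w" "G v w"] by linarith
      qed
      then show ?thesis unfolding transversal_def by blast
    next
      case C
      have "a * dist v v' \<le> dist (G v w) (G v' w)" if "v \<in> X" "v' \<in> X" for v v'
      proof -
        define l where "l = v - v'"
        have l: "l \<in> L" and vW: "v \<in> W" "v' \<in> W" using that L by (auto simp: X_def l_def subspace_diff)
        \<comment> \<open>The increment of the gradient, paired with \<open>l\<close>, is the
          quadratic form at \<open>v0\<close> up to \<open>E\<close>. The form is at least twice as
          large as the bound for \<open>E\<close>, so the gradient moves by at least
          \<open>a * norm l\<close>.\<close>
        define E where "E = (\<phi>1 v - \<phi>1 v') l - \<phi>2 v0 l l"
        have "E = (\<phi>1 v - \<phi>1 v' - \<phi>2 v0 l) l" by (simp add: E_def blinfun.diff_left)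
        then have "norm E \<le> norm (\<phi>1 v - \<phi>1 v' - \<phi>2 v0 l) * norm l" by (metis norm_blinfun)
        also have "\<dots> \<le> a * norm l * norm l" using lin1[OF vW] by (intro mult_right_mono) (auto simp: l_def)
        finally have "\<bar>E \<bullet> w\<bar> \<le> a * (norm l)\<^sup>2"
          using Cauchy_Schwarz_ineq2[of E w] w by (simp add: power2_eq_square mult.assoc)
        moreover have "(G v w - G v' w) \<bullet> l = \<phi>2 v0 l l \<bullet> w + E \<bullet> w"
          using Gl[OF l] by (simp add: E_def inner_diff_left blinfun.diff_left)
        moreover have "2 * a * (norm l)\<^sup>2 \<le> \<bar>\<phi>2 v0 l l \<bullet> w\<bar>" using C l a(2) by simp
        ultimately have "a * (norm l)\<^sup>2 \<le> \<bar>(G v w - G v' w) \<bullet> l\<bar>" by linarith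
        also have "\<dots> \<le> norm (G v w - G v' w) * norm l" by (rule Cauchy_Schwarz_ineq2)
        finally have "(a * norm l) * norm l \<le> norm (G v w - G v' w) * norm l" by (simp add: power2_eq_square mult.assoc)
        then have "a * norm l \<le> norm (G v w - G v' w)"
          by (cases "l = 0") (auto simp: mult_le_cancel_right)
        then show ?thesis by (simp add: dist_norm l_def)
      qed
      then show ?thesis unfolding transversal_def by blast
    qed
  qed
  \<comment> \<open>The parameter domain has shrunk to \<open>W\<close>, so the neighbourhood of
    \<open>x0\<close> shrinks accordingly, by continuity of the inverse chart.\<close>
  have "continuous_on (\<Sigma> \<inter> U) \<psi>" using hom by (simp add: homeomorphism_def)
  then have "\<exists>d>0. \<forall>y\<in>\<Sigma> \<inter> U. dist y x0 < d \<longrightarrow> dist (\<psi> y) v0 < r"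
    using x U(2) r unfolding continuous_on_iff v0_def by blast
  then obtain d where d: "d > 0" "\<And>y. y \<in> \<Sigma> \<inter> U \<Longrightarrow> dist y x0 < d \<Longrightarrow> dist (\<psi> y) v0 < r" by blast
  have 1: "open (U \<inter> ball x0 d)" "x0 \<in> U \<inter> ball x0 d" using U d by auto
  have 2: "\<Sigma> \<inter> (U \<inter> ball x0 d) \<subseteq> \<phi> ` X"
  proof
    fix y assume y: "y \<in> \<Sigma> \<inter> (U \<inter> ball x0 d)"
    then have "\<psi> y \<in> V \<inter> L" "\<phi> (\<psi> y) = y" using hom by (auto simp: homeomorphism_def)
    moreover have "\<psi> y \<in> W" using d(2)[of y] y by (simp add: W_def dist_commute)
    ultimately show "y \<in> \<phi> ` X" unfolding X_def by (metis IntD2 IntI imageI)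
  qed
  have 3: "inj_on \<phi> X"
  proof (rule inj_on_inverseI)
    show "\<psi> (\<phi> v) = v" if "v \<in> X" for v using that hom WV by (auto simp: X_def homeomorphism_def)
  qed
  have 4: "dist (\<phi> v) (\<phi> v') \<le> R0 * dist v v' \<and> dist v v' \<le> 2 * r" if "v \<in> X" "v' \<in> X" for v v'
  proof -
    have "dist v v0 < r" "dist v' v0 < r" using that by (auto simp: X_def W_def dist_commute)
    then have "dist v v' \<le> 2 * r" using dist_triangle2[of v v' v0] by linarith
    then show ?thesis using lip[of v v'] that by (auto simp: X_def dist_norm)
  qed
  have 5: "\<forall>w. norm w = 1 \<longrightarrow> (\<exists>g. regular_gradient L M R0 X (\<lambda>v. \<phi> v \<bullet> w) g \<and> transversal a X (\<lambda>v. \<phi> v \<bullet> w) g)"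
    using grad trans by blast
  show ?thesis
  proof (intro exI conjI)
    show "\<forall>v\<in>X. \<forall>v'\<in>X. dist (\<phi> v) (\<phi> v') \<le> R0 * dist v v' \<and> dist v v' \<le> 2 * r" using 4 by blast
    show "X \<subseteq> L" by (simp add: X_def)
    show "0 \<le> 2 * r" using r by simp
  qed (fact L 1 2 3 5 pos a)+
qed

section \<open>Kaufman's argument\<close>

text \<open>Pulls weights on the manifold back through the chart and returns a statement free of
  charts: a slab of half-width \<rho> orthogonal to a unit vector has weight at most a constant
  times \<rho>^s. The constant works at every resolution \<open>j\<close>.\<close>

lemma chart_transversality:
  fixes \<Sigma> :: "(real ^ 'm) set"
  assumes k: "2 \<le> k" and M: "C2_submanifold k \<Sigma>" and nd: "nondegenerate \<Sigma>" and x: "x0 \<in> \<Sigma>"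
    and s: "0 < s" "s < 1" and t: "t = real (k - 1) + s"
  shows "\<exists>U K. open U \<and> x0 \<in> U \<and> bounded (\<Sigma> \<inter> U) \<and> 0 < K \<and>
    (\<forall>j P m. dyadic_weights t j P m \<longrightarrow> P \<subseteq> \<Sigma> \<inter> U \<longrightarrow> sum m P \<le> K \<and>
      (\<forall>w \<rho>. norm w = 1 \<longrightarrow> 1 / 2 ^ j \<le> \<rho> \<longrightarrow> sum m {p\<in>P. \<bar>p \<bullet> w\<bar> \<le> \<rho>} \<le> K * \<rho> powr s))"
proof -
  obtain U L X and \<phi> :: "real ^ 'm \<Rightarrow> real ^ 'm" and M R0 a \<Lambda> D where
    U: "open U" "x0 \<in> U" and L: "subspace L" "dim L = k" "X \<subseteq> L" and inj: "inj_on \<phi> X" and im: "\<Sigma> \<inter> U \<subseteq> \<phi> ` X"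
    and lip: "\<forall>v\<in>X. \<forall>v'\<in>X. dist (\<phi> v) (\<phi> v') \<le> \<Lambda> * dist v v' \<and> dist v v' \<le> D"
    and pos: "0 \<le> D" "0 < M" "0 < a" "a \<le> R0" "0 \<le> \<Lambda>"
    and reg: "\<forall>w. norm w = 1 \<longrightarrow> (\<exists>g. regular_gradient L M R0 X (\<lambda>v. \<phi> v \<bullet> w) g \<and> transversal a X (\<lambda>v. \<phi> v \<bullet> w) g)"
    using local_chart[OF M nd x] by (elim exE conjE) (rule that)
  have t0: "t > 0" using t s by simp
  have bd: "bounded (\<phi> ` X)"
    unfolding bounded_two_points
  proof (intro exI[of _ "\<Lambda> * D"] ballI)
    fix y y' assume "y \<in> \<phi> ` X" "y' \<in> \<phi> ` X"
    then obtain v v' where v: "v \<in> X" "v' \<in> X" "y = \<phi> v" "y' = \<phi> v'" by blast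
    then have "dist y y' \<le> \<Lambda> * dist v v'" using lip by blast
    also have "\<dots> \<le> \<Lambda> * D" using lip v pos by (intro mult_left_mono) auto
    finally show "dist y y' \<le> \<Lambda> * D" .
  qed
  define N0 where "N0 = {i. fst i = 0 \<and> dcube i \<inter> \<phi> ` X \<noteq> {}}"
  have finN0: "finite N0" unfolding N0_def by (rule finite_dcubes_meeting[OF bd])
  define T0 where "T0 = real (card N0)"
  have total: "sum m P \<le> T0" if m: "dyadic_weights t j P m" and P: "P \<subseteq> \<Sigma> \<inter> U" for j P m
  proof -
    have Pm: "finite P" "\<And>p. 0 \<le> m p" "\<And>i. fst i \<le> j \<Longrightarrow> sum m (P \<inter> dcube i) \<le> dweight t i"
      using m by (auto simp: dyadic_weights_def)
    have sub: "P \<subseteq> (\<Union>i\<in>N0. P \<inter> dcube i)"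
    proof
      fix p assume p: "p \<in> P"
      then have "(0, \<lambda>j. \<lfloor>2 ^ 0 * p $ j\<rfloor>) \<in> N0" using mem_dcube[of p 0] im P unfolding N0_def by fastforce
      then show "p \<in> (\<Union>i\<in>N0. P \<inter> dcube i)" using p mem_dcube[of p 0] by blast
    qed
    have "sum m P \<le> sum m (\<Union>i\<in>N0. P \<inter> dcube i)" using Pm finN0 sub by (intro sum_mono2) auto
    also have "\<dots> \<le> (\<Sum>i\<in>N0. sum m (P \<inter> dcube i))" using Pm finN0 by (intro sum_UN_le) auto
    also have "\<dots> \<le> (\<Sum>i\<in>N0. 1)"
    proof (intro sum_mono)
      fix i assume "i \<in> N0"
      then have "fst i = 0" by (simp add: N0_def)
      then show "sum m (P \<inter> dcube i) \<le> 1" using Pm(3)[of i] by (simp add: dweight_def)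
    qed
    finally show ?thesis by (simp add: T0_def)
  qed
  \<comment> \<open>The first summand serves images of diameter at most 1, the total mass
    \<open>T0\<close> the larger ones. The factor comes from the Lipschitz constant of the chart;
    its 1 keeps the enlarged radius above the resolution.\<close>
  define C where "C = (3 ^ CARD('m) * 2 powr t + T0) * (\<Lambda> + 1) powr t"
  have T0: "T0 \<ge> 0" by (simp add: T0_def)
  have C: "C \<ge> 0" using T0 by (simp add: C_def)
  obtain K0 where K0: "K0 > 0" "\<forall>f g Q m \<delta> \<rho>. regular_gradient L M R0 X f g \<longrightarrow> transversal a X f g \<longrightarrow>
    spread_weights C t \<delta> Q m \<longrightarrow> \<delta> \<le> \<rho> \<longrightarrow> 0 < \<rho> \<longrightarrow> \<rho> \<le> 1 \<longrightarrow>
    sum m (Q \<inter> {v\<in>X. \<bar>f v\<bar> \<le> \<rho>}) \<le> K0 * \<rho> powr s"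
    using sublevel_weight[OF L(1,3) _ pos(2-4) C s _ _ pos(1), of t] L(2) k t lip by blast
  have spread: "spread_weights C t (1 / 2 ^ j) {v\<in>X. \<phi> v \<in> P} (m \<circ> \<phi>)" if m: "dyadic_weights t j P m" and P: "P \<subseteq> \<Sigma> \<inter> U" for j P m
    unfolding spread_weights_def
  proof (intro conjI allI impI)
    have Pm: "finite P" "\<And>p. 0 \<le> m p" using m by (auto simp: dyadic_weights_def)
    have "\<phi> ` {v\<in>X. \<phi> v \<in> P} \<subseteq> P" by auto
    moreover have "inj_on \<phi> {v\<in>X. \<phi> v \<in> P}" by (rule inj_on_subset[OF inj]) auto
    ultimately show "finite {v\<in>X. \<phi> v \<in> P}" using Pm(1) finite_imageD finite_subset by blast
    show "0 \<le> (m \<circ> \<phi>) p" for p using Pm by simp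
    fix Y :: "(real ^ 'm) set" and r :: real assume Y: "\<forall>x\<in>Y. \<forall>y\<in>Y. dist x y \<le> r" and r: "1 / 2 ^ j \<le> r"
    have r0: "r > 0" using r by (rule less_le_trans[rotated]) simp
    define r' where "r' = (\<Lambda> + 1) * r"
    have "1 * r \<le> r'" unfolding r'_def using pos r0 by (intro mult_right_mono) auto
    then have r': "1 / 2 ^ j \<le> r'" "r' > 0" using r r0 by auto
    define Y' where "Y' = \<phi> ` (Y \<inter> X)"
    have dY': "dist y y' \<le> r'" if "y \<in> Y'" "y' \<in> Y'" for y y'
    proof -
      obtain v v' where v: "v \<in> Y \<inter> X" "v' \<in> Y \<inter> X" "y = \<phi> v" "y' = \<phi> v'" using \<open>y \<in> Y'\<close> \<open>y' \<in> Y'\<close> by (auto simp: Y'_def)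
      then have "dist y y' \<le> \<Lambda> * dist v v'" using lip by blast
      also have "\<dots> \<le> (\<Lambda> + 1) * r" using Y v pos r0 by (intro mult_mono) auto
      finally show ?thesis by (simp add: r'_def)
    qed
    have "sum (m \<circ> \<phi>) ({v\<in>X. \<phi> v \<in> P} \<inter> Y) = sum m (\<phi> ` ({v\<in>X. \<phi> v \<in> P} \<inter> Y))"
      by (rule sum.reindex[symmetric]) (rule inj_on_subset[OF inj], auto)
    also have "\<phi> ` ({v\<in>X. \<phi> v \<in> P} \<inter> Y) = P \<inter> Y'" by (auto simp: Y'_def)
    also have "sum m (P \<inter> Y') \<le> (3 ^ CARD('m) * 2 powr t + T0) * r' powr t"
    proof (cases "r' \<le> 1")
      case True
      have "sum m (P \<inter> Y') \<le> 3 ^ CARD('m) * 2 powr t * r' powr t"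
        by (rule dyadic_weights_small_set[OF m t0 dY' r'(1) True])
      also have "\<dots> \<le> (3 ^ CARD('m) * 2 powr t + T0) * r' powr t" using T0 by (intro mult_right_mono) auto
      finally show ?thesis .
    next
      case False
      have "sum m (P \<inter> Y') \<le> sum m P" using Pm by (intro sum_mono2) auto
      also have "\<dots> \<le> T0 * 1" using total[OF m P] by simp
      also have "\<dots> \<le> (3 ^ CARD('m) * 2 powr t + T0) * r' powr t"
        using T0 False t0 by (intro mult_mono ge_one_powr_ge_zero) auto
      finally show ?thesis .
    qed
    also have "\<dots> = C * r powr t" using pos r0 by (simp add: C_def r'_def powr_mult)
    finally show "sum (m \<circ> \<phi>) ({v\<in>X. \<phi> v \<in> P} \<inter> Y) \<le> C * r powr t" .
  qed
  define K where "K = K0 + T0"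
  have K: "0 < K" "K0 \<le> K" "T0 \<le> K" using K0(1) T0 by (simp_all add: K_def)
  have main: "sum m P \<le> K \<and> (\<forall>w \<rho>. norm w = 1 \<longrightarrow> 1 / 2 ^ j \<le> \<rho> \<longrightarrow> sum m {p\<in>P. \<bar>p \<bullet> w\<bar> \<le> \<rho>} \<le> K * \<rho> powr s)"
    if m: "dyadic_weights t j P m" and P: "P \<subseteq> \<Sigma> \<inter> U" for j P m
  proof (intro conjI allI impI)
    have Pm: "finite P" "\<And>p. 0 \<le> m p" using m by (auto simp: dyadic_weights_def)
    show "sum m P \<le> K" using total[OF m P] K by simp
    fix w :: "real ^ 'm" and \<rho> :: real assume w: "norm w = 1" and \<rho>: "1 / 2 ^ j \<le> \<rho>"
    have \<rho>0: "\<rho> > 0" using \<rho> by (rule less_le_trans[rotated]) simp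
    show "sum m {p\<in>P. \<bar>p \<bullet> w\<bar> \<le> \<rho>} \<le> K * \<rho> powr s"
    proof (cases "\<rho> \<le> 1")
      case True
      obtain g where g: "regular_gradient L M R0 X (\<lambda>v. \<phi> v \<bullet> w) g" "transversal a X (\<lambda>v. \<phi> v \<bullet> w) g" using reg w by blast
      have "sum (m \<circ> \<phi>) ({v\<in>X. \<phi> v \<in> P} \<inter> {v\<in>X. \<bar>\<phi> v \<bullet> w\<bar> \<le> \<rho>}) \<le> K0 * \<rho> powr s"
        using K0(2) g spread[OF m P] \<rho> \<rho>0 True by blast
      moreover have "sum (m \<circ> \<phi>) ({v\<in>X. \<phi> v \<in> P} \<inter> {v\<in>X. \<bar>\<phi> v \<bullet> w\<bar> \<le> \<rho>}) =
          sum m (\<phi> ` ({v\<in>X. \<phi> v \<in> P} \<inter> {v\<in>X. \<bar>\<phi> v \<bullet> w\<bar> \<le> \<rho>}))"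
        by (rule sum.reindex[symmetric]) (rule inj_on_subset[OF inj], auto)
      moreover have "\<phi> ` ({v\<in>X. \<phi> v \<in> P} \<inter> {v\<in>X. \<bar>\<phi> v \<bullet> w\<bar> \<le> \<rho>}) = {p\<in>P. \<bar>p \<bullet> w\<bar> \<le> \<rho>}"
        using P im by auto
      moreover have "K0 * \<rho> powr s \<le> K * \<rho> powr s" using K by (intro mult_right_mono) auto
      ultimately show ?thesis by simp
    next
      case False
      have "sum m {p\<in>P. \<bar>p \<bullet> w\<bar> \<le> \<rho>} \<le> sum m P" using Pm by (intro sum_mono2) auto
      also have "\<dots> \<le> K * 1" using total[OF m P] K by simp
      also have "\<dots> \<le> K * \<rho> powr s" using False K s by (intro mult_left_mono ge_one_powr_ge_zero) auto
      finally show ?thesis .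
    qed
  qed
  have "bounded (\<Sigma> \<inter> U)" by (rule bounded_subset[OF bd im])
  moreover have "\<forall>j P m. dyadic_weights t j P m \<longrightarrow> P \<subseteq> \<Sigma> \<inter> U \<longrightarrow> sum m P \<le> K \<and>
      (\<forall>w \<rho>. norm w = 1 \<longrightarrow> 1 / 2 ^ j \<le> \<rho> \<longrightarrow> sum m {p\<in>P. \<bar>p \<bullet> w\<bar> \<le> \<rho>} \<le> K * \<rho> powr s)"
    by (intro allI impI main)
  ultimately show ?thesis using U K(1) by (intro exI[of _ U] exI[of _ K] conjI)
qed

text \<open>Cauchy-Schwarz over the fibres of a choice of interval: mass in few intervals forces many close pairs.\<close>
lemma close_pairs_weight:
  fixes f :: "'a \<Rightarrow> real" and n :: "'a \<Rightarrow> real"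
  assumes N: "finite N" "\<And>a. 0 \<le> n a" and F: "finite F"
  shows "(sum n {a\<in>N. \<exists>c\<in>F. \<bar>f a - c\<bar> < \<delta>})\<^sup>2 \<le>
    real (card F) * (\<Sum>a\<in>N. \<Sum>b\<in>N. if \<bar>f a - f b\<bar> \<le> 2 * \<delta> then n a * n b else 0)"
proof -
  define Y where "Y = {a\<in>N. \<exists>c\<in>F. \<bar>f a - c\<bar> < \<delta>}"
  \<comment> \<open>Points with the same chosen centre have values within
    \<open>2 * \<delta>\<close> of each other; the fibres of \<open>h\<close> supply the close
    pairs.\<close>
  define h where "h a = (SOME c. c \<in> F \<and> \<bar>f a - c\<bar> < \<delta>)" for a
  have h: "h a \<in> F \<and> \<bar>f a - h a\<bar> < \<delta>" if "a \<in> Y" for a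
    unfolding h_def by (rule someI_ex) (use that in \<open>auto simp: Y_def\<close>)
  have finY: "finite Y" using N by (simp add: Y_def)
  define S where "S c = sum n {a\<in>Y. h a = c}" for c
  have "sum n Y = (\<Sum>c\<in>F. S c)" unfolding S_def
    using h by (intro sum.group[symmetric] finY F) auto
  then have "(sum n Y)\<^sup>2 \<le> real (card F) * (\<Sum>c\<in>F. (S c)\<^sup>2)"
    using sum_squared_le_sum_of_squares[of S F] by (simp add: mult.commute)
  also have "(\<Sum>c\<in>F. (S c)\<^sup>2) = (\<Sum>c\<in>F. \<Sum>a\<in>{a\<in>Y. h a = c}. \<Sum>b\<in>{b\<in>Y. h b = h a}. n a * n b)"
    unfolding S_def power2_eq_square sum_product by (intro sum.cong) auto
  also have "\<dots> = (\<Sum>a\<in>Y. \<Sum>b\<in>{b\<in>Y. h b = h a}. n a * n b)"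
    using h by (intro sum.group finY F) auto
  also have "\<dots> \<le> (\<Sum>a\<in>Y. \<Sum>b\<in>N. if \<bar>f a - f b\<bar> \<le> 2 * \<delta> then n a * n b else 0)"
  proof (intro sum_mono)
    fix a assume a: "a \<in> Y"
    have "(\<Sum>b\<in>{b\<in>Y. h b = h a}. n a * n b) = (\<Sum>b\<in>{b\<in>Y. h b = h a}. if \<bar>f a - f b\<bar> \<le> 2 * \<delta> then n a * n b else 0)"
    proof (intro sum.cong refl)
      fix b assume "b \<in> {b\<in>Y. h b = h a}"
      then have "\<bar>f a - f b\<bar> \<le> 2 * \<delta>" using h[OF a] h[of b] by (simp; linarith)
      then show "n a * n b = (if \<bar>f a - f b\<bar> \<le> 2 * \<delta> then n a * n b else 0)" by simp
    qed
    also have "\<dots> \<le> (\<Sum>b\<in>N. if \<bar>f a - f b\<bar> \<le> 2 * \<delta> then n a * n b else 0)"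
      using N by (intro sum_mono2) (auto simp: Y_def)
    finally show "(\<Sum>b\<in>{b\<in>Y. h b = h a}. n a * n b) \<le> (\<Sum>b\<in>N. if \<bar>f a - f b\<bar> \<le> 2 * \<delta> then n a * n b else 0)" .
  qed
  also have "\<dots> \<le> (\<Sum>a\<in>N. \<Sum>b\<in>N. if \<bar>f a - f b\<bar> \<le> 2 * \<delta> then n a * n b else 0)"
    using N by (intro sum_mono2) (auto simp: Y_def intro!: sum_nonneg)
  finally show ?thesis unfolding Y_def by (simp add: mult_left_mono)
qed

lemma geometric_sum_powr_less:
  fixes \<eta> :: real
  assumes "\<eta> > 0" "finite I"
  shows "(\<Sum>i\<in>I. (1 / 2 ^ i) powr \<eta>) < 1 / (1 - 2 powr - \<eta>)"
proof -
  define x where "x = (2::real) powr - \<eta>"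
  have x: "0 < x" "x < 1" using assms powr_less_mono[of "- \<eta>" 0 2] by (auto simp: x_def)
  have eq: "(1 / 2 ^ i) powr \<eta> = x ^ i" for i :: nat
  proof -
    have "(1 / 2 ^ i :: real) = 2 powr - real i" by (simp add: powr_minus powr_realpow divide_inverse)
    then show ?thesis using x by (simp add: x_def powr_powr mult.commute flip: powr_realpow)
  qed
  obtain n where n: "I \<subseteq> {..<n}" using finite_nat_bounded[OF assms(2)] by blast
  have "(\<Sum>i\<in>I. x ^ i) \<le> (\<Sum>i<n. x ^ i)" using n x by (intro sum_mono2) auto
  also have "\<dots> = (1 - x ^ n) / (1 - x)" using x by (simp add: sum_gp_strict)
  also have "\<dots> < 1 / (1 - x)" using x by (intro divide_strict_right_mono) auto
  finally show ?thesis by (simp add: eq x_def)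
qed

lemma dyadic_bracket:
  assumes "1 / 2 ^ j < (d::real)" "d \<le> 1"
  shows "\<exists>i<j. 1 / 2 ^ Suc i < d \<and> d \<le> 1 / 2 ^ i"
  using assms(1)
proof (induction j)
  case 0
  then show ?case using assms(2) by simp
next
  case (Suc j)
  show ?case
  proof (cases "d \<le> 1 / 2 ^ j")
    case True
    then show ?thesis using Suc.prems by blast
  next
    case False
    then show ?thesis using Suc.IH by (meson less_Suc_eq not_le)
  qed
qed

text \<open>For distinct \<open>a\<close> and \<open>b\<close> the condition says that
  \<open>p\<close> lies in the slab of half-width 2 \<delta> / |a - b| orthogonal to a - b, which
  gives a bound of order (\<delta> / |a - b|)^s. The sum over \<open>i\<close> is a dyadic majorant
  of this kernel, suited to ball estimates; its last term \<open>i = j\<close> accounts for pairs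
  closer than \<delta>, and the extra summand for pairs farther apart than 1.\<close>

lemma pair_weight:
  fixes P :: "'a::real_inner set"
  assumes P: "finite P" "\<And>p. 0 \<le> m p" and tot: "sum m P \<le> K"
    and tr: "\<And>w \<rho>. norm w = 1 \<Longrightarrow> 1 / 2 ^ j \<le> \<rho> \<Longrightarrow> sum m {p\<in>P. \<bar>p \<bullet> w\<bar> \<le> \<rho>} \<le> K * \<rho> powr s"
    and K: "K > 0" and s: "s > 0"
  shows "sum m {p\<in>P. \<bar>a \<bullet> p - b \<bullet> p\<bar> \<le> 2 * (1 / 2 ^ j)} \<le>
    K * 2 powr s * ((\<Sum>i\<le>j. if dist a b \<le> 1 / 2 ^ i then (1 / 2 ^ j * 2 ^ Suc i) powr s else 0) + (1 / 2 ^ j) powr s)"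
proof -
  define \<delta> :: real where "\<delta> = 1 / 2 ^ j"
  define d where "d = dist a b"
  define T where "T i = (if d \<le> 1 / 2 ^ i then (\<delta> * 2 ^ Suc i) powr s else 0)" for i
  define L where "L = sum m {p\<in>P. \<bar>a \<bullet> p - b \<bullet> p\<bar> \<le> 2 * \<delta>}"
  have \<delta>: "\<delta> > 0" by (simp add: \<delta>_def)
  have T0: "T i \<ge> 0" for i by (simp add: T_def)
  have Tle: "T i \<le> (\<Sum>i\<le>j. T i)" if "i \<le> j" for i
    using that T0 by (intro member_le_sum) auto
  have p2: "2 powr s \<ge> 1" using s by (intro ge_one_powr_ge_zero) auto
  have LK: "L \<le> K"
  proof -
    have "L \<le> sum m P" unfolding L_def using P by (intro sum_mono2) auto
    then show ?thesis using tot by simp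
  qed
  have dir: "L \<le> K * \<rho> powr s" if "d > 0" "2 * \<delta> / d \<le> \<rho>" "\<delta> \<le> \<rho>" for \<rho>
  proof -
    define w where "w = (a - b) /\<^sub>R d"
    have w: "norm w = 1" using that by (simp add: w_def d_def dist_norm)
    have "{p\<in>P. \<bar>a \<bullet> p - b \<bullet> p\<bar> \<le> 2 * \<delta>} \<subseteq> {p\<in>P. \<bar>p \<bullet> w\<bar> \<le> \<rho>}"
    proof clarify
      fix p assume "\<bar>a \<bullet> p - b \<bullet> p\<bar> \<le> 2 * \<delta>"
      then have "\<bar>a \<bullet> p - b \<bullet> p\<bar> / d \<le> 2 * \<delta> / d" using that(1) by (intro divide_right_mono) auto
      moreover have "\<bar>p \<bullet> w\<bar> = \<bar>a \<bullet> p - b \<bullet> p\<bar> / d"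
        using that(1) by (simp add: w_def inner_diff_right inner_commute abs_mult divide_inverse mult.commute)
      ultimately show "\<bar>p \<bullet> w\<bar> \<le> \<rho>" using that(2) by linarith
    qed
    then have "L \<le> sum m {p\<in>P. \<bar>p \<bullet> w\<bar> \<le> \<rho>}" unfolding L_def using P by (intro sum_mono2) auto
    also have "\<dots> \<le> K * \<rho> powr s" using tr[OF w] that(3) by (simp add: \<delta>_def)
    finally show ?thesis .
  qed
  have "L \<le> K * 2 powr s * (sum T {..j} + \<delta> powr s)"
  proof -
    consider "d \<le> \<delta>" | "\<delta> < d" "d \<le> 1" | "1 < d" by linarith
    then show ?thesis
    proof cases
      case 1
      then have "T j = 2 powr s" by (simp add: T_def \<delta>_def)
      then have "1 \<le> sum T {..j}" using Tle[of j] p2 by simp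
      then have "1 * 1 \<le> 2 powr s * (sum T {..j} + \<delta> powr s)" using p2 by (intro mult_mono) (auto intro: add_increasing2)
      then have "K * 1 \<le> K * (2 powr s * (sum T {..j} + \<delta> powr s))" using K by (intro mult_left_mono) auto
      then show ?thesis using LK by (simp add: mult.assoc)
    next
      case 2
      then obtain i where i: "i < j" "1 / 2 ^ Suc i < d" "d \<le> 1 / 2 ^ i" using dyadic_bracket[of j d] by (auto simp: \<delta>_def)
      have d0: "d > 0" using 2 \<delta> by linarith
      have "\<delta> * d \<le> 2 * \<delta>" using 2 \<delta> by (simp add: mult.commute)
      then have "\<delta> \<le> 2 * \<delta> / d" using d0 by (simp add: field_simps)
      then have "L \<le> K * (2 * \<delta> / d) powr s" using dir[OF d0 order_refl] by simp
      also have "\<dots> \<le> K * (2 * (\<delta> * 2 ^ Suc i)) powr s"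
      proof (intro mult_left_mono powr_mono2)
        have "1 / d \<le> 2 ^ Suc i" using i(2) d0 by (simp add: field_simps)
        then have "2 * \<delta> * (1 / d) \<le> 2 * \<delta> * 2 ^ Suc i" using \<delta> by (intro mult_left_mono) auto
        then show "2 * \<delta> / d \<le> 2 * (\<delta> * 2 ^ Suc i)" by simp
      qed (use K s \<delta> d0 in auto)
      also have "\<dots> = K * 2 powr s * T i" using i(3) \<delta> powr_mult[of 2 "\<delta> * 2 ^ Suc i" s] by (simp add: T_def)
      also have "\<dots> \<le> K * 2 powr s * (sum T {..j} + \<delta> powr s)"
        using Tle[of i] i(1) K by (intro mult_left_mono) (auto intro: add_increasing2)
      finally show ?thesis .
    next
      case 3
      have "2 * \<delta> / d \<le> 2 * \<delta>" using 3 \<delta> by (simp add: field_simps)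
      then have "L \<le> K * (2 * \<delta>) powr s" using dir[of "2 * \<delta>"] 3 \<delta> by simp
      also have "\<dots> = K * 2 powr s * \<delta> powr s" using \<delta> by (simp add: powr_mult)
      also have "\<dots> \<le> K * 2 powr s * (sum T {..j} + \<delta> powr s)"
        using T0 K by (intro mult_left_mono) (auto intro: add_increasing sum_nonneg)
      finally show ?thesis .
    qed
  qed
  moreover have "sum T {..j} = (\<Sum>i\<le>j. if dist a b \<le> 1 / 2 ^ i then (1 / 2 ^ j * 2 ^ Suc i) powr s else 0)"
    by (intro sum.cong) (auto simp: T_def d_def \<delta>_def)
  ultimately show ?thesis by (simp only: L_def \<delta>_def)
qed

text \<open>The discrete version of the bounded potential: for weights of exponent \<open>s2\<close>
  the kernel |a - b|^-s with s < s2 sums dyadically to a geometric series with ratio 2^-(s2 - s).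
  The far part contributes the total mass.\<close>

lemma kernel_sum:
  fixes N :: "(real ^ 'm) set"
  assumes n: "dyadic_weights s2 J N n" and j: "j \<le> J" and s: "0 < s" "s < s2"
  shows "(\<Sum>b\<in>N. n b * ((\<Sum>i\<le>j. if dist a b \<le> 1 / 2 ^ i then (1 / 2 ^ j * 2 ^ Suc i) powr s else 0) + (1 / 2 ^ j) powr s))
    \<le> (1 / 2 ^ j) powr s * (3 ^ CARD('m) * 2 powr s / (1 - 2 powr - (s2 - s)) + sum n N)"
proof -
  define \<delta> :: real where "\<delta> = 1 / 2 ^ j"
  have \<delta>: "\<delta> > 0" by (simp add: \<delta>_def)
  have N: "finite N" "\<And>b. 0 \<le> n b" using n by (auto simp: dyadic_weights_def)
  have "(\<Sum>b\<in>N. n b * (\<Sum>i\<le>j. if dist a b \<le> 1 / 2 ^ i then (\<delta> * 2 ^ Suc i) powr s else 0))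
      = (\<Sum>i\<le>j. \<Sum>b\<in>N. n b * (if dist a b \<le> 1 / 2 ^ i then (\<delta> * 2 ^ Suc i) powr s else 0))"
    unfolding sum_distrib_left by (rule sum.swap)
  also have "\<dots> \<le> (\<Sum>i\<le>j. \<delta> powr s * (3 ^ CARD('m) * 2 powr s) * (1 / 2 ^ i) powr (s2 - s))"
  proof (intro sum_mono)
    fix i assume i: "i \<in> {..j}"
    have "(\<Sum>b\<in>N. n b * (if dist a b \<le> 1 / 2 ^ i then (\<delta> * 2 ^ Suc i) powr s else 0))
        = (\<Sum>b\<in>N \<inter> {b. dist a b \<le> 1 / 2 ^ i}. n b * (\<delta> * 2 ^ Suc i) powr s)"
      using N by (subst sum.inter_restrict) (auto intro!: sum.cong)
    also have "\<dots> = sum n (N \<inter> {b. dist a b \<le> 1 / 2 ^ i}) * (\<delta> * 2 ^ Suc i) powr s"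
      by (simp add: sum_distrib_right)
    also have "\<dots> \<le> (3 ^ CARD('m) * (1 / 2 ^ i) powr s2) * (\<delta> * 2 ^ Suc i) powr s"
      using i j by (intro mult_right_mono dyadic_weights_ball[OF n]) auto
    also have "\<dots> = \<delta> powr s * (3 ^ CARD('m) * 2 powr s) * (1 / 2 ^ i) powr (s2 - s)"
    proof -
      have 1: "(\<delta> * 2 ^ Suc i) powr s = \<delta> powr s * (2 powr s * (2 ^ i) powr s)" using \<delta> by (simp add: powr_mult)
      have 2: "(1 / 2 ^ i :: real) powr s2 = (1 / 2 ^ i) powr (s2 - s) * (1 / 2 ^ i) powr s" by (simp flip: powr_add)
      have 3: "(1 / 2 ^ i :: real) powr s * (2 ^ i) powr s = 1" by (simp flip: powr_mult)
      have "(3 ^ CARD('m) * (1 / 2 ^ i) powr s2) * (\<delta> * 2 ^ Suc i) powr s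
        = \<delta> powr s * (3 ^ CARD('m) * 2 powr s) * (1 / 2 ^ i) powr (s2 - s) * ((1 / 2 ^ i) powr s * (2 ^ i) powr s)"
        unfolding 1 2 by (simp only: mult_ac)
      then show ?thesis unfolding 3 by simp
    qed
    finally show "(\<Sum>b\<in>N. n b * (if dist a b \<le> 1 / 2 ^ i then (\<delta> * 2 ^ Suc i) powr s else 0))
        \<le> \<delta> powr s * (3 ^ CARD('m) * 2 powr s) * (1 / 2 ^ i) powr (s2 - s)" .
  qed
  also have "\<dots> = \<delta> powr s * (3 ^ CARD('m) * 2 powr s) * (\<Sum>i\<le>j. (1 / 2 ^ i) powr (s2 - s))"
    by (simp add: sum_distrib_left)
  also have "\<dots> \<le> \<delta> powr s * (3 ^ CARD('m) * 2 powr s) * (1 / (1 - 2 powr - (s2 - s)))"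
    using geometric_sum_powr_less[of "s2 - s" "{..j}"] s by (intro mult_left_mono) auto
  finally have 1: "(\<Sum>b\<in>N. n b * (\<Sum>i\<le>j. if dist a b \<le> 1 / 2 ^ i then (\<delta> * 2 ^ Suc i) powr s else 0))
    \<le> \<delta> powr s * (3 ^ CARD('m) * 2 powr s / (1 - 2 powr - (s2 - s)))" by simp
  have "(\<Sum>b\<in>N. n b * ((\<Sum>i\<le>j. if dist a b \<le> 1 / 2 ^ i then (\<delta> * 2 ^ Suc i) powr s else 0) + \<delta> powr s)) =
    (\<Sum>b\<in>N. n b * (\<Sum>i\<le>j. if dist a b \<le> 1 / 2 ^ i then (\<delta> * 2 ^ Suc i) powr s else 0)) + sum n N * \<delta> powr s"
    by (simp add: distrib_left sum.distrib sum_distrib_right)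
  also have "\<dots> \<le> \<delta> powr s * (3 ^ CARD('m) * 2 powr s / (1 - 2 powr - (s2 - s))) + sum n N * \<delta> powr s"
    using 1 by simp
  also have "\<dots> = \<delta> powr s * (3 ^ CARD('m) * 2 powr s / (1 - 2 powr - (s2 - s)) + sum n N)"
    by (simp add: distrib_left mult.commute)
  finally show ?thesis by (simp only: \<delta>_def)
qed

text \<open>Kaufman's double counting at one scale: integrate the number of close pairs over the exceptional directions.\<close>
lemma single_scale_content:
  fixes E :: "(real ^ 'm) set"
  assumes bE: "bounded E"
    and tr: "\<And>P m. dyadic_weights t j P m \<Longrightarrow> P \<subseteq> E \<Longrightarrow> sum m P \<le> K \<and>
      (\<forall>w \<rho>. norm w = 1 \<longrightarrow> 1 / 2 ^ j \<le> \<rho> \<longrightarrow> sum m {p\<in>P. \<bar>p \<bullet> w\<bar> \<le> \<rho>} \<le> K * \<rho> powr s1)"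
    and K: "K > 0" and s1: "0 < s1" "s1 < s2"
    and n: "dyadic_weights s2 J N n" and j: "j \<le> J" and c0: "0 < c0" "c0 \<le> sum n N" and \<mu>: "\<mu> > 0"
    and E: "\<And>p. p \<in> E \<Longrightarrow> \<exists>F. finite F \<and> real (card F) \<le> (2 ^ j) powr s \<and>
      \<mu> * sum n N \<le> sum n {b\<in>N. \<exists>c\<in>F. \<bar>b \<bullet> p - c\<bar> < 1 / 2 ^ j}"
  shows "dcontent t E \<le> ennreal (K * 2 powr s1 * (3 ^ CARD('m) * 2 powr s1 / (1 - 2 powr - (s2 - s1)) / c0 + 1) / \<mu>\<^sup>2 *
    ((2 ^ j) powr s * (1 / 2 ^ j) powr s1))"
proof -
  define \<delta> :: real where "\<delta> = 1 / 2 ^ j"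
  define M where "M = sum n N"
  define G where "G = 3 ^ CARD('m) * 2 powr s1 / (1 - 2 powr - (s2 - s1))"
  have M: "M > 0" "c0 \<le> M" using c0 by (auto simp: M_def)
  have "2 powr - (s2 - s1) < 1" using s1 powr_less_mono[of "- (s2 - s1)" 0 2] by simp
  then have G: "G \<ge> 0" by (simp add: G_def)
  have N: "finite N" "\<And>b. 0 \<le> n b" using n by (auto simp: dyadic_weights_def)
  obtain P m where Pm: "dyadic_weights t j P m" "P \<subseteq> E" "dcontent t E \<le> ennreal (sum m P)"
    using frostman_weights[OF bE, of t j] by blast
  have P: "finite P" "\<And>p. 0 \<le> m p" using Pm(1) by (auto simp: dyadic_weights_def)
  define I where "I p = (\<Sum>a\<in>N. \<Sum>b\<in>N. if \<bar>a \<bullet> p - b \<bullet> p\<bar> \<le> 2 * \<delta> then n a * n b else 0)" for p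
  have low: "(\<mu> * M)\<^sup>2 \<le> (2 ^ j) powr s * I p" if "p \<in> P" for p
  proof -
    have "p \<in> E" using Pm(2) that by blast
    from E[OF this] obtain F where F: "finite F" "real (card F) \<le> (2 ^ j) powr s"
      "\<mu> * M \<le> sum n {b\<in>N. \<exists>c\<in>F. \<bar>b \<bullet> p - c\<bar> < \<delta>}" unfolding M_def \<delta>_def by blast
    have I0: "I p \<ge> 0" unfolding I_def using N by (intro sum_nonneg) auto
    have "(\<mu> * M)\<^sup>2 \<le> (sum n {b\<in>N. \<exists>c\<in>F. \<bar>b \<bullet> p - c\<bar> < \<delta>})\<^sup>2"
      using F(3) \<mu> M by (intro power_mono) auto
    also have "\<dots> \<le> real (card F) * I p" unfolding I_def
      using close_pairs_weight[where f = "\<lambda>b. b \<bullet> p" and \<delta> = \<delta>, OF N F(1)] by simp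
    also have "\<dots> \<le> (2 ^ j) powr s * I p" using F(2) I0 by (intro mult_right_mono) auto
    finally show ?thesis .
  qed
  have "(\<mu> * M)\<^sup>2 * sum m P = (\<Sum>p\<in>P. (\<mu> * M)\<^sup>2 * m p)" by (simp add: sum_distrib_left)
  also have "\<dots> \<le> (\<Sum>p\<in>P. (2 ^ j) powr s * I p * m p)" using low P by (intro sum_mono mult_right_mono) auto
  also have "\<dots> = (2 ^ j) powr s * (\<Sum>p\<in>P. I p * m p)" by (simp add: sum_distrib_left mult.assoc)
  also have "(\<Sum>p\<in>P. I p * m p) = (\<Sum>a\<in>N. \<Sum>b\<in>N. \<Sum>p\<in>P. (if \<bar>a \<bullet> p - b \<bullet> p\<bar> \<le> 2 * \<delta> then n a * n b else 0) * m p)"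
    unfolding I_def sum_distrib_right by (subst sum.swap) (intro sum.cong refl sum.swap)
  also have "\<dots> = (\<Sum>a\<in>N. n a * (\<Sum>b\<in>N. n b * sum m {p\<in>P. \<bar>a \<bullet> p - b \<bullet> p\<bar> \<le> 2 * \<delta>}))"
    using P by (simp add: sum_distrib_left sum.inter_filter mult.assoc if_distrib[of "\<lambda>x. x * _"] if_distrib[of "\<lambda>x. _ * x"] cong: if_cong)
  also have "\<dots> \<le> (\<Sum>a\<in>N. n a * (K * 2 powr s1 * (\<delta> powr s1 * (G + M))))"
  proof (intro sum_mono mult_left_mono N)
    fix a :: "real ^ 'm"
    define T where "T b = (\<Sum>i\<le>j. if dist a b \<le> 1 / 2 ^ i then (1 / 2 ^ j * 2 ^ Suc i) powr s1 else 0) + (1 / 2 ^ j) powr s1" for b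
    have "(\<Sum>b\<in>N. n b * sum m {p\<in>P. \<bar>a \<bullet> p - b \<bullet> p\<bar> \<le> 2 * \<delta>}) \<le> (\<Sum>b\<in>N. n b * (K * 2 powr s1 * T b))"
      unfolding \<delta>_def T_def using tr[OF Pm(1,2)] K s1 P by (intro sum_mono mult_left_mono N pair_weight) blast+
    also have "\<dots> = K * 2 powr s1 * (\<Sum>b\<in>N. n b * T b)" by (simp add: sum_distrib_left mult_ac)
    also have "\<dots> \<le> K * 2 powr s1 * (\<delta> powr s1 * (G + M))"
      using kernel_sum[OF n j s1, of a] K unfolding T_def \<delta>_def G_def M_def by (intro mult_left_mono) auto
    finally show "(\<Sum>b\<in>N. n b * sum m {p\<in>P. \<bar>a \<bullet> p - b \<bullet> p\<bar> \<le> 2 * \<delta>}) \<le> K * 2 powr s1 * (\<delta> powr s1 * (G + M))" .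
  qed
  also have "\<dots> = M * (K * 2 powr s1 * (\<delta> powr s1 * (G + M)))" by (simp add: M_def sum_distrib_right)
  finally have "(\<mu> * M)\<^sup>2 * sum m P \<le> (2 ^ j) powr s * (M * (K * 2 powr s1 * (\<delta> powr s1 * (G + M))))"
    by (simp add: mult_left_mono)
  then have "sum m P \<le> (2 ^ j) powr s * (M * (K * 2 powr s1 * (\<delta> powr s1 * (G + M)))) / (\<mu> * M)\<^sup>2"
    using \<mu> M by (simp add: field_simps)
  \<comment> \<open>The total mass enters as (G + M) / M, so the lower bound \<open>c0\<close>
    controls it, whatever the weights are.\<close>
  also have "\<dots> = K * 2 powr s1 * (G / M + 1) / \<mu>\<^sup>2 * ((2 ^ j) powr s * \<delta> powr s1)"
    using \<mu> M by (simp add: power2_eq_square field_simps)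
  also have "\<dots> \<le> K * 2 powr s1 * (G / c0 + 1) / \<mu>\<^sup>2 * ((2 ^ j) powr s * \<delta> powr s1)"
  proof (intro mult_right_mono divide_right_mono mult_left_mono add_right_mono)
    show "G / M \<le> G / c0" using M c0 G by (intro divide_left_mono) auto
  qed (use K in auto)
  finally have "sum m P \<le> K * 2 powr s1 * (G / c0 + 1) / \<mu>\<^sup>2 * ((2 ^ j) powr s * \<delta> powr s1)" .
  then show ?thesis using Pm(3) order_trans[OF Pm(3) ennreal_leI] unfolding G_def \<delta>_def by blast
qed

section \<open>From covers of the image of Z to a single scale\<close>

lemma finite_sum_half_le: "finite I \<Longrightarrow> (\<Sum>n\<in>I. (1 / 2) ^ Suc n) \<le> (1::real)"
  using sum_le_suminf[OF sums_summable[OF power_half_series], of I] sums_unique[OF power_half_series] by simp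

text \<open>The members of an efficient cover are enlarged to open intervals with dyadic radius. One
  small total serves both claims: it forces each radius to be at most 2^-j0, and it bounds the
  sum.\<close>

lemma dyadic_interval_cover:
  fixes Y :: "real set"
  assumes H: "hausdorff_measure s Y = 0" and s: "0 < s"
  shows "\<exists>(c :: nat \<Rightarrow> real) i. Y \<subseteq> (\<Union>n. {y. \<bar>y - c n\<bar> < 1 / 2 ^ i n}) \<and> (\<forall>n. j0 \<le> i n) \<and>
    (\<forall>I. finite I \<longrightarrow> (\<Sum>n\<in>I. (1 / 2 ^ i n) powr s) \<le> 1)"
proof -
  \<comment> \<open>Rounding to dyadic radii costs \<open>4 powr s\<close>, and the two parts of
    each radius contribute \<open>\<epsilon>\<close> each; the sum then comes out as
    (2^-j0)^s.\<close>
  define \<epsilon> where "\<epsilon> = (1 / 2 ^ j0 :: real) powr s / (2 * 4 powr s)"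
  have \<epsilon>: "\<epsilon> > 0" by (simp add: \<epsilon>_def)
  obtain C where C: "Y \<subseteq> (\<Union>n. C n)" "\<And>n. bounded (C n)" "\<And>n. diameter (C n) \<le> 1 / 4"
    "(\<Sum>n. ennreal (diam_pow s (C n))) < ennreal \<epsilon>"
    by (rule hausdorff_measure_zeroD[OF H \<epsilon>, of "1 / 4"]) auto
  define d where "d n = diameter (C n)" for n
  have d: "0 \<le> d n" "d n \<le> 1 / 4" for n using C(2,3) by (auto simp: d_def diameter_ge_0)
  have dp: "diam_pow s (C n) = d n powr s" for n using s by (simp add: diam_pow_def d_def)
  \<comment> \<open>Adds a positive amount to each diameter, so that sets of diameter 0 also get an
    interval; the total \<open>s\<close>-sum of these additions is at most
    \<open>\<epsilon>\<close>.\<close>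
  define \<tau> where "\<tau> n = (\<epsilon> * (1 / 2) ^ Suc n) powr (1 / s)" for n
  have \<tau>s: "\<tau> n powr s = \<epsilon> * (1 / 2) ^ Suc n" for n using s \<epsilon> by (simp add: \<tau>_def powr_powr)
  have \<tau>0: "\<tau> n > 0" for n using \<epsilon> by (simp add: \<tau>_def)
  have \<tau>1: "\<tau> n < 1 / 4" for n
  proof -
    have "(1 / 2 :: real) ^ Suc n \<le> 1" by (rule power_le_one) auto
    then have "\<tau> n powr s \<le> \<epsilon> * 1" unfolding \<tau>s using \<epsilon> by (intro mult_left_mono) auto
    also have "\<dots> \<le> 1 / (2 * 4 powr s)" unfolding \<epsilon>_def using s by (simp add: divide_right_mono powr_le1)
    also have "\<dots> < 1 / 4 powr s" by (simp add: field_simps)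
    also have "\<dots> = (1 / 4) powr s" by (simp add: powr_divide)
    finally show ?thesis using s \<tau>0[of n] powr_mono2[of s "1 / 4" "\<tau> n"] by linarith
  qed
  have "\<exists>i. 1 / 2 ^ Suc i \<le> d n + \<tau> n \<and> d n + \<tau> n < 1 / 2 ^ i" for n
  proof -
    have e: "0 < d n + \<tau> n" "d n + \<tau> n < 1" using d[of n] \<tau>0[of n] \<tau>1[of n] by auto
    obtain k where "(1 / 2) ^ k < d n + \<tau> n" using real_arch_pow_inv[OF e(1), of "1 / 2"] by auto
    then have ex: "\<exists>k. 1 / 2 ^ k \<le> d n + \<tau> n" by (auto simp: power_divide intro!: exI[of _ k])
    define k where "k = (LEAST k. 1 / 2 ^ k \<le> d n + \<tau> n)"
    have k: "1 / 2 ^ k \<le> d n + \<tau> n" unfolding k_def using ex by (rule LeastI_ex)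
    then have "k \<noteq> 0" using e by (cases k) auto
    then obtain i where i: "k = Suc i" by (cases k) auto
    then have "\<not> 1 / 2 ^ i \<le> d n + \<tau> n" using not_less_Least[of i "\<lambda>k. 1 / 2 ^ k \<le> d n + \<tau> n"] by (simp add: k_def[symmetric])
    then show ?thesis using k i by auto
  qed
  then obtain i where i: "\<And>n. 1 / 2 ^ Suc (i n) \<le> d n + \<tau> n" "\<And>n. d n + \<tau> n < 1 / 2 ^ i n" by metis
  have ile: "(1 / 2 ^ i n) powr s \<le> 4 powr s * (d n powr s + \<tau> n powr s)" for n
  proof -
    have "1 / 2 ^ i n = 2 * (1 / 2 ^ Suc (i n) :: real)" by simp
    moreover have "d n \<le> max (d n) (\<tau> n)" "\<tau> n \<le> max (d n) (\<tau> n)" by simp_all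
    ultimately have "1 / 2 ^ i n \<le> 4 * max (d n) (\<tau> n)" using i(1)[of n] by linarith
    then have "(1 / 2 ^ i n) powr s \<le> (4 * max (d n) (\<tau> n)) powr s" using s by (intro powr_mono2) auto
    also have "\<dots> = 4 powr s * max (d n) (\<tau> n) powr s" using d[of n] by (simp add: powr_mult)
    also have "\<dots> \<le> 4 powr s * (d n powr s + \<tau> n powr s)" by (intro mult_left_mono) (auto simp: max_def)
    finally show ?thesis .
  qed
  have sum_le: "(\<Sum>n\<in>I. (1 / 2 ^ i n) powr s) \<le> (1 / 2 ^ j0) powr s" if I: "finite I" for I
  proof -
    have "(\<Sum>n\<in>I. ennreal (d n powr s)) \<le> (\<Sum>n. ennreal (d n powr s))" using I by (intro sum_le_suminf) auto
    also have "\<dots> \<le> ennreal \<epsilon>" using C(4) by (simp add: dp)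
    finally have 1: "(\<Sum>n\<in>I. d n powr s) \<le> \<epsilon>" using \<epsilon> by (simp add: sum_ennreal ennreal_le_iff)
    have 2: "(\<Sum>n\<in>I. \<tau> n powr s) \<le> \<epsilon> * 1"
      unfolding \<tau>s sum_distrib_left[symmetric] using finite_sum_half_le[OF I] \<epsilon> by (intro mult_left_mono) auto
    have "(\<Sum>n\<in>I. (1 / 2 ^ i n) powr s) \<le> (\<Sum>n\<in>I. 4 powr s * (d n powr s + \<tau> n powr s))" by (intro sum_mono ile)
    also have "\<dots> = 4 powr s * ((\<Sum>n\<in>I. d n powr s) + (\<Sum>n\<in>I. \<tau> n powr s))"
      by (simp add: sum_distrib_left distrib_left sum.distrib)
    also have "\<dots> \<le> 4 powr s * (\<epsilon> + \<epsilon>)" using 1 2 by (intro mult_left_mono) auto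
    also have "\<dots> = (1 / 2 ^ j0) powr s" by (simp add: \<epsilon>_def)
    finally show ?thesis .
  qed
  have 1: "j0 \<le> i n" for n
  proof (rule ccontr)
    assume "\<not> j0 \<le> i n"
    then have "(1 / 2 ^ j0 :: real) < 1 / 2 ^ i n" by (simp add: field_simps)
    then have "(1 / 2 ^ j0 :: real) powr s < (1 / 2 ^ i n) powr s" using s by (intro powr_less_mono2) auto
    then show False using sum_le[of "{n}"] by simp
  qed
  have 2: "(\<Sum>n\<in>I. (1 / 2 ^ i n) powr s) \<le> 1" if I: "finite I" for I
    using sum_le[OF I] powr_le1[of s "1 / 2 ^ j0"] s by simp
  define c where "c n = (SOME y. y \<in> C n)" for n
  have 3: "Y \<subseteq> (\<Union>n. {y. \<bar>y - c n\<bar> < 1 / 2 ^ i n})"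
  proof
    fix y assume "y \<in> Y"
    then obtain n where n: "y \<in> C n" using C(1) by blast
    then have "c n \<in> C n" unfolding c_def by (rule someI)
    then have "dist y (c n) \<le> d n" unfolding d_def using diameter_bounded_bound[OF C(2) n] by blast
    also have "\<dots> < 1 / 2 ^ i n" using i(2)[of n] \<tau>0[of n] by linarith
    finally show "y \<in> (\<Union>n. {y. \<bar>y - c n\<bar> < 1 / 2 ^ i n})" by (auto simp: dist_real_def)
  qed
  show ?thesis
  proof (intro exI conjI allI impI)
    show "Y \<subseteq> (\<Union>n. {y. \<bar>y - c n\<bar> < 1 / 2 ^ i n})" by (fact 3)
  qed (simp_all add: 1 2)
qed

text \<open>The summand 1 keeps the Lipschitz constant positive at \<open>z = 0\<close>, as
  \<open>hausdorff_measure_zero_lipschitz\<close> requires.\<close>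

lemma dist_inner_left_le:
  fixes z :: "'a::real_inner"
  shows "dist (v \<bullet> z) (w \<bullet> z) \<le> (norm z + 1) * dist v w"
proof -
  have "dist (v \<bullet> z) (w \<bullet> z) = \<bar>(v - w) \<bullet> z\<bar>" by (simp add: dist_real_def inner_diff_left)
  also have "\<dots> \<le> norm (v - w) * norm z" by (rule Cauchy_Schwarz_ineq2)
  also have "\<dots> \<le> dist v w * (norm z + 1)" by (simp add: dist_norm mult_left_mono)
  finally show ?thesis by (simp add: mult.commute)
qed

text \<open>Preimages of the intervals under \<open>w \<mapsto> w \<bullet> z\<close> are open slabs
  covering \<open>Z\<close>, so finitely many of them cover some \<open>A k\<close>.\<close>

lemma finite_interval_cover:
  fixes z :: "'a::real_inner"
  assumes comp: "\<forall>\<U>. (\<forall>U\<in>\<U>. open U) \<longrightarrow> Z \<subseteq> \<Union>\<U> \<longrightarrow> (\<exists>(k::nat) \<U>'. finite \<U>' \<and> \<U>' \<subseteq> \<U> \<and> A k \<subseteq> \<Union>\<U>')"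
    and dec: "decseq A" and H: "hausdorff_measure s (dotset Z z) = 0" and s: "s > 0"
  shows "\<exists>J I (c :: nat \<Rightarrow> real) i. finite I \<and> (\<forall>n\<in>I. j0 \<le> i n \<and> i n \<le> J) \<and> (\<Sum>n\<in>I. (1 / 2 ^ i n) powr s) \<le> 1 \<and>
    (\<forall>b\<in>A J. \<exists>n\<in>I. \<bar>b \<bullet> z - c n\<bar> < 1 / 2 ^ i n)"
proof -
  obtain c :: "nat \<Rightarrow> real" and i where c: "dotset Z z \<subseteq> (\<Union>n. {y. \<bar>y - c n\<bar> < 1 / 2 ^ i n})"
    "\<forall>n. j0 \<le> i n" "\<forall>I. finite I \<longrightarrow> (\<Sum>n\<in>I. (1 / 2 ^ i n) powr s) \<le> 1"
    using dyadic_interval_cover[OF H s, of j0] by (elim exE conjE) (rule that)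
  define W where "W n = {w. \<bar>w \<bullet> z - c n\<bar> < 1 / 2 ^ i n}" for n
  have "open (W n)" for n unfolding W_def by (intro open_Collect_less continuous_intros)
  then have op: "\<forall>U\<in>range W. open U" by blast
  have "Z \<subseteq> \<Union>(range W)" using c(1) by (auto simp: W_def dotset_def)
  from mp[OF mp[OF spec[OF comp] op] this]
  obtain k \<U>' where k: "finite \<U>'" "\<U>' \<subseteq> range W" "A k \<subseteq> \<Union>\<U>'" by (elim exE conjE) (rule that)
  obtain I where I: "finite I" "\<U>' = W ` I" using finite_subset_image[OF k(1,2)] by blast
  \<comment> \<open>One number bounds both the index of the approximating set and the scales in use,
    so the increasing union later runs over a single parameter.\<close>
  define J where "J = Max (insert k (i ` I))"
  have J: "k \<le> J" "\<forall>n\<in>I. i n \<le> J" using I(1) by (auto simp: J_def)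
  have "A J \<subseteq> A k" using dec J(1) by (simp add: decseqD)
  then have "\<forall>b\<in>A J. \<exists>n\<in>I. \<bar>b \<bullet> z - c n\<bar> < 1 / 2 ^ i n" using k(3) I(2) by (auto simp: W_def)
  then show ?thesis using I(1) J(2) c(2,3)
    by (intro exI[of _ J] exI[of _ I] exI[of _ c] exI[of _ i]) blast
qed

text \<open>Pigeonhole: the factors \<open>(1 - 2\<^sup>-\<^sup>\<eta>) 2\<^sup>-\<^sup>j\<^sup>\<eta>\<close> sum to less than 1 over the scales \<open>j\<close>.\<close>
lemma heavy_scale:
  fixes z :: "'a::real_inner" and n :: "'a \<Rightarrow> real"
  assumes N: "finite N" "\<And>a. 0 \<le> n a" "0 < sum n N" and \<eta>: "\<eta> > 0"
    and I: "finite I" "\<forall>k\<in>I. j0 \<le> i k \<and> i k \<le> J" "(\<Sum>k\<in>I. (1 / 2 ^ i k) powr s) \<le> 1"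
    and cov: "\<forall>b\<in>N. \<exists>k\<in>I. \<bar>b \<bullet> z - c k\<bar> < 1 / 2 ^ i k"
  shows "\<exists>j\<in>{j0..J}. \<exists>F. finite F \<and> real (card F) \<le> (2 ^ j) powr s \<and>
    (1 - 2 powr - \<eta>) * (1 / 2 ^ j) powr \<eta> * sum n N \<le> sum n {b\<in>N. \<exists>c\<in>F. \<bar>b \<bullet> z - c\<bar> < 1 / 2 ^ j}"
proof (rule ccontr)
  assume neg: "\<not> ?thesis"
  define \<kappa> where "\<kappa> = 1 - 2 powr - \<eta>"
  have \<kappa>: "\<kappa> > 0" using \<eta> powr_less_mono[of "- \<eta>" 0 2] by (simp add: \<kappa>_def)
  \<comment> \<open>The centres of the intervals of scale \<open>j\<close>. Each contributes
    (2^-j)^s to a sum of at most 1, hence there are at most (2^j)^s of them.\<close>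
  define F where "F j = c ` {k\<in>I. i k = j}" for j
  define Y where "Y j = {b\<in>N. \<exists>c\<in>F j. \<bar>b \<bullet> z - c\<bar> < 1 / 2 ^ j}" for j
  have F: "finite (F j)" "real (card (F j)) \<le> (2 ^ j) powr s" for j
  proof -
    show "finite (F j)" using I(1) by (simp add: F_def)
    have "card (F j) \<le> card {k\<in>I. i k = j}" unfolding F_def using I(1) by (intro card_image_le) simp
    then have "real (card (F j)) * (1 / 2 ^ j) powr s \<le> real (card {k\<in>I. i k = j}) * (1 / 2 ^ j) powr s"
      by (intro mult_right_mono) auto
    also have "\<dots> = (\<Sum>k\<in>{k\<in>I. i k = j}. (1 / 2 ^ i k) powr s)" by simp
    also have "\<dots> \<le> (\<Sum>k\<in>I. (1 / 2 ^ i k) powr s)" using I(1) by (intro sum_mono2) auto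
    finally have "real (card (F j)) * (1 / 2 ^ j) powr s \<le> 1" using I(3) by simp
    then show "real (card (F j)) \<le> (2 ^ j) powr s" by (simp add: powr_divide)
  qed
  have small: "sum n (Y j) \<le> \<kappa> * (1 / 2 ^ j) powr \<eta> * sum n N" if "j \<in> {j0..J}" for j
    using neg F[of j] that unfolding Y_def \<kappa>_def by (meson linear)
  have "N \<subseteq> (\<Union>j\<in>{j0..J}. Y j)"
  proof
    fix b assume b: "b \<in> N"
    then obtain k where k: "k \<in> I" "\<bar>b \<bullet> z - c k\<bar> < 1 / 2 ^ i k" using cov by blast
    then have "b \<in> Y (i k)" using b by (auto simp: Y_def F_def)
    then show "b \<in> (\<Union>j\<in>{j0..J}. Y j)" using I(2) k(1) by auto
  qed
  then have "sum n N \<le> sum n (\<Union>j\<in>{j0..J}. Y j)" using N by (intro sum_mono2) (auto simp: Y_def)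
  also have "\<dots> \<le> (\<Sum>j\<in>{j0..J}. sum n (Y j))" using N by (intro sum_UN_le) (auto simp: Y_def)
  also have "\<dots> \<le> (\<Sum>j\<in>{j0..J}. \<kappa> * (1 / 2 ^ j) powr \<eta> * sum n N)" by (intro sum_mono small)
  also have "\<dots> = \<kappa> * sum n N * (\<Sum>j\<in>{j0..J}. (1 / 2 ^ j) powr \<eta>)"
    by (subst sum_distrib_left) (intro sum.cong refl, simp only: mult_ac)
  also have "\<dots> < \<kappa> * sum n N * (1 / \<kappa>)"
    using geometric_sum_powr_less[OF \<eta>, of "{j0..J}"] \<kappa> N(3) unfolding \<kappa>_def by (intro mult_strict_left_mono) auto
  also have "\<dots> = sum n N" using \<kappa> by simp
  finally show False by simp
qed

lemma exceptional_set_locally_null: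
  fixes \<Sigma> Z :: "(real ^ 'm) set"
  assumes k: "2 \<le> k" and M: "C2_submanifold k \<Sigma>" and nd: "nondegenerate \<Sigma>" and x: "x0 \<in> \<Sigma>"
    and Z: "analytic_set Z" "dcontent s2 Z \<noteq> 0" and s: "0 < s" "s < s1" "s1 < s2" "s1 < 1"
  shows "\<exists>U. open U \<and> x0 \<in> U \<and> dcontent (real (k - 1) + s1) {z\<in>\<Sigma> \<inter> U. hausdorff_measure s (dotset Z z) = 0} = 0"
proof -
  define t where "t = real (k - 1) + s1"
  have s1: "0 < s1" using s by simp
  obtain U K where U: "open U" "x0 \<in> U" "bounded (\<Sigma> \<inter> U)" and K: "0 < K"
    and tr: "\<forall>j P m. dyadic_weights t j P m \<longrightarrow> P \<subseteq> \<Sigma> \<inter> U \<longrightarrow> sum m P \<le> K \<and>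
      (\<forall>w \<rho>. norm w = 1 \<longrightarrow> 1 / 2 ^ j \<le> \<rho> \<longrightarrow> sum m {p\<in>P. \<bar>p \<bullet> w\<bar> \<le> \<rho>} \<le> K * \<rho> powr s1)"
    using chart_transversality[OF k M nd x s1 s(4) t_def] by (elim exE conjE) (rule that)
  obtain A c0 where A: "decseq A" "\<forall>k. A k \<subseteq> Z \<and> bounded (A k) \<and> ennreal c0 \<le> dcontent s2 (A k)" "(0::real) < c0"
    and comp: "\<forall>\<U>. (\<forall>U\<in>\<U>. open U) \<longrightarrow> Z \<subseteq> \<Union>\<U> \<longrightarrow> (\<exists>(k::nat) \<U>'. finite \<U>' \<and> \<U>' \<subseteq> \<U> \<and> A k \<subseteq> \<Union>\<U>')"
    using analytic_compact_approximation[OF Z] by (elim exE conjE) (rule that)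
  define E where "E = {z\<in>\<Sigma> \<inter> U. hausdorff_measure s (dotset Z z) = 0}"
  define \<eta> where "\<eta> = (s1 - s) / 4"
  have \<eta>: "\<eta> > 0" using s by (simp add: \<eta>_def)
  define \<kappa> where "\<kappa> = 1 - 2 powr - \<eta>"
  have \<kappa>: "\<kappa> > 0" using \<eta> powr_less_mono[of "- \<eta>" 0 2] by (simp add: \<kappa>_def)
  define B where "B = K * 2 powr s1 * (3 ^ CARD('m) * 2 powr s1 / (1 - 2 powr - (s2 - s1)) / c0 + 1) / \<kappa>\<^sup>2"
  have "2 powr - (s2 - s1) < 1" using s powr_less_mono[of "- (s2 - s1)" 0 2] by simp
  then have B: "B \<ge> 0" using K A(3) by (simp add: B_def)
  have bound: "dcontent t E \<le> ennreal (B / \<kappa> * (1 / 2 ^ j0) powr \<eta>)" for j0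
  proof -
    \<comment> \<open>Increasing in \<open>J\<close>: the range of scales grows, while
      \<open>A J\<close>, the set to be covered, shrinks.\<close>
    define EJ where "EJ J = {z\<in>\<Sigma> \<inter> U. \<exists>I (c :: nat \<Rightarrow> real) i. finite I \<and> (\<forall>n\<in>I. j0 \<le> i n \<and> i n \<le> J) \<and>
      (\<Sum>n\<in>I. (1 / 2 ^ i n) powr s) \<le> 1 \<and> (\<forall>b\<in>A J. \<exists>n\<in>I. \<bar>b \<bullet> z - c n\<bar> < 1 / 2 ^ i n)}" for J
    have "incseq EJ"
      unfolding incseq_def
    proof (intro allI impI subsetI)
      fix J J' z assume J: "J \<le> (J' :: nat)" and z: "z \<in> EJ J"
      then obtain I and c :: "nat \<Rightarrow> real" and i where I: "z \<in> \<Sigma> \<inter> U" "finite I" "\<forall>n\<in>I. j0 \<le> i n \<and> i n \<le> J"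
        "(\<Sum>n\<in>I. (1 / 2 ^ i n) powr s) \<le> 1" "\<forall>b\<in>A J. \<exists>n\<in>I. \<bar>b \<bullet> z - c n\<bar> < 1 / 2 ^ i n"
        unfolding EJ_def by blast
      have "A J' \<subseteq> A J" using A(1) J by (simp add: decseqD)
      then show "z \<in> EJ J'" unfolding EJ_def using I J
        by (intro CollectI conjI exI[of _ I] exI[of _ c] exI[of _ i]) (auto intro: order_trans)
    qed
    moreover have "E \<subseteq> (\<Union>J. EJ J)"
    proof
      fix z assume "z \<in> E"
      then have z: "z \<in> \<Sigma> \<inter> U" "hausdorff_measure s (dotset Z z) = 0" by (auto simp: E_def)
      from finite_interval_cover[OF comp A(1) z(2) s(1), of j0] z(1) show "z \<in> (\<Union>J. EJ J)"
        unfolding EJ_def by blast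
    qed
    ultimately have "dcontent t E \<le> (SUP J. dcontent t (EJ J))"
      using dyadic.content_mono dyadic.content_incseq order_trans by metis
    also have "\<dots> \<le> ennreal (B / \<kappa> * (1 / 2 ^ j0) powr \<eta>)"
    proof (rule SUP_least)
      fix J
      obtain N n where n: "dyadic_weights s2 J N n" "N \<subseteq> A J" "dcontent s2 (A J) \<le> ennreal (sum n N)"
        using frostman_weights[of "A J" s2 J] A(2) by blast
      have N: "finite N" "\<And>a. 0 \<le> n a" using n(1) by (auto simp: dyadic_weights_def)
      have "ennreal c0 \<le> ennreal (sum n N)" using A(2) n(3) order_trans by blast
      then have c0: "c0 \<le> sum n N" using N by (simp add: ennreal_le_iff sum_nonneg)
      \<comment> \<open>What the pigeonhole retains about \<open>z\<close> at scale
        \<open>j\<close>: few intervals that carry a share of order 2^(-j \<eta>) of the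
        mass.\<close>
      define H where "H j = {z\<in>\<Sigma> \<inter> U. \<exists>F. finite F \<and> real (card F) \<le> (2 ^ j) powr s \<and>
        \<kappa> * (1 / 2 ^ j) powr \<eta> * sum n N \<le> sum n {b\<in>N. \<exists>c\<in>F. \<bar>b \<bullet> z - c\<bar> < 1 / 2 ^ j}}" for j
      have "EJ J \<subseteq> (\<Union>j\<in>{j0..J}. H j)"
      proof
        fix z assume "z \<in> EJ J"
        then obtain I and c :: "nat \<Rightarrow> real" and i where I: "z \<in> \<Sigma> \<inter> U" "finite I" "\<forall>n\<in>I. j0 \<le> i n \<and> i n \<le> J"
          "(\<Sum>n\<in>I. (1 / 2 ^ i n) powr s) \<le> 1" "\<forall>b\<in>A J. \<exists>n\<in>I. \<bar>b \<bullet> z - c n\<bar> < 1 / 2 ^ i n"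
          unfolding EJ_def by blast
        have cov: "\<forall>b\<in>N. \<exists>k\<in>I. \<bar>b \<bullet> z - c k\<bar> < 1 / 2 ^ i k" using I(5) n(2) by blast
        have "0 < sum n N" using c0 A(3) by simp
        from heavy_scale[OF N this \<eta> I(2-4) cov] show "z \<in> (\<Union>j\<in>{j0..J}. H j)"
          using I(1) unfolding H_def \<kappa>_def by blast
      qed
      then have "dcontent t (EJ J) \<le> dcontent t (\<Union>j\<in>{j0..J}. H j)" by (rule dyadic.content_mono)
      also have "\<dots> \<le> (\<Sum>j\<in>{j0..J}. dcontent t (H j))" by (rule dyadic.content_UN_finite) simp
      also have "\<dots> \<le> (\<Sum>j\<in>{j0..J}. ennreal (B * (1 / 2 ^ j) powr (2 * \<eta>)))"
      proof (rule sum_mono)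
        fix j assume j: "j \<in> {j0..J}"
        define \<mu> where "\<mu> = \<kappa> * (1 / 2 ^ j) powr \<eta>"
        have \<mu>: "\<mu> > 0" using \<kappa> by (simp add: \<mu>_def)
        have "dcontent t (H j) \<le> ennreal (K * 2 powr s1 * (3 ^ CARD('m) * 2 powr s1 / (1 - 2 powr - (s2 - s1)) / c0 + 1) / \<mu>\<^sup>2 *
          ((2 ^ j) powr s * (1 / 2 ^ j) powr s1))"
        proof (rule single_scale_content[OF _ _ K s1 s(3) n(1) _ A(3) c0 \<mu>])
          show "bounded (H j)" by (rule bounded_subset[OF U(3)]) (auto simp: H_def)
          show "sum m P \<le> K \<and> (\<forall>w \<rho>. norm w = 1 \<longrightarrow> 1 / 2 ^ j \<le> \<rho> \<longrightarrow> sum m {p\<in>P. \<bar>p \<bullet> w\<bar> \<le> \<rho>} \<le> K * \<rho> powr s1)"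
            if "dyadic_weights t j P m" "P \<subseteq> H j" for P m
          proof -
            have "P \<subseteq> \<Sigma> \<inter> U" using that(2) by (auto simp: H_def)
            then show ?thesis using tr that(1) by blast
          qed
          show "j \<le> J" using j by simp
          show "\<exists>F. finite F \<and> real (card F) \<le> (2 ^ j) powr s \<and> \<mu> * sum n N \<le> sum n {b\<in>N. \<exists>c\<in>F. \<bar>b \<bullet> p - c\<bar> < 1 / 2 ^ j}"
            if "p \<in> H j" for p using that unfolding H_def \<mu>_def by blast
        qed
        also have "K * 2 powr s1 * (3 ^ CARD('m) * 2 powr s1 / (1 - 2 powr - (s2 - s1)) / c0 + 1) / \<mu>\<^sup>2 *
          ((2 ^ j) powr s * (1 / 2 ^ j) powr s1) = B * (1 / 2 ^ j) powr (2 * \<eta>)"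
        proof -
          define q where "q = (1 / 2 ^ j :: real)"
          have q: "q > 0" by (simp add: q_def)
          have 1: "\<mu>\<^sup>2 = \<kappa>\<^sup>2 * q powr (2 * \<eta>)"
            using q powr_add[of q \<eta> \<eta>] by (simp add: \<mu>_def q_def[symmetric] power_mult_distrib power2_eq_square)
          have 2: "(2 ^ j) powr s = q powr - s" by (simp add: q_def powr_minus powr_divide)
          have "- s + s1 = 2 * \<eta> + 2 * \<eta>" by (simp add: \<eta>_def field_simps)
          then have "q powr - s * q powr s1 = q powr (2 * \<eta>) * q powr (2 * \<eta>)"
            by (simp only: powr_add[symmetric])
          then show ?thesis unfolding q_def[symmetric] 1 2 using q \<kappa> by (simp add: B_def field_simps)
        qed
        finally show "dcontent t (H j) \<le> ennreal (B * (1 / 2 ^ j) powr (2 * \<eta>))" .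
      qed
      also have "\<dots> = ennreal (\<Sum>j\<in>{j0..J}. B * (1 / 2 ^ j) powr (2 * \<eta>))" using B by (intro sum_ennreal) auto
      also have "\<dots> \<le> ennreal (B / \<kappa> * (1 / 2 ^ j0) powr \<eta>)"
      proof (rule ennreal_leI)
        \<comment> \<open>Half of the remaining decay is spent on a factor that tends to 0 with
          growing \<open>j0\<close>, the other half on summing over \<open>j\<close> independently
          of \<open>J\<close>.\<close>
        have "(\<Sum>j\<in>{j0..J}. B * (1 / 2 ^ j) powr (2 * \<eta>)) \<le> (\<Sum>j\<in>{j0..J}. B * ((1 / 2 ^ j0) powr \<eta> * (1 / 2 ^ j) powr \<eta>))"
        proof (intro sum_mono mult_left_mono B)
          fix j assume j: "j \<in> {j0..J}"
          have "(1 / 2 ^ j :: real) powr (2 * \<eta>) = (1 / 2 ^ j) powr \<eta> * (1 / 2 ^ j) powr \<eta>" by (simp flip: powr_add)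
          also have "\<dots> \<le> (1 / 2 ^ j0) powr \<eta> * (1 / 2 ^ j) powr \<eta>"
            using j \<eta> by (intro mult_right_mono powr_mono2) (auto simp: field_simps)
          finally show "(1 / 2 ^ j :: real) powr (2 * \<eta>) \<le> (1 / 2 ^ j0) powr \<eta> * (1 / 2 ^ j) powr \<eta>" .
        qed
        also have "\<dots> = B * (1 / 2 ^ j0) powr \<eta> * (\<Sum>j\<in>{j0..J}. (1 / 2 ^ j) powr \<eta>)"
          by (simp add: sum_distrib_left mult.assoc)
        also have "\<dots> \<le> B * (1 / 2 ^ j0) powr \<eta> * (1 / \<kappa>)"
          using geometric_sum_powr_less[OF \<eta>, of "{j0..J}"] B unfolding \<kappa>_def by (intro mult_left_mono) auto
        finally show "(\<Sum>j\<in>{j0..J}. B * (1 / 2 ^ j) powr (2 * \<eta>)) \<le> B / \<kappa> * (1 / 2 ^ j0) powr \<eta>" by (simp add: mult_ac)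
      qed
      finally show "dcontent t (EJ J) \<le> ennreal (B / \<kappa> * (1 / 2 ^ j0) powr \<eta>)" .
    qed
    finally show ?thesis .
  qed
  have "(\<lambda>j. 1 / 2 ^ j :: real) \<longlonglongrightarrow> 0" using LIMSEQ_power_zero[of "1 / 2 :: real"] by (simp add: power_divide)
  then have "(\<lambda>j. (1 / 2 ^ j :: real) powr \<eta>) \<longlonglongrightarrow> 0 powr \<eta>"
    using \<eta> by (intro tendsto_powr2) auto
  then have "(\<lambda>j. B / \<kappa> * (1 / 2 ^ j) powr \<eta>) \<longlonglongrightarrow> B / \<kappa> * 0" using \<eta> by (intro tendsto_mult) auto
  then have "(\<lambda>j. ennreal (B / \<kappa> * (1 / 2 ^ j) powr \<eta>)) \<longlonglongrightarrow> ennreal 0" by (intro tendsto_ennrealI) simp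
  then have "dcontent t E \<le> ennreal 0" by (rule LIMSEQ_le_const) (use bound in blast)
  then show ?thesis using U unfolding E_def t_def by (intro exI[of _ U]) simp
qed

section \<open>Hausdorff dimension and globalisation\<close>

lemma hausdorff_dim_le:
  assumes "hausdorff_measure t A = 0" "0 \<le> t"
  shows "hausdorff_dim A \<le> t"
  unfolding hausdorff_dim_def using assms by (intro cInf_lower bdd_belowI[of _ 0]) auto

lemma hausdorff_dim_set_nonempty:
  fixes A :: "'a::euclidean_space set"
  shows "{s. 0 \<le> s \<and> hausdorff_measure s A = 0} \<noteq> {}"
proof -
  have "hausdorff_measure (real DIM('a) + 1) A = 0"
    by (rule hausdorff_measure_zero_subset[OF hausdorff_measure_UNIV]) auto
  then have "real DIM('a) + 1 \<in> {s. 0 \<le> s \<and> hausdorff_measure s A = 0}" by simp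
  then show ?thesis by blast
qed

lemma hausdorff_dim_nonneg: "0 \<le> hausdorff_dim (A :: 'a::euclidean_space set)"
  unfolding hausdorff_dim_def by (rule cInf_greatest[OF hausdorff_dim_set_nonempty]) simp

lemma hausdorff_measure_zero_if_dim_less:
  fixes A :: "'a::euclidean_space set"
  assumes "hausdorff_dim A < t"
  shows "hausdorff_measure t A = 0"
proof -
  from cInf_lessD[OF hausdorff_dim_set_nonempty assms[unfolded hausdorff_dim_def]]
  obtain s where "0 \<le> s" "hausdorff_measure s A = 0" "s < t" by blast
  then show ?thesis using hausdorff_measure_zero_mono[of s A t] by linarith
qed

lemma hausdorff_dim_dotset_le:
  fixes Z :: "'a::euclidean_space set"
  shows "hausdorff_dim (dotset Z z) \<le> min (hausdorff_dim Z) 1"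
proof (rule min.boundedI)
  have le: "hausdorff_dim (dotset Z z) \<le> t" if "hausdorff_dim Z < t" "0 < t" for t
  proof (rule hausdorff_dim_le)
    show "hausdorff_measure t (dotset Z z) = 0" unfolding dotset_def
      by (rule hausdorff_measure_zero_lipschitz[OF hausdorff_measure_zero_if_dim_less[OF that(1)] that(2) _ dist_inner_left_le])
        (simp add: add_nonneg_pos)
  qed (use that in simp)
  have "0 \<le> hausdorff_dim Z" by (rule hausdorff_dim_nonneg)
  show "hausdorff_dim (dotset Z z) \<le> hausdorff_dim Z"
  proof (rule field_le_epsilon)
    fix e :: real assume "e > 0"
    with \<open>0 \<le> hausdorff_dim Z\<close> show "hausdorff_dim (dotset Z z) \<le> hausdorff_dim Z + e"
      by (intro le) linarith+
  qed
  show "hausdorff_dim (dotset Z z) \<le> 1"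
  proof (rule field_le_epsilon)
    fix e :: real assume "e > 0"
    have "hausdorff_measure (1 + e) (dotset Z z) = 0"
      by (rule hausdorff_measure_zero_subset[OF hausdorff_measure_UNIV]) (use \<open>e > 0\<close> in simp_all)
    then show "hausdorff_dim (dotset Z z) \<le> 1 + e" by (rule hausdorff_dim_le) (use \<open>e > 0\<close> in simp)
  qed
qed

lemma exceptional_set_null:
  fixes \<Sigma> Z :: "(real ^ 'm) set"
  assumes k: "2 \<le> k" and M: "C2_submanifold k \<Sigma>" and nd: "nondegenerate \<Sigma>"
    and Z: "analytic_set Z" and s: "0 < s" "s < min (hausdorff_dim Z) 1" and t: "real (k - 1) + s < t"
  shows "hausdorff_measure t {z\<in>\<Sigma>. hausdorff_dim (dotset Z z) < s} = 0"
proof -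
  \<comment> \<open>The exponents \<open>s1\<close> and \<open>s2\<close> divide the gap between
    \<open>s\<close> and \<open>u\<close> into thirds. This keeps s1 below 1, s2 below the dimension
    of \<open>Z\<close>, and k - 1 + s1 below \<open>t\<close>, with the strict gaps on which the
    geometric series rely.\<close>
  define u where "u = min (min (hausdorff_dim Z) 1) (t - real (k - 1))"
  have u: "s < u" "u \<le> hausdorff_dim Z" "u \<le> 1" "u \<le> t - real (k - 1)" using s t by (auto simp: u_def)
  define s1 where "s1 = s + (u - s) / 3"
  define s2 where "s2 = s + 2 * (u - s) / 3"
  have s12: "s < s1" "s1 < s2" "s2 < u" using u(1) by (auto simp: s1_def s2_def field_simps)
  have "hausdorff_measure s2 Z \<noteq> 0"
  proof
    assume "hausdorff_measure s2 Z = 0"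
    from hausdorff_dim_le[OF this] show False using s12 s(1) u by linarith
  qed
  then have c: "dcontent s2 Z \<noteq> 0" using hausdorff_measure_zero_if_dcontent_zero[of s2 Z] s12(1,2) s(1) by auto
  define t1 where "t1 = real (k - 1) + s1"
  have t1: "0 < t1" "t1 \<le> t" using s s12 u by (auto simp: t1_def)
  define E where "E = {z\<in>\<Sigma>. hausdorff_measure s (dotset Z z) = 0}"
  have "\<forall>x\<in>\<Sigma>. \<exists>U. open U \<and> x \<in> U \<and> dcontent t1 {z\<in>\<Sigma> \<inter> U. hausdorff_measure s (dotset Z z) = 0} = 0"
    unfolding t1_def
    by (intro ballI exceptional_set_locally_null[OF k M nd _ Z c s(1) s12(1,2)]) (use s12 u in auto)
  then obtain U where U: "\<forall>x\<in>\<Sigma>. open (U x) \<and> x \<in> U x \<and> dcontent t1 {z\<in>\<Sigma> \<inter> U x. hausdorff_measure s (dotset Z z) = 0} = 0"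
    by (rule bchoice[THEN exE]) (rule that)
  obtain \<U> where \<U>: "\<U> \<subseteq> U ` \<Sigma>" "countable \<U>" "\<Union>\<U> = \<Union>(U ` \<Sigma>)"
  proof (rule Lindelof[of "U ` \<Sigma>"])
    show "open S" if "S \<in> U ` \<Sigma>" for S using that U by blast
  qed (rule that)
  have "hausdorff_measure t1 (\<Union>((\<lambda>V. {z\<in>\<Sigma> \<inter> V. hausdorff_measure s (dotset Z z) = 0}) ` \<U>)) = 0"
  proof (rule hausdorff_measure_zero_Union[OF t1(1)])
    show "countable ((\<lambda>V. {z\<in>\<Sigma> \<inter> V. hausdorff_measure s (dotset Z z) = 0}) ` \<U>)" using \<U>(2) by simp
    fix A assume "A \<in> (\<lambda>V. {z\<in>\<Sigma> \<inter> V. hausdorff_measure s (dotset Z z) = 0}) ` \<U>"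
    then obtain x where "x \<in> \<Sigma>" "A = {z\<in>\<Sigma> \<inter> U x. hausdorff_measure s (dotset Z z) = 0}" using \<U>(1) by blast
    then show "hausdorff_measure t1 A = 0" using hausdorff_measure_zero_if_dcontent_zero[OF t1(1)] U by blast
  qed
  moreover have "E \<subseteq> \<Union>((\<lambda>V. {z\<in>\<Sigma> \<inter> V. hausdorff_measure s (dotset Z z) = 0}) ` \<U>)"
  proof
    fix z assume z: "z \<in> E"
    then have "z \<in> \<Union>(U ` \<Sigma>)" using U by (auto simp: E_def)
    then obtain V where "V \<in> \<U>" "z \<in> V" using \<U>(3) by blast
    then show "z \<in> \<Union>((\<lambda>V. {z\<in>\<Sigma> \<inter> V. hausdorff_measure s (dotset Z z) = 0}) ` \<U>)" using z by (auto simp: E_def)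
  qed
  ultimately have "hausdorff_measure t1 E = 0" by (rule hausdorff_measure_zero_subset)
  then have "hausdorff_measure t E = 0" using hausdorff_measure_zero_mono[of t1 E t] t1 by simp
  moreover have "{z\<in>\<Sigma>. hausdorff_dim (dotset Z z) < s} \<subseteq> E"
    unfolding E_def using hausdorff_measure_zero_if_dim_less by blast
  ultimately show ?thesis by (rule hausdorff_measure_zero_subset)
qed

theorem theorem1p9:
  fixes \<Sigma> Z :: "(real ^ 'm) set" and s :: real
  assumes "CARD('m) \<ge> 4"
    and "C2_submanifold (CARD('m) - 2) \<Sigma>"
    and "nondegenerate \<Sigma>"
    and "analytic_set Z"
    and "0 < s" and "s < min (hausdorff_dim Z) 1"
  shows "hausdorff_dim {z \<in> \<Sigma>. hausdorff_dim (dotset Z z) < s}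
           \<le> real (CARD('m) - 3) + s \<and>
         hausdorff_measure (real (CARD('m) - 2))
           {z \<in> \<Sigma>. hausdorff_dim (dotset Z z) \<noteq> min (hausdorff_dim Z) 1} = 0"
proof
  \<comment> \<open>In terms of n = CARD('m) - 1 these are the dimension n - 1 of the manifold and
    the exponent n - 2; the assumption n >= 3 gives the required k >= 2.\<close>
  have k: "2 \<le> CARD('m) - 2" "CARD('m) - 2 - 1 = CARD('m) - 3" using assms(1) by auto
  have null: "hausdorff_measure t {z \<in> \<Sigma>. hausdorff_dim (dotset Z z) < r} = 0"
    if "0 < r" "r < min (hausdorff_dim Z) 1" "real (CARD('m) - 3) + r < t" for r t
    using exceptional_set_null[OF k(1) assms(2-4) that(1,2)] that(3) k(2) by simp
  show "hausdorff_dim {z \<in> \<Sigma>. hausdorff_dim (dotset Z z) < s} \<le> real (CARD('m) - 3) + s"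
  proof (rule field_le_epsilon)
    fix e :: real assume "e > 0"
    then show "hausdorff_dim {z \<in> \<Sigma>. hausdorff_dim (dotset Z z) < s} \<le> real (CARD('m) - 3) + s + e"
      using null[OF assms(5,6)] assms(5) by (intro hausdorff_dim_le) auto
  qed
  define d where "d = min (hausdorff_dim Z) 1"
  have d: "0 < d" "d \<le> 1" using assms(5,6) by (auto simp: d_def)
  \<comment> \<open>Thresholds increasing to \<open>d\<close>. Each stays strictly below 1, so the
    null set statement applies with the full dimension of the manifold as its exponent.\<close>
  define r where "r n = d * (1 - 1 / (real n + 2))" for n
  have r: "0 < r n" "r n < d" for n using d(1) by (simp_all add: r_def)
  have "hausdorff_measure (real (CARD('m) - 2)) (\<Union>n. {z \<in> \<Sigma>. hausdorff_dim (dotset Z z) < r n}) = 0"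
  proof (rule hausdorff_measure_zero_UN)
    show "0 < real (CARD('m) - 2)" using k by simp
    show "hausdorff_measure (real (CARD('m) - 2)) {z \<in> \<Sigma>. hausdorff_dim (dotset Z z) < r n} = 0" for n
    proof (rule null)
      have "real (CARD('m) - 2) = real (CARD('m) - 3) + 1" using assms(1) by (simp add: of_nat_diff)
      then show "real (CARD('m) - 3) + r n < real (CARD('m) - 2)" using r[of n] d by linarith
    qed (use r[of n] d_def in auto)
  qed
  moreover have "{z \<in> \<Sigma>. hausdorff_dim (dotset Z z) \<noteq> d} \<subseteq> (\<Union>n. {z \<in> \<Sigma>. hausdorff_dim (dotset Z z) < r n})"
  proof clarify
    fix z assume z: "z \<in> \<Sigma>" "hausdorff_dim (dotset Z z) \<noteq> d"
    then have lt: "hausdorff_dim (dotset Z z) < d" using hausdorff_dim_dotset_le[of Z z, folded d_def] by simp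
    have "(\<lambda>n. 1 / real (n + 2)) \<longlonglongrightarrow> 0" by (rule LIMSEQ_ignore_initial_segment[OF lim_1_over_n])
    then have "(\<lambda>n. d * (1 - 1 / real (n + 2))) \<longlonglongrightarrow> d * (1 - 0)" by (intro tendsto_intros)
    then have "r \<longlonglongrightarrow> d" by (simp add: r_def[abs_def] add.commute)
    from order_tendstoD(1)[OF this lt] obtain n where "hausdorff_dim (dotset Z z) < r n"
      by (auto simp: eventually_sequentially)
    then show "z \<in> (\<Union>n. {z \<in> \<Sigma>. hausdorff_dim (dotset Z z) < r n})" using z(1) by blast
  qed
  ultimately show "hausdorff_measure (real (CARD('m) - 2)) {z \<in> \<Sigma>. hausdorff_dim (dotset Z z) \<noteq> min (hausdorff_dim Z) 1} = 0"
    unfolding d_def by (rule hausdorff_measure_zero_subset)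
qed

end
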